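(* Let $\alpha>0$ and let $(\phi,\Omega_\alpha)$ and $(\psi,\Omega'_\alpha)$ be two subdyadic frame pairs. For every $\beta\in\mathbb R$ there exist constants $0<c_\beta\le C_\beta<\infty$ such that, simultaneously for all $1\le p,q\le\infty$ and all $f\in\mathcal S'(\mathbb R^d)$, $$c_\beta\,\|f\|^{(\phi,\Omega_\alpha)}_{M^{p,q}_{\alpha,\beta}}\le\|f\|^{(\psi,\Omega'_\alpha)}_{M^{p,q}_{\alpha,\beta}}\le C_\beta\,\|f\|^{(\phi,\Omega_\alpha)}_{M^{p,q}_{\alpha,\beta}}$$ (with values in $[0,\infty]$). The constants may depend on $d,\alpha,\beta$, on the fixed window data, and on the geometric parameters of the two constructions, but they are independent of $p,q$ and $f$.
   Context: Conventions: $\widehat f(\eta)=\int_{\mathbb R^d}f(t)e^{-it\cdot\eta}\,dt$; $\langle f,g\rangle=\int f\overline g$, extended to a sesquilinear pairing of $\mathcal S'$ with $\mathcal S$; $B(c,r)$ is a Euclidean ball. Subdyadic lattice at scale $\rho\in(0,\rho_0]$. Here $\rho_0,a>0$ are fixed sufficiently small constants and $b>0$ a fixed constant, depending only on $d,\alpha$. For $n\in\mathbb N_0$ let $A_n=\{2^n\le|\xi|<2^{n+1}\}$, $h_n=\rho2^{n(1-\alpha)}$. Partition $\mathbb R^d$ into half-open cubes of side $h_n$ and choose one point of $A_n$ in each cube meeting $A_n$ (candidates). Order all candidates first by $n$ and arbitrarily inside each annulus, and process them in this order, retaining a candidate $\xi$ exactly when the ball $\{|\eta-\xi|<a\rho|\xi|^{1-\alpha}\}$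 is disjoint from all such balls of previously retained candidates. Enumerate the retained points as $\{\xi_k\}_{k\in\mathbb N}$ and set $x_j^k=b\rho|\xi_k|^{\alpha-1}j$, $j\in\mathbb Z^d$; $\Omega_\alpha=\{(x_j^k,\xi_k)\}$. There is a constant $A_{\mathrm{cov}}>1$ depending only on $d,\alpha$ such that the balls $\{|\eta-\xi_k|\le A_{\mathrm{cov}}\rho|\xi_k|^{1-\alpha}\}$ cover $\{|\eta|\ge1\}$. Subdyadic frame pair $(\phi,\Omega_\alpha)$: $\phi\in\mathcal S(\mathbb R^d)$ is real-valued, even, $L^2$-normalized, with $\widehat\phi\in C_c^\infty$, $\operatorname{supp}\widehat\phi\subset B(0,R_1)$, $|\widehat\phi|\ge m_0>0$ on $\{|\zeta|\le R_0\}$, where $3\cdot2^{\max\{\alpha-1,0\}}<R_0<R_1$; and $\Omega_\alpha$ is a subdyadic lattice at a scale $\rho_\ast\le\rho_0$, i.e. $\Omega_\alpha=\{(x_j^k,\xi_k):k\in\mathbb N,\ j\in\mathbb Z^d\}$ where the $\xi_k$ are the centers retained by the selection procedure run with $\rho=\rho_\ast$ and $x_j^k=b\rho_\ast|\xi_k|^{\alpha-1}j$, with $A_{\mathrm{cov}}\rho_\ast<R_0$ and $b\rho_\ast R_1<\pi$. The two pairs in the claim may have different windows, window constants, scales and geometric parameters. Packets: $\phi_{x,\xi}(t)=|\xi|^{\frac d2(1-\alpha)}\phi((t-x)|\xi|^{1-\alpha})e^{it\cdot\xi}$. For a pair $(\phi,\Omega_\alpha)$ and $f\in\mathcal S'(\mathbb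 R^d)$ put $c_{j,k}(f)=\langle f,\phi_{x_j^k,\xi_k}\rangle$ and $$\|f\|^{(\phi,\Omega_\alpha)}_{M^{p,q}_{\alpha,\beta}}=\Big(\sum_k\Big(\sum_{j\in\mathbb Z^d}|c_{j,k}(f)|^p\Big)^{q/p}(1+|\xi_k|)^{\beta q}\Big)^{1/q},$$ with suprema in place of sums if $p$ or $q$ is infinite. *)

theory Defs
  imports "HOL-Analysis.Analysis"
begin

text \<open>The dimension is \<open>d = CARD('n)\<close>; functions on \<open>\<real>\<^sup>d\<close> are functions on \<open>real ^ 'n\<close>.\<close>

section \<open>Schwartz functions and tempered distributions\<close>

definition partial_deriv :: "'n::finite \<Rightarrow> (real ^ 'n \<Rightarrow> complex) \<Rightarrow> real ^ 'n \<Rightarrow> complex" where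
  "partial_deriv i g = (\<lambda>t. frechet_derivative g (at t) (axis i 1))"

text \<open>Iterated partial derivatives are indexed by lists of coordinates instead of multi-indices;
  for smooth functions the order in the list is irrelevant.\<close>

definition partial_derivs :: "'n::finite list \<Rightarrow> (real ^ 'n \<Rightarrow> complex) \<Rightarrow> real ^ 'n \<Rightarrow> complex" where
  "partial_derivs is g = foldr partial_deriv is g"

text \<open>If every iterated partial derivative is (Frechet) differentiable everywhere, then all of them
  are continuous, so this is \<open>C\<^sup>\<infinity>\<close>.\<close>

definition smooth :: "(real ^ 'n::finite \<Rightarrow> complex) \<Rightarrow> bool" where
  "smooth g \<longleftrightarrow> (\<forall>is t. partial_derivs is g differentiable (at t))"

definition schwartz_seminorm :: "nat \<Rightarrow> 'n::finite list \<Rightarrow> (real ^ 'n \<Rightarrow> complex) \<Rightarrow> real" where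
  "schwartz_seminorm N is g = (SUP t. (1 + norm t) ^ N * cmod (partial_derivs is g t))"

definition schwartz :: "(real ^ 'n::finite \<Rightarrow> complex) set" where
  "schwartz = {g. smooth g \<and>
     (\<forall>N is. bdd_above (range (\<lambda>t. (1 + norm t) ^ N * cmod (partial_derivs is g t))))}"

text \<open>Linear functionals on the Schwartz space that are continuous with respect to the seminorms.
  The values of \<open>T\<close> outside the Schwartz space are irrelevant.\<close>

definition tempered_distribution :: "((real ^ 'n::finite \<Rightarrow> complex) \<Rightarrow> complex) \<Rightarrow> bool" where
  "tempered_distribution T \<longleftrightarrow>
     (\<forall>g\<in>schwartz. \<forall>h\<in>schwartz. T (\<lambda>t. g t + h t) = T g + T h) \<and>
     (\<forall>c. \<forall>g\<in>schwartz. T (\<lambda>t. c * g t) = c * T g) \<and>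
     (\<exists>C N m. \<forall>g\<in>schwartz.
        cmod (T g) \<le> C * (\<Sum>is | length is \<le> m. schwartz_seminorm N is g))"

text \<open>The sesquilinear pairing of a distribution with a Schwartz function, extending
  \<open>\<integral> f * cnj g\<close>.\<close>

definition pairing :: "((real ^ 'n::finite \<Rightarrow> complex) \<Rightarrow> complex) \<Rightarrow> (real ^ 'n \<Rightarrow> complex) \<Rightarrow> complex" where
  "pairing T g = T (\<lambda>t. cnj (g t))"

definition fourier :: "(real ^ 'n::finite \<Rightarrow> complex) \<Rightarrow> real ^ 'n \<Rightarrow> complex" where
  "fourier g \<eta> = (LINT t|lborel. g t * exp (- (\<i> * complex_of_real (t \<bullet> \<eta>))))"

section \<open>Subdyadic lattices\<close>

definition annulus :: "nat \<Rightarrow> (real ^ 'n::finite) set" where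
  "annulus n = {\<xi>. 2 ^ n \<le> norm \<xi> \<and> norm \<xi> < 2 ^ (n + 1)}"

definition mesh :: "real \<Rightarrow> real \<Rightarrow> nat \<Rightarrow> real" where
  "mesh \<alpha> \<rho> n = \<rho> * 2 powr (real n * (1 - \<alpha>))"

definition half_open_cube :: "real \<Rightarrow> (real ^ 'n::finite) set \<Rightarrow> bool" where
  "half_open_cube h Q \<longleftrightarrow> (\<exists>c. Q = {x. \<forall>i. c $ i \<le> x $ i \<and> x $ i < c $ i + h})"

text \<open>\<open>C\<close> arises by choosing one point of the annulus in each cube that meets it. The partition
  into cubes is arbitrary; it need not be the standard grid.\<close>

definition candidate_set :: "real \<Rightarrow> real \<Rightarrow> nat \<Rightarrow> (real ^ 'n::finite) set \<Rightarrow> bool" where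
  "candidate_set \<alpha> \<rho> n C \<longleftrightarrow>
     (\<exists>P g. partition_on UNIV P \<and> (\<forall>Q\<in>P. half_open_cube (mesh \<alpha> \<rho> n) Q) \<and>
        (\<forall>Q\<in>P. Q \<inter> annulus n \<noteq> {} \<longrightarrow> g Q \<in> Q \<inter> annulus n) \<and>
        C = g ` {Q \<in> P. Q \<inter> annulus n \<noteq> {}})"

text \<open>Each annulus contains finitely many candidates, so a processing order is an enumeration
  by \<open>nat\<close>.\<close>

definition candidate_order :: "real \<Rightarrow> real \<Rightarrow> (nat \<Rightarrow> real ^ 'n::finite) \<Rightarrow> bool" where
  "candidate_order \<alpha> \<rho> e \<longleftrightarrow>
     (\<exists>C. (\<forall>n. candidate_set \<alpha> \<rho> n (C n)) \<and> bij_betw e UNIV (\<Union>n. C n)) \<and>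
     (\<forall>i j m n. i < j \<and> e i \<in> annulus m \<and> e j \<in> annulus n \<longrightarrow> m \<le> n)"

definition separation_ball :: "real \<Rightarrow> real \<Rightarrow> real \<Rightarrow> real ^ 'n::finite \<Rightarrow> (real ^ 'n) set" where
  "separation_ball \<alpha> a \<rho> \<xi> = ball \<xi> (a * \<rho> * norm \<xi> powr (1 - \<alpha>))"

text \<open>The points retained among the first \<open>i\<close> candidates.\<close>

primrec retained ::
    "real \<Rightarrow> real \<Rightarrow> real \<Rightarrow> (nat \<Rightarrow> real ^ 'n::finite) \<Rightarrow> nat \<Rightarrow> (real ^ 'n) set" where
  "retained \<alpha> a \<rho> e 0 = {}"
| "retained \<alpha> a \<rho> e (Suc i) =
     (if \<forall>\<zeta>\<in>retained \<alpha> a \<rho> e i. separation_ball \<alpha> a \<rho> (e i) \<inter> separation_ball \<alpha> a \<rho> \<zeta> = {}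
      then insert (e i) (retained \<alpha> a \<rho> e i) else retained \<alpha> a \<rho> e i)"

text \<open>\<open>\<xi>\<close> enumerates the points retained in some run of the selection procedure at scale \<open>\<rho>\<close>.\<close>

definition subdyadic_centers :: "real \<Rightarrow> real \<Rightarrow> real \<Rightarrow> (nat \<Rightarrow> real ^ 'n::finite) \<Rightarrow> bool" where
  "subdyadic_centers \<alpha> a \<rho> \<xi> \<longleftrightarrow>
     (\<exists>e. candidate_order \<alpha> \<rho> e \<and> bij_betw \<xi> UNIV (\<Union>i. retained \<alpha> a \<rho> e i))"

text \<open>The nodes \<open>x k j\<close> stand for $x_j^k$.\<close>

definition subdyadic_lattice :: "real \<Rightarrow> real \<Rightarrow> real \<Rightarrow> real \<Rightarrow>
    (nat \<Rightarrow> int ^ 'n \<Rightarrow> real ^ 'n) \<Rightarrow> (nat \<Rightarrow> real ^ 'n::finite) \<Rightarrow> bool" where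
  "subdyadic_lattice \<alpha> a b \<rho> x \<xi> \<longleftrightarrow> subdyadic_centers \<alpha> a \<rho> \<xi> \<and>
     (\<forall>k j. x k j = (b * \<rho> * norm (\<xi> k) powr (\<alpha> - 1)) *\<^sub>R (\<chi> i. real_of_int (j $ i)))"

text \<open>The constants of a construction: the largest scale \<open>rho0\<close>, the separation constant \<open>sep\<close>
  (written \<open>a\<close> in formulas), the spatial step \<open>stp\<close> (written \<open>b\<close>), the covering constant \<open>Acov\<close>,
  the scale \<open>rho\<close> actually used, and the window constants \<open>R0\<close>, \<open>R1\<close>, \<open>m0\<close>.\<close>

record frame_params =
  rho0 :: real
  sep :: real
  stp :: real
  Acov :: real
  rho :: real
  R0 :: real
  R1 :: real
  m0 :: real

text \<open>The smallness of \<open>rho0\<close> and \<open>sep\<close> is expressed by the covering property that it guarantees;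
  the lemma \<open>geometry_if_small\<close> below shows that all sufficiently small values
  are admissible, with a covering constant depending only on the dimension and \<open>\<alpha>\<close>.\<close>

definition subdyadic_geometry :: "'n::finite itself \<Rightarrow> real \<Rightarrow> frame_params \<Rightarrow> bool" where
  "subdyadic_geometry _ \<alpha> D \<longleftrightarrow>
     0 < rho0 D \<and> 0 < sep D \<and> 0 < stp D \<and> 1 < Acov D \<and>
     (\<forall>\<rho> (\<xi> :: nat \<Rightarrow> real ^ 'n). 0 < \<rho> \<and> \<rho> \<le> rho0 D \<and> subdyadic_centers \<alpha> (sep D) \<rho> \<xi> \<longrightarrow>
        {\<eta>. 1 \<le> norm \<eta>} \<subseteq> (\<Union>k. cball (\<xi> k) (Acov D * \<rho> * norm (\<xi> k) powr (1 - \<alpha>))))"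

section \<open>Frame pairs and packet norms\<close>

definition subdyadic_window :: "real \<Rightarrow> frame_params \<Rightarrow> (real ^ 'n::finite \<Rightarrow> complex) \<Rightarrow> bool" where
  "subdyadic_window \<alpha> D \<phi> \<longleftrightarrow>
     \<phi> \<in> schwartz \<and> (\<forall>t. \<phi> t \<in> \<real>) \<and> (\<forall>t. \<phi> (- t) = \<phi> t) \<and>
     (LINT t|lborel. (cmod (\<phi> t))\<^sup>2) = 1 \<and>
     smooth (fourier \<phi>) \<and> compact (closure {\<zeta>. fourier \<phi> \<zeta> \<noteq> 0}) \<and>
     closure {\<zeta>. fourier \<phi> \<zeta> \<noteq> 0} \<subseteq> ball 0 (R1 D) \<and>
     0 < m0 D \<and> (\<forall>\<zeta>. norm \<zeta> \<le> R0 D \<longrightarrow> m0 D \<le> cmod (fourier \<phi> \<zeta>)) \<and>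
     3 * 2 powr (max (\<alpha> - 1) 0) < R0 D \<and> R0 D < R1 D"

definition subdyadic_frame_pair :: "real \<Rightarrow> frame_params \<Rightarrow> (real ^ 'n::finite \<Rightarrow> complex) \<Rightarrow>
    (nat \<Rightarrow> int ^ 'n \<Rightarrow> real ^ 'n) \<Rightarrow> (nat \<Rightarrow> real ^ 'n) \<Rightarrow> bool" where
  "subdyadic_frame_pair \<alpha> D \<phi> x \<xi> \<longleftrightarrow>
     subdyadic_geometry TYPE('n) \<alpha> D \<and> subdyadic_window \<alpha> D \<phi> \<and>
     0 < rho D \<and> rho D \<le> rho0 D \<and>
     Acov D * rho D < R0 D \<and> stp D * rho D * R1 D < pi \<and>
     subdyadic_lattice \<alpha> (sep D) (stp D) (rho D) x \<xi>"

definition packet :: "real \<Rightarrow> (real ^ 'n::finite \<Rightarrow> complex) \<Rightarrow> real ^ 'n \<Rightarrow> real ^ 'n \<Rightarrow> real ^ 'n \<Rightarrow> complex" where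
  "packet \<alpha> \<phi> x \<xi> = (\<lambda>t.
     complex_of_real (norm \<xi> powr (real CARD('n) / 2 * (1 - \<alpha>))) *
     \<phi> (norm \<xi> powr (1 - \<alpha>) *\<^sub>R (t - x)) * exp (\<i> * complex_of_real (t \<bullet> \<xi>)))"

text \<open>Real powers on \<open>[0, \<infinity>]\<close>, used for exponents \<open>r > 0\<close> only.\<close>

definition ennpow :: "ennreal \<Rightarrow> real \<Rightarrow> ennreal" where
  "ennpow y r = (if y = \<infinity> then \<infinity> else ennreal (enn2real y powr r))"

definition lp_norm :: "ennreal \<Rightarrow> ('i \<Rightarrow> ennreal) \<Rightarrow> ennreal" where
  "lp_norm p u = (if p = \<infinity> then (SUP i. u i)
     else ennpow (\<Sum>\<^sub>\<infinity>i\<in>UNIV. ennpow (u i) (enn2real p)) (1 / enn2real p))"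

text \<open>For finite \<open>q\<close>, the \<open>q\<close>-th power of the \<open>k\<close>-th entry of the outer sequence is
  $(\sum_j |c_{j,k}|^p)^{q/p} (1 + |\xi_k|)^{\beta q}$.\<close>

definition M_norm :: "real \<Rightarrow> real \<Rightarrow> ennreal \<Rightarrow> ennreal \<Rightarrow> (real ^ 'n::finite \<Rightarrow> complex) \<Rightarrow>
    (nat \<Rightarrow> int ^ 'n \<Rightarrow> real ^ 'n) \<Rightarrow> (nat \<Rightarrow> real ^ 'n) \<Rightarrow>
    ((real ^ 'n \<Rightarrow> complex) \<Rightarrow> complex) \<Rightarrow> ennreal" where
  "M_norm \<alpha> \<beta> p q \<phi> x \<xi> f =
     lp_norm q (\<lambda>k. lp_norm p (\<lambda>j. ennreal (cmod (pairing f (packet \<alpha> \<phi> (x k j) (\<xi> k))))) *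
                    ennreal ((1 + norm (\<xi> k)) powr \<beta>))"

section \<open>Sufficiently small parameters are admissible\<close>

lemma norm_powr_comparable:
  fixes x y s :: real
  assumes "0 < x" "0 < y" "x \<le> 2 * y" "y \<le> 2 * x"
  shows "x powr s \<le> 2 powr \<bar>s\<bar> * y powr s"
proof (cases "0 \<le> s")
  case True
  have "x powr s \<le> (2 * y) powr s"
    using assms True by (intro powr_mono2) auto
  with True assms show ?thesis by (simp add: powr_mult)
next
  case False
  have "x powr s \<le> (y / 2) powr s"
    using assms False by (intro powr_mono2') auto
  also have "\<dots> = 2 powr \<bar>s\<bar> * y powr s"
    using False assms by (simp add: powr_divide powr_minus field_simps)
  finally show ?thesis .
qed

lemma annulus_ex:
  fixes \<eta> :: "real ^ 'n::finite"
  assumes "1 \<le> norm \<eta>"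
  shows "\<exists>n. \<eta> \<in> annulus n"
proof -
  define n where "n = nat \<lfloor>log 2 (norm \<eta>)\<rfloor>"
  have l: "0 \<le> log 2 (norm \<eta>)" using assms by (intro zero_le_log_cancel_iff[THEN iffD2]) auto
  then have "real n \<le> log 2 (norm \<eta>)" "log 2 (norm \<eta>) < real (n + 1)"
    unfolding n_def by linarith+
  then have "2 powr real n \<le> norm \<eta>" "norm \<eta> < 2 powr real (n + 1)"
    using assms le_log_iff[of 2 "norm \<eta>"] log_less_iff[of 2 "norm \<eta>"] by fastforce+
  then have "\<eta> \<in> annulus n"
    by (simp add: annulus_def powr_realpow powr_add)
  then show ?thesis ..
qed

lemma half_open_cube_norm_le:
  fixes x y :: "real ^ 'n::finite"
  assumes "half_open_cube h Q" "x \<in> Q" "y \<in> Q"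
  shows "norm (x - y) \<le> real CARD('n) * h"
proof -
  have "\<bar>(x - y) $ i\<bar> \<le> h" for i
  proof -
    obtain c where c: "\<forall>i. c $ i \<le> x $ i \<and> x $ i < c $ i + h"
        "\<forall>i. c $ i \<le> y $ i \<and> y $ i < c $ i + h"
      using assms by (auto simp: half_open_cube_def)
    from c(1)[rule_format, of i] c(2)[rule_format, of i] show ?thesis
      by (simp add: abs_le_iff)
  qed
  then have "(\<Sum>i\<in>UNIV. \<bar>(x - y) $ i\<bar>) \<le> (\<Sum>i\<in>(UNIV::'n set). h)"
    by (intro sum_mono)
  then show ?thesis
    using norm_le_l1_cart[of "x - y"] by simp
qed

lemma candidate_set_subset:
  assumes "candidate_set \<alpha> \<rho> n C"
  shows "C \<subseteq> annulus n"
proof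
  fix y assume "y \<in> C"
  obtain P g where P: "\<forall>Q\<in>P. Q \<inter> annulus n \<noteq> {} \<longrightarrow> g Q \<in> Q \<inter> annulus n"
      "C = g ` {Q \<in> P. Q \<inter> annulus n \<noteq> {}}"
    using assms unfolding candidate_set_def by (elim exE conjE)
  have "y \<in> g ` {Q \<in> P. Q \<inter> annulus n \<noteq> {}}" using \<open>y \<in> C\<close> by (simp only: P(2))
  then obtain Q where "Q \<in> {Q \<in> P. Q \<inter> annulus n \<noteq> {}}" "y = g Q" by (rule imageE)
  with P(1) show "y \<in> annulus n" by blast
qed

lemma candidate_set_near:
  assumes "candidate_set \<alpha> \<rho> n C" "\<eta> \<in> annulus n"
  shows "\<exists>Q y. half_open_cube (mesh \<alpha> \<rho> n) Q \<and> \<eta> \<in> Q \<and> y \<in> Q \<and> y \<in> C"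
proof -
  obtain P g where P: "partition_on UNIV P" "\<forall>Q\<in>P. half_open_cube (mesh \<alpha> \<rho> n) Q"
      "\<forall>Q\<in>P. Q \<inter> annulus n \<noteq> {} \<longrightarrow> g Q \<in> Q \<inter> annulus n"
      "C = g ` {Q \<in> P. Q \<inter> annulus n \<noteq> {}}"
    using assms(1) unfolding candidate_set_def by (elim exE conjE)
  have "\<eta> \<in> \<Union>P" using P(1) by (simp add: partition_on_def)
  then obtain Q where Q: "Q \<in> P" "\<eta> \<in> Q" by blast
  have ne: "Q \<inter> annulus n \<noteq> {}" using Q(2) assms(2) by blast
  have "g Q \<in> C" unfolding P(4) using Q(1) ne by (intro imageI) simp
  moreover have "g Q \<in> Q" using P(3) Q(1) ne by blast
  ultimately show ?thesis using P(2) Q by blast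
qed

lemma geometry_if_small:
  fixes \<alpha> :: real
  assumes "0 < \<alpha>"
  shows "\<exists>\<delta>>0. \<exists>A>1. \<forall>D. 0 < rho0 D \<and> rho0 D \<le> \<delta> \<and> 0 < sep D \<and> sep D \<le> \<delta> \<and> 0 < stp D \<and> Acov D = A
           \<longrightarrow> subdyadic_geometry TYPE('n::finite) \<alpha> D"
proof -
  define s where "s = 1 - \<alpha>"
  define K where "K = (2::real) powr \<bar>s\<bar>"
  have K: "K \<ge> 1" by (simp add: K_def ge_one_powr_ge_zero)
  define d where "d = real CARD('n)"
  have d: "d \<ge> 1" by (simp add: d_def Suc_le_eq)
  define A where "A = d * K * K + K + 1"
  have dK: "0 < d * K * K" "d * K \<le> d * K * K" using d K by auto
  have cover: "\<eta> \<in> (\<Union>k. cball (\<xi> k) (A * \<rho> * norm (\<xi> k) powr s))"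
    if a: "0 < a" "a \<le> 1/2" and \<rho>: "0 < \<rho>" "\<rho> \<le> 1/2"
      and cen: "subdyadic_centers \<alpha> a \<rho> \<xi>" and \<eta>: "1 \<le> norm \<eta>"
    for a \<rho> and \<xi> :: "nat \<Rightarrow> real ^ 'n" and \<eta>
  proof -
    obtain e where e: "candidate_order \<alpha> \<rho> e"
      and bij: "bij_betw \<xi> UNIV (\<Union>i. retained \<alpha> a \<rho> e i)"
      using cen by (auto simp: subdyadic_centers_def)
    obtain C where C: "\<And>n. candidate_set \<alpha> \<rho> n (C n)" "bij_betw e UNIV (\<Union>n. C n)"
      using e by (auto simp: candidate_order_def)
    have norm_e: "1 \<le> norm (e i)" for i
    proof -
      have "e i \<in> (\<Union>n. C n)" using C(2) by (auto simp: bij_betw_def)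
      then obtain n where "e i \<in> C n" by blast
      then have "e i \<in> annulus n" using candidate_set_subset[OF C(1)] by blast
      then show ?thesis unfolding annulus_def
        using one_le_power[of "2::real" n] by (simp, linarith)
    qed
    have ret: "\<zeta> \<in> range e" if "\<zeta> \<in> retained \<alpha> a \<rho> e i" for \<zeta> i
      using that by (induction i) (auto split: if_splits)
    obtain n where n: "\<eta> \<in> annulus n" using annulus_ex[OF \<eta>] by blast
    obtain Q y where Q: "half_open_cube (mesh \<alpha> \<rho> n) Q" "\<eta> \<in> Q" "y \<in> Q" "y \<in> C n"
      using candidate_set_near[OF C(1) n] by blast
    have y: "y \<in> annulus n" using candidate_set_subset[OF C(1)] Q(4) by blast
    have "y \<in> (\<Union>n. C n)" using Q(4) by blast
    then obtain i where i: "e i = y" using C(2) by (metis bij_betw_imp_surj_on imageE)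
    have "norm (\<eta> - e i) \<le> d * mesh \<alpha> \<rho> n"
      using half_open_cube_norm_le[OF Q(1-3)] i by (simp add: d_def)
    also have "mesh \<alpha> \<rho> n \<le> \<rho> * (K * norm (e i) powr s)"
    proof -
      have "2 powr (real n * s) = (2 ^ n) powr s"
        by (simp add: powr_realpow[symmetric] powr_powr)
      also have "\<dots> \<le> K * norm (e i) powr s"
        unfolding K_def using y i norm_e[of i]
        by (intro norm_powr_comparable) (auto simp: annulus_def)
      finally show ?thesis using \<rho> by (simp add: mesh_def s_def)
    qed
    finally have dist1: "norm (\<eta> - e i) \<le> d * (\<rho> * (K * norm (e i) powr s))"
      using d by simp
    show ?thesis
    proof (cases "e i \<in> retained \<alpha> a \<rho> e (Suc i)")
      case True
      then obtain k where k: "\<xi> k = e i" using bij by (metis UN_I UNIV_I bij_betw_imp_surj_on imageE)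
      have "d * (\<rho> * (K * norm (e i) powr s)) = (d * K) * (\<rho> * norm (e i) powr s)" by simp
      also have "\<dots> \<le> A * (\<rho> * norm (e i) powr s)"
        using dK K \<rho> by (intro mult_right_mono) (auto simp: A_def)
      finally have "norm (\<eta> - e i) \<le> A * \<rho> * norm (e i) powr s"
        using dist1 by simp
      then show ?thesis using k
        by (auto intro!: exI[of _ k] simp: dist_norm norm_minus_commute)
    next
      case False
      then obtain \<zeta> where \<zeta>: "\<zeta> \<in> retained \<alpha> a \<rho> e i"
        "separation_ball \<alpha> a \<rho> (e i) \<inter> separation_ball \<alpha> a \<rho> \<zeta> \<noteq> {}"
        by (auto split: if_splits)
      obtain k where k: "\<xi> k = \<zeta>"
        using bij \<zeta>(1) by (metis UN_I UNIV_I bij_betw_imp_surj_on imageE)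
      have \<zeta>1: "1 \<le> norm \<zeta>" using ret[OF \<zeta>(1)] norm_e by auto
      obtain z where z: "norm (e i - z) < a * \<rho> * norm (e i) powr s" "norm (\<zeta> - z) < a * \<rho> * norm \<zeta> powr s"
        using \<zeta>(2) by (auto simp: separation_ball_def s_def dist_norm)
      have tri: "norm (e i - \<zeta>) \<le> a * \<rho> * norm (e i) powr s + a * \<rho> * norm \<zeta> powr s"
      proof -
        have "norm (e i - \<zeta>) \<le> norm (e i - z) + norm (z - \<zeta>)"
          using norm_triangle_ineq[of "e i - z" "z - \<zeta>"] by simp
        then show ?thesis using z by (simp add: norm_minus_commute)
      qed
      have a\<rho>: "a * \<rho> \<le> 1/4" using mult_mono[OF a(2) \<rho>(2)] a \<rho> by simp
      have small: "a * \<rho> * norm v powr s \<le> norm v / 4" if "1 \<le> norm v" for v :: "real ^ 'n"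
      proof -
        have "norm v powr s \<le> norm v powr 1"
          using that assms by (intro powr_mono) (auto simp: s_def)
        then have "a * \<rho> * norm v powr s \<le> 1/4 * norm v"
          using a\<rho> that by (intro mult_mono) auto
        then show ?thesis by simp
      qed
      have close: "norm (e i - \<zeta>) \<le> norm (e i) / 4 + norm \<zeta> / 4"
        using tri small[OF norm_e[of i]] small[OF \<zeta>1] by linarith
      have "norm (e i) \<le> 2 * norm \<zeta>" "norm \<zeta> \<le> 2 * norm (e i)"
        using close norm_triangle_ineq2[of "e i" \<zeta>] norm_triangle_ineq3[of "e i" \<zeta>] by linarith+
      then have cmp: "norm (e i) powr s \<le> K * norm \<zeta> powr s"
        unfolding K_def using norm_e[of i] \<zeta>1 by (intro norm_powr_comparable) auto
      define w where "w = \<rho> * norm \<zeta> powr s"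
      have w: "0 \<le> w" using \<rho> by (simp add: w_def)
      have cmp': "\<rho> * norm (e i) powr s \<le> K * w"
        using mult_left_mono[OF cmp, of \<rho>] \<rho> by (simp add: w_def mult_ac)
      have "norm (\<eta> - \<zeta>) \<le> norm (\<eta> - e i) + norm (e i - \<zeta>)"
        using norm_triangle_ineq[of "\<eta> - e i" "e i - \<zeta>"] by simp
      also have "\<dots> \<le> d * K * (\<rho> * norm (e i) powr s) + (a * (\<rho> * norm (e i) powr s) + a * w)"
        using dist1 tri by (simp add: w_def mult_ac)
      also have "\<dots> \<le> d * K * (K * w) + (1 * (K * w) + 1 * w)"
      proof -
        define u where "u = \<rho> * norm (e i) powr s"
        have u: "0 \<le> u" "u \<le> K * w" using cmp' \<rho> by (simp_all add: u_def)
        have "d * K * u + (a * u + a * w) \<le> d * K * (K * w) + (1 * (K * w) + 1 * w)"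
          using u a d K w by (intro add_mono mult_mono) auto
        then show ?thesis by (simp only: u_def)
      qed
      also have "\<dots> = A * w" by (simp add: A_def algebra_simps)
      finally have "norm (\<eta> - \<zeta>) \<le> A * \<rho> * norm \<zeta> powr s" by (simp add: w_def mult.assoc)
      then show ?thesis using k
        by (auto intro!: exI[of _ k] simp: dist_norm norm_minus_commute)
    qed
  qed
  have "A > 1" using dK K by (simp add: A_def)
  moreover have "subdyadic_geometry TYPE('n) \<alpha> D"
    if "0 < rho0 D \<and> rho0 D \<le> 1/2 \<and> 0 < sep D \<and> sep D \<le> 1/2 \<and> 0 < stp D \<and> Acov D = A" for D
    unfolding subdyadic_geometry_def
  proof (intro conjI allI impI subsetI)
    fix \<rho> :: real and \<xi> :: "nat \<Rightarrow> real ^ 'n" and \<eta> :: "real ^ 'n"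
    assume *: "0 < \<rho> \<and> \<rho> \<le> rho0 D \<and> subdyadic_centers \<alpha> (sep D) \<rho> \<xi>" "\<eta> \<in> {\<eta>. 1 \<le> norm \<eta>}"
    show "\<eta> \<in> (\<Union>k. cball (\<xi> k) (Acov D * \<rho> * norm (\<xi> k) powr (1 - \<alpha>)))"
      using cover[of "sep D" \<rho> \<xi> \<eta>] * that by (simp add: s_def)
  qed (use that \<open>A > 1\<close> in auto)
  ultimately show ?thesis
    by (intro exI[of _ "1/2"] conjI exI[of _ A] allI impI) auto
qed

end

theory Submission
  imports Defs "HOL-Probability.Probability"
begin

text \<open>
  Write \<open>\<lambda>\<^sub>k = |\<xi>\<^sub>k|\<^sup>1\<^sup>-\<^sup>\<alpha>\<close>. Both frames sample \<open>f\<close> at nearly the same places of phase space, so every packet of one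
  family is a rapidly convergent series of packets of the other family. The coefficient sequences are then related by a
  matrix that is almost diagonal, and Schur's test bounds such a matrix on all mixed \<open>\<ell>\<^sup>p\<close>-\<open>\<ell>\<^sup>q\<close> norms with one constant.

  The expansion is the following. The dilated windows \<open>P\<^sub>k(\<eta>) = P((\<eta> - \<xi>\<^sub>k)/\<lambda>\<^sub>k)\<close>, \<open>P = fourier \<phi>\<close>, cover all frequencies: the covering
  property of the centers serves \<open>|\<eta>| \<ge> 1\<close>, and the first center serves \<open>|\<eta>| < 1\<close> (\<open>frame_pair_cover\<close>). Hence
  \<open>\<Phi> = \<Sum>\<^sub>k |P\<^sub>k|\<^sup>2\<close> is bounded below, and the transform of a packet of \<open>\<psi>\<close> is the sum over \<open>k\<close> of \<open>P\<^sub>k\<close> times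
  the packet transform times \<open>cnj P\<^sub>k / \<Phi>\<close>. Only the finitely many \<open>k\<close> whose window meets that of the packet occur. In
  the unit coordinate of \<open>\<xi>\<^sub>k\<close> the second factor is supported in a cube that is a period cell of the node lattice
  (this is \<open>b \<rho> R\<^sub>1 < \<pi>\<close>), so it equals its Fourier series there, and the inverse transform of \<open>P\<^sub>k\<close> times a
  character is a packet of \<open>\<phi>\<close>. This gives \<open>packet_piece_has_sum\<close> and \<open>packet_eq_sum_pieces\<close>.

  The coefficients are Fourier integrals of the symbols \<open>cnj P \<cdot> Q(\<dots>) / \<Phi>(\<dots>)\<close>. Windows that meet have comparable
  \<open>|\<xi>|\<close> (\<open>touching_norm_le\<close>), and each meets boundedly many others because the separation balls are disjoint
  (\<open>touching_card_bound\<close>). So all symbols are built from two fixed smooth functions by boundedly many sums and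
  products and one division, after dilations from a compact range; their derivatives are bounded uniformly
  (\<open>dual_symbol_bounded_derivs\<close>), and integration by parts gives decay of any order in the distance of the nodes
  (\<open>packet_coeff_bound\<close>, \<open>packet_coeff_rapid\<close>). Decay of every order makes the series converge in the Schwartz space, so
  a tempered distribution may be applied term by term (\<open>tempered_sums\<close>); decay of one fixed order gives the row and
  column sums for Schur's test (\<open>lp_norm_schur\<close>), used in \<open>j\<close> for the exponent \<open>p\<close> and in \<open>k\<close> for the exponent \<open>q\<close>.
  The weights \<open>(1 + |\<xi>|)\<^sup>\<beta>\<close> of windows that meet are comparable as well. The resulting one-sided estimate \<open>M_norm_le\<close>
  is symmetric in the two pairs.
\<close>

section \<open>Integration on Euclidean space and Fourier inversion\<close>

text \<open>Lebesgue measure on \<open>real ^ 'n\<close> is the image of the product measure indexed by the basis vectors, so the product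
  rule for that measure only has to be reindexed by the coordinates.\<close>
lemma
  fixes f :: "'n::finite \<Rightarrow> real \<Rightarrow> complex"
  assumes f: "\<And>i. integrable lborel (f i)"
  shows integrable_prod_cart: "integrable lborel (\<lambda>x::real^'n. \<Prod>i\<in>UNIV. f i (x $ i))" (is ?A)
    and integral_prod_cart: "(LINT x|lborel. (\<Prod>i\<in>UNIV. f i ((x::real^'n) $ i))) = (\<Prod>i\<in>UNIV. (LINT t|lborel. f i t))" (is ?B)
proof -
  define ax where "ax = (\<lambda>i::'n. axis i (1::real))"
  have inj: "inj ax" by (auto simp: inj_def ax_def axis_eq_axis)
  have Bas: "(Basis :: (real^'n) set) = range ax" by (auto simp: Basis_vec_def ax_def)
  define g where "g b = f (inv ax b)" for b
  have g: "integrable lborel (g b)" for b by (simp add: g_def f)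
  have [measurable]: "f i \<in> borel_measurable borel" for i
    using borel_measurable_integrable[OF f] by simp
  interpret product_sigma_finite "\<lambda>_::real^'n. lborel :: real measure" ..
  let ?T = "\<lambda>h::real^'n\<Rightarrow>real. \<Sum>b\<in>Basis. h b *\<^sub>R b"
  have T: "?T \<in> measurable (\<Pi>\<^sub>M b\<in>Basis. lborel) borel" by measurable
  have eq: "(\<Prod>i\<in>UNIV. f i (?T h $ i)) = (\<Prod>b\<in>Basis. g b (h b))" for h :: "real^'n \<Rightarrow> real"
  proof -
    have "?T h $ i = h (ax i)" for i
    proof -
      have "?T h $ i = ?T h \<bullet> ax i" by (simp add: ax_def inner_axis)
      also have "\<dots> = h (ax i)"
        by (subst inner_sum_left_Basis) (auto simp: Bas)
      finally show ?thesis .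
    qed
    then show ?thesis unfolding Bas by (simp add: prod.reindex[OF inj] g_def inv_f_f[OF inj])
  qed
  have m: "(\<lambda>x::real^'n. \<Prod>i\<in>UNIV. f i (x $ i)) \<in> borel_measurable borel" by measurable
  have int: "integrable (\<Pi>\<^sub>M b\<in>(Basis::(real^'n) set). lborel) (\<lambda>h. \<Prod>b\<in>Basis. g b (h b))"
    by (rule product_integrable_prod) (auto intro: g)
  show ?A
    by (subst lborel_eq, subst integrable_distr_eq[OF T m]) (use int in \<open>simp only: eq\<close>)
  have "(LINT x|lborel. (\<Prod>i\<in>UNIV. f i ((x::real^'n) $ i))) = (LINT h|(\<Pi>\<^sub>M b\<in>(Basis::(real^'n) set). lborel). (\<Prod>b\<in>Basis. g b (h b)))"
    by (subst lborel_eq, subst integral_distr[OF T m]) (simp only: eq)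
  also have "\<dots> = (\<Prod>b\<in>Basis. (LINT t|lborel. g b t))"
    by (rule product_integral_prod) (auto intro: g)
  also have "\<dots> = (\<Prod>i\<in>UNIV. (LINT t|lborel. f i t))"
    unfolding Bas by (simp add: prod.reindex[OF inj] g_def inv_f_f[OF inj])
  finally show ?B .
qed

lemma
  fixes f :: "'a::euclidean_space \<Rightarrow> 'b::{banach, second_countable_topology}" and c :: real
  assumes c: "c \<noteq> 0" and f[measurable]: "f \<in> borel_measurable borel"
  shows lborel_integral_affine: "(LINT x|lborel. f (t + c *\<^sub>R x)) = (LINT x|lborel. f x) /\<^sub>R \<bar>c\<bar> ^ DIM('a)"
    and lborel_integrable_affine: "integrable lborel (\<lambda>x. f (t + c *\<^sub>R x)) \<longleftrightarrow> integrable lborel f"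
proof -
  have T: "(\<lambda>x::'a. t + c *\<^sub>R x) \<in> measurable lborel borel" by measurable
  have "(LINT x|lborel. f x) = (LINT x|density (distr lborel borel (\<lambda>x. t + c *\<^sub>R x)) (\<lambda>_. \<bar>c\<bar>^DIM('a)). f x)"
    by (subst lborel_affine[OF c, of t]) simp
  also have "\<dots> = \<bar>c\<bar>^DIM('a) *\<^sub>R (LINT x|lborel. f (t + c *\<^sub>R x))"
    by (subst integral_density) (auto simp: integral_distr[OF T] c)
  finally show "(LINT x|lborel. f (t + c *\<^sub>R x)) = (LINT x|lborel. f x) /\<^sub>R \<bar>c\<bar> ^ DIM('a)"
    using c by simp
  have "integrable lborel f \<longleftrightarrow> integrable (density (distr lborel borel (\<lambda>x. t + c *\<^sub>R x)) (\<lambda>_. ennreal (\<bar>c\<bar>^DIM('a)))) f"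
    by (subst lborel_affine[OF c, of t]) simp
  also have "\<dots> \<longleftrightarrow> integrable lborel (\<lambda>x. \<bar>c\<bar>^DIM('a) *\<^sub>R f (t + c *\<^sub>R x))"
    by (subst integrable_density) (simp_all add: integrable_distr_eq[OF T] del: Bochner_Integration.integrable_scaleR_right)
  also have "\<dots> \<longleftrightarrow> integrable lborel (\<lambda>x. f (t + c *\<^sub>R x))"
  proof
    assume "integrable lborel (\<lambda>x. \<bar>c\<bar>^DIM('a) *\<^sub>R f (t + c *\<^sub>R x))"
    then have "integrable lborel (\<lambda>x. inverse (\<bar>c\<bar>^DIM('a)) *\<^sub>R \<bar>c\<bar>^DIM('a) *\<^sub>R f (t + c *\<^sub>R x))"
      by (rule Bochner_Integration.integrable_scaleR_right)
    then show "integrable lborel (\<lambda>x. f (t + c *\<^sub>R x))" using c by simp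
  qed simp
  finally show "integrable lborel (\<lambda>x. f (t + c *\<^sub>R x)) \<longleftrightarrow> integrable lborel f" ..
qed

definition gauss :: "real ^ 'n::finite \<Rightarrow> real" where
  "gauss x = (\<Prod>i\<in>UNIV. exp (- (x $ i)\<^sup>2 / 2))"

lemma
  shows integrable_gauss_1d: "integrable lborel (\<lambda>x::real. complex_of_real (exp (- x\<^sup>2 / 2)) * iexp (x * u))" (is ?A)
    and integral_gauss_1d: "(LINT x|lborel. complex_of_real (exp (- x\<^sup>2 / 2)) * iexp (x * u))
       = complex_of_real (sqrt (2 * pi) * exp (- u\<^sup>2 / 2))" (is ?B)
proof -
  have eq: "complex_of_real (exp (- x\<^sup>2 / 2)) * iexp (x * u)
      = sqrt (2 * pi) * (std_normal_density x *\<^sub>R iexp (u * x))" for x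
    by (simp add: std_normal_density_def scaleR_conv_of_real mult_ac real_sqrt_mult)
  have i: "integrable lborel (\<lambda>x. std_normal_density x *\<^sub>R iexp (u * x))"
  proof (rule Bochner_Integration.integrable_bound)
    show "integrable lborel std_normal_density" using integrable_normal_density[of 1 0] by simp
  qed (auto simp: normal_density_nonneg norm_exp_i_times)
  then show ?A unfolding eq by (intro integrable_mult_right)
  have "(LINT x|lborel. std_normal_density x *\<^sub>R iexp (u * x)) = char std_normal_distribution u"
    unfolding char_def by (subst integral_density) (auto simp: normal_density_nonneg)
  then have "(LINT x|lborel. std_normal_density x *\<^sub>R iexp (u * x)) = exp (- u\<^sup>2 / 2)"
    by (simp only: char_std_normal_distribution)
  then show ?B unfolding eq by (subst integral_mult_right_zero) simp
qed

lemma
  fixes u :: "real ^ 'n::finite"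
  shows integrable_gauss_exp: "integrable lborel (\<lambda>x. complex_of_real (gauss x) * iexp (x \<bullet> u))" (is ?A)
    and integral_gauss_exp: "(LINT x|lborel. complex_of_real (gauss x) * iexp (x \<bullet> u))
       = complex_of_real (sqrt (2 * pi) ^ CARD('n) * gauss u)" (is ?B)
proof -
  have eq: "complex_of_real (gauss x) * iexp (x \<bullet> u) =
     (\<Prod>i\<in>UNIV. complex_of_real (exp (- (x $ i)\<^sup>2 / 2)) * iexp (x $ i * u $ i))" for x
  proof -
    have "iexp (x \<bullet> u) = (\<Prod>i\<in>UNIV. iexp (x $ i * u $ i))"
      by (simp add: inner_vec_def exp_sum[symmetric] sum_distrib_left)
    then show ?thesis by (simp only: gauss_def prod.distrib of_real_prod)
  qed
  show ?A unfolding eq by (rule integrable_prod_cart[OF integrable_gauss_1d])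
  show ?B unfolding eq
    by (subst integral_prod_cart[OF integrable_gauss_1d])
      (simp only: integral_gauss_1d, simp add: prod.distrib gauss_def)
qed

lemma gauss_bounds: "0 \<le> gauss x" "gauss x \<le> 1"
  by (auto simp: gauss_def intro!: prod_nonneg prod_le_1)

lemma gauss_cont: "continuous_on S gauss"
  unfolding gauss_def by (intro continuous_intros) auto

lemma gauss_meas[measurable]: "gauss \<in> borel_measurable borel"
  using gauss_cont by (rule borel_measurable_continuous_onI)

lemma integrable_gauss: "integrable lborel (gauss :: real^'n::finite \<Rightarrow> real)"
proof -
  have "integrable lborel (\<lambda>x::real^'n. complex_of_real (gauss x))"
    using integrable_gauss_exp[of "0::real^'n"] by simp
  from integrable_norm[OF this] show ?thesis by (simp add: gauss_bounds)
qed

lemma integral_gauss: "(LINT x|lborel. gauss (x::real^'n::finite)) = sqrt (2 * pi) ^ CARD('n)"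
proof -
  have "complex_of_real (LINT x|lborel. gauss (x::real^'n)) = complex_of_real (sqrt (2 * pi) ^ CARD('n))"
    using integral_gauss_exp[of "0::real^'n"] unfolding integral_complex_of_real[symmetric]
    by (simp add: gauss_def[of 0])
  then show ?thesis using of_real_eq_iff by blast
qed

text \<open>Damp the inversion integral by the Gaussian \<open>gauss (e \<eta>)\<close>. Then Fubini's theorem applies, the inner integral is the
  transform of a Gaussian, and the damped integral becomes the average of \<open>g (t + e u)\<close> against a Gaussian in \<open>u\<close>. As
  \<open>e\<close> tends to 0, dominated convergence applies on both sides.\<close>
lemma fourier_inversion:
  fixes g :: "real ^ 'n::finite \<Rightarrow> complex"
  assumes int: "integrable lborel g" and cont: "continuous_on UNIV g" and bd: "\<And>x. cmod (g x) \<le> B"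
    and intF: "integrable lborel (fourier g)"
  shows "(LINT \<eta>|lborel. fourier g \<eta> * iexp (t \<bullet> \<eta>)) = (2 * pi) ^ CARD('n) * g t"
proof -
  define d where "d = CARD('n)"
  have [measurable]: "g \<in> borel_measurable borel" using cont by (rule borel_measurable_continuous_onI)
  have mF[measurable]: "fourier g \<in> borel_measurable borel"
    using borel_measurable_integrable[OF intF] by simp
  have main: "(LINT \<eta>|lborel. fourier g \<eta> * iexp (t \<bullet> \<eta>) * gauss (e *\<^sub>R \<eta>))
     = (LINT u|lborel. g (t + e *\<^sub>R u) * (sqrt (2 * pi) ^ d * gauss u))" (is "?L = ?R") if e: "0 < e" for e :: real
  proof -
    have F: "fourier g (\<omega> /\<^sub>R e) * iexp (t \<bullet> (\<omega> /\<^sub>R e))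
      = e ^ d * (LINT u|lborel. g (t + e *\<^sub>R u) * exp (- (\<i> * complex_of_real (u \<bullet> \<omega>))))" for \<omega>
    proof -
      let ?G = "\<lambda>y. g y * exp (- (\<i> * complex_of_real ((y - t) \<bullet> (\<omega> /\<^sub>R e))))"
      have "fourier g (\<omega> /\<^sub>R e) * iexp (t \<bullet> (\<omega> /\<^sub>R e)) = (LINT y|lborel. ?G y)"
        unfolding fourier_def
        by (subst integral_mult_left_zero[symmetric])
          (simp add: mult.assoc exp_add[symmetric] algebra_simps)
      also have "\<dots> = e ^ d *\<^sub>R (LINT u|lborel. ?G (t + e *\<^sub>R u))"
        using e by (subst lborel_integral_affine) (auto simp: d_def)
      also have "\<dots> = e ^ d *\<^sub>R (LINT u|lborel. g (t + e *\<^sub>R u) * exp (- (\<i> * complex_of_real (u \<bullet> \<omega>))))"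
      proof -
        have "(e *\<^sub>R u) \<bullet> (\<omega> /\<^sub>R e) = u \<bullet> \<omega>" for u
          using e by (simp add: field_simps)
        then show ?thesis by (simp only: add_diff_cancel_left')
      qed
      finally show ?thesis by (simp add: scaleR_conv_of_real[where 'a=complex])
    qed
    let ?H = "\<lambda>\<eta>. fourier g \<eta> * iexp (t \<bullet> \<eta>) * gauss (e *\<^sub>R \<eta>)"
    have "?L = (LINT \<omega>|lborel. ?H (0 + inverse e *\<^sub>R \<omega>)) /\<^sub>R e ^ d"
      using e by (subst lborel_integral_affine) (auto simp: d_def power_inverse)
    also have "\<dots> = (LINT \<omega>|lborel. e ^ d * ((LINT u|lborel. g (t + e *\<^sub>R u) * exp (- (\<i> * complex_of_real (u \<bullet> \<omega>)))) * gauss \<omega>)) /\<^sub>R e ^ d"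
      using e F by (simp add: mult.assoc)
    also have "\<dots> = (LINT \<omega>|lborel. (LINT u|lborel. g (t + e *\<^sub>R u) * exp (- (\<i> * complex_of_real (u \<bullet> \<omega>))) * gauss \<omega>))"
      using e by (subst integral_mult_right_zero) (simp add: scaleR_conv_of_real[where 'a=complex] field_simps)
    also have "\<dots> = (LINT u|lborel. (LINT \<omega>|lborel. g (t + e *\<^sub>R u) * exp (- (\<i> * complex_of_real (u \<bullet> \<omega>))) * gauss \<omega>))"
    proof (rule lborel_pair.Fubini_integral)
      have gi: "integrable lborel (\<lambda>u. g (t + e *\<^sub>R u))"
        using e int by (subst lborel_integrable_affine) auto
      show "integrable (lborel \<Otimes>\<^sub>M lborel) (\<lambda>(u, \<omega>). g (t + e *\<^sub>R u) * exp (- (\<i> * complex_of_real (u \<bullet> \<omega>))) * complex_of_real (gauss \<omega>))"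
      proof (rule lborel_pair.Fubini_integrable)
        show "integrable lborel (\<lambda>u. LINT \<omega>|lborel. norm (case (u, \<omega>) of (u, \<omega>) \<Rightarrow> g (t + e *\<^sub>R u) * exp (- (\<i> * complex_of_real (u \<bullet> \<omega>))) * complex_of_real (gauss \<omega>)))"
          using gi by (simp add: norm_mult gauss_bounds)
        show "AE u in lborel. integrable lborel (\<lambda>\<omega>. case (u, \<omega>) of (u, \<omega>) \<Rightarrow> g (t + e *\<^sub>R u) * exp (- (\<i> * complex_of_real (u \<bullet> \<omega>))) * complex_of_real (gauss \<omega>))"
        proof (intro AE_I2)
          fix u :: "real^'n"
          show "integrable lborel (\<lambda>\<omega>. case (u, \<omega>) of (u, \<omega>) \<Rightarrow> g (t + e *\<^sub>R u) * exp (- (\<i> * complex_of_real (u \<bullet> \<omega>))) * complex_of_real (gauss \<omega>))"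
            using integrable_mult_right[OF integrable_gauss_exp[of "-u"], of "g (t + e *\<^sub>R u)"]
            by (simp add: mult_ac inner_commute)
        qed
      qed measurable
    qed
    also have "\<dots> = ?R"
    proof (rule Bochner_Integration.integral_cong)
      fix u :: "real^'n"
      have "(LINT \<omega>|lborel. g (t + e *\<^sub>R u) * exp (- (\<i> * complex_of_real (u \<bullet> \<omega>))) * complex_of_real (gauss \<omega>))
        = (LINT \<omega>|lborel. g (t + e *\<^sub>R u) * (complex_of_real (gauss \<omega>) * iexp (\<omega> \<bullet> - u)))"
        by (simp add: mult_ac inner_commute)
      also have "\<dots> = g (t + e *\<^sub>R u) * (sqrt (2 * pi) ^ d * gauss u)"
        by (subst integral_mult_right_zero, subst integral_gauss_exp) (simp add: d_def gauss_def)
      finally show "(LINT \<omega>|lborel. g (t + e *\<^sub>R u) * exp (- (\<i> * complex_of_real (u \<bullet> \<omega>))) * complex_of_real (gauss \<omega>)) = g (t + e *\<^sub>R u) * (sqrt (2 * pi) ^ d * gauss u)" .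
    qed simp
    finally show ?thesis .
  qed
  define \<epsilon> where "\<epsilon> m = inverse (real (Suc m))" for m
  have \<epsilon>: "0 < \<epsilon> m" for m by (simp add: \<epsilon>_def)
  have \<epsilon>0: "\<epsilon> \<longlonglongrightarrow> 0" unfolding \<epsilon>_def by (rule LIMSEQ_inverse_real_of_nat)
  have lim1: "(\<lambda>m. LINT \<eta>|lborel. fourier g \<eta> * iexp (t \<bullet> \<eta>) * gauss (\<epsilon> m *\<^sub>R \<eta>))
     \<longlonglongrightarrow> (LINT \<eta>|lborel. fourier g \<eta> * iexp (t \<bullet> \<eta>))"
  proof (rule integral_dominated_convergence)
    show "integrable lborel (\<lambda>\<eta>. cmod (fourier g \<eta>))" using intF by simp
    show "AE \<eta> in lborel. (\<lambda>m. fourier g \<eta> * iexp (t \<bullet> \<eta>) * gauss (\<epsilon> m *\<^sub>R \<eta>))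
       \<longlonglongrightarrow> fourier g \<eta> * iexp (t \<bullet> \<eta>)"
    proof (intro AE_I2)
      fix \<eta> :: "real^'n"
      have "(\<lambda>m. gauss (\<epsilon> m *\<^sub>R \<eta>)) \<longlonglongrightarrow> gauss (0 *\<^sub>R \<eta>)"
        by (rule continuous_on_tendsto_compose[OF gauss_cont[of UNIV] tendsto_scaleR[OF \<epsilon>0 tendsto_const]]) auto
      then have "(\<lambda>m. gauss (\<epsilon> m *\<^sub>R \<eta>)) \<longlonglongrightarrow> 1" by (simp add: gauss_def)
      then have "(\<lambda>m. complex_of_real (gauss (\<epsilon> m *\<^sub>R \<eta>))) \<longlonglongrightarrow> complex_of_real 1" by (rule tendsto_of_real)
      from tendsto_mult[OF tendsto_const this, of "fourier g \<eta> * iexp (t \<bullet> \<eta>)"]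
      show "(\<lambda>m. fourier g \<eta> * iexp (t \<bullet> \<eta>) * gauss (\<epsilon> m *\<^sub>R \<eta>))
       \<longlonglongrightarrow> fourier g \<eta> * iexp (t \<bullet> \<eta>)"
        by simp
    qed
    show "AE \<eta> in lborel. norm (fourier g \<eta> * iexp (t \<bullet> \<eta>) * gauss (\<epsilon> m *\<^sub>R \<eta>)) \<le> cmod (fourier g \<eta>)" for m
      by (intro AE_I2) (simp add: norm_mult gauss_bounds mult_left_le)
  qed measurable
  have lim2: "(\<lambda>m. LINT u|lborel. g (t + \<epsilon> m *\<^sub>R u) * (sqrt (2 * pi) ^ d * gauss u))
     \<longlonglongrightarrow> (LINT u|lborel. g t * (sqrt (2 * pi) ^ d * gauss (u::real^'n)))"
  proof (rule integral_dominated_convergence)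
    show "integrable lborel (\<lambda>u::real^'n. B * (sqrt (2 * pi) ^ d * gauss u))"
      by (intro integrable_mult_right integrable_gauss)
    show "AE u in lborel. (\<lambda>m. g (t + \<epsilon> m *\<^sub>R u) * (sqrt (2 * pi) ^ d * gauss u)) \<longlonglongrightarrow> g t * (sqrt (2 * pi) ^ d * gauss u)"
    proof (intro AE_I2)
      fix u :: "real^'n"
      have "(\<lambda>m. g (t + \<epsilon> m *\<^sub>R u)) \<longlonglongrightarrow> g (t + 0 *\<^sub>R u)"
        by (rule continuous_on_tendsto_compose[OF cont tendsto_add[OF tendsto_const tendsto_scaleR[OF \<epsilon>0 tendsto_const]]]) auto
      then show "(\<lambda>m. g (t + \<epsilon> m *\<^sub>R u) * (sqrt (2 * pi) ^ d * gauss u)) \<longlonglongrightarrow> g t * (sqrt (2 * pi) ^ d * gauss u)"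
        by (auto intro!: tendsto_intros)
    qed
    show "AE u in lborel. norm (g (t + \<epsilon> m *\<^sub>R u) * (sqrt (2 * pi) ^ d * gauss u)) \<le> B * (sqrt (2 * pi) ^ d * gauss u)" for m
      by (intro AE_I2) (simp add: norm_mult norm_power gauss_bounds bd mult_right_mono)
  qed measurable
  have val: "(LINT u|lborel. g t * (sqrt (2 * pi) ^ d * gauss (u::real^'n))) = (2 * pi) ^ d * g t"
  proof -
    have "sqrt (2 * pi) ^ d * sqrt (2 * pi) ^ d = (2 * pi) ^ d"
      by (subst power_mult_distrib[symmetric]) simp
    then have "(LINT u|lborel. sqrt (2 * pi) ^ d * gauss (u::real^'n)) = (2 * pi) ^ d"
      by (simp add: integral_gauss d_def)
    then have "(LINT u|lborel. complex_of_real (sqrt (2 * pi) ^ d * gauss (u::real^'n))) = complex_of_real ((2 * pi) ^ d)"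
      by (simp only: integral_complex_of_real)
    then show ?thesis by (subst integral_mult_right_zero) simp
  qed
  have "(LINT \<eta>|lborel. fourier g \<eta> * iexp (t \<bullet> \<eta>)) = (LINT u|lborel. g t * (sqrt (2 * pi) ^ d * gauss (u::real^'n)))"
    by (rule LIMSEQ_unique[OF lim1[unfolded main[OF \<epsilon>]] lim2])
  then show ?thesis unfolding val by (simp only: d_def)
qed

section \<open>Fourier series on a cube\<close>

lemma borel_measurable_cnj[measurable]:
  "f \<in> borel_measurable M \<Longrightarrow> (\<lambda>x. cnj (f x)) \<in> borel_measurable M"
  by (rule borel_measurable_continuous_on[OF continuous_on_cnj[OF continuous_on_id]])

text \<open>The expansion of \<open>H\<close> is paired with a bounded \<open>\<Psi>\<close>, so that convergence in mean square is what matters.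
  Among all combinations of \<open>E j\<close>, \<open>j \<in> Y\<close>, the orthogonal projection is closest to \<open>H\<close> in mean square; a uniform
  approximation of \<open>H\<close> by some combination over \<open>F \<subseteq> Y\<close> therefore makes the error of the projection small.\<close>
lemma orthogonal_expansion_has_sum:
  fixes E :: "'j \<Rightarrow> 'a \<Rightarrow> complex" and H \<Psi> :: "'a \<Rightarrow> complex"
  assumes "finite_measure M"
    and Em: "\<And>j. E j \<in> borel_measurable M" and Eb: "\<And>j x. cmod (E j x) \<le> 1"
    and orth: "\<And>j k. (LINT x|M. E j x * cnj (E k x)) = (if j = k then of_real V else 0)" and V: "V > 0"
    and Hm: "H \<in> borel_measurable M" and Hb: "\<And>x. cmod (H x) \<le> A"
    and \<Psi>m: "\<Psi> \<in> borel_measurable M" and \<Psi>b: "\<And>x. cmod (\<Psi> x) \<le> B"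
    and dense: "\<And>e. e > 0 \<Longrightarrow> \<exists>F c. finite F \<and> (\<forall>x\<in>space M. cmod (H x - (\<Sum>j\<in>F. c j * E j x)) \<le> e)"
  shows "((\<lambda>j. (LINT x|M. H x * cnj (E j x)) / of_real V * (LINT x|M. \<Psi> x * E j x)) has_sum (LINT x|M. \<Psi> x * H x)) UNIV"
proof -
  interpret finite_measure M by fact
  note [measurable] = Em Hm \<Psi>m
  have bint: "integrable M f" if "f \<in> borel_measurable M" "\<And>x. cmod (f x) \<le> C" for f :: "'a \<Rightarrow> complex" and C
    using that by (intro integrable_const_bound[where B=C]) auto
  have bint_real: "integrable M f" if "f \<in> borel_measurable M" "\<And>x. \<bar>f x\<bar> \<le> C" for f :: "'a \<Rightarrow> real" and C
    using that by (intro integrable_const_bound[where B=C]) auto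
  define m where "m = measure M (space M)"
  have m: "0 \<le> m" by (simp add: m_def)
  define b where "b j = (LINT x|M. H x * cnj (E j x)) / of_real V" for j
  show ?thesis unfolding has_sum_def tendsto_iff eventually_finite_subsets_at_top
  proof (intro allI impI)
    fix \<epsilon>0 :: real assume "\<epsilon>0 > 0"
    define K where "K = B\<^sup>2 * m + m + 1"
    have K: "K > 0" using m by (simp add: K_def add_nonneg_pos)
    define e where "e = \<epsilon>0 / K"
    have e: "e > 0" using \<open>\<epsilon>0 > 0\<close> K by (simp add: e_def)
    obtain F c where F: "finite F" and Fc: "\<And>x. x \<in> space M \<Longrightarrow> cmod (H x - (\<Sum>j\<in>F. c j * E j x)) \<le> e"
      using dense[OF e] by blast
    have "dist (\<Sum>j\<in>Y. b j * (LINT x|M. \<Psi> x * E j x)) (LINT x|M. \<Psi> x * H x) < \<epsilon>0"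
      if Y: "finite Y" "F \<subseteq> Y" for Y
    proof -
      \<comment> \<open>The approximation over \<open>F\<close>, read as a combination over \<open>Y\<close>.\<close>
      define c' where "c' j = (if j \<in> F then c j else 0)" for j
      define U where "U x = (\<Sum>j\<in>Y. b j * E j x)" for x
      define P where "P x = (\<Sum>j\<in>Y. c' j * E j x)" for x
      have P: "P x = (\<Sum>j\<in>F. c j * E j x)" for x
        unfolding P_def c'_def using Y by (intro sum.mono_neutral_cong_right) auto
      have [measurable]: "U \<in> borel_measurable M" "P \<in> borel_measurable M"
        unfolding U_def[abs_def] P_def[abs_def] by measurable
      have trigb: "cmod (\<Sum>j\<in>Y. d j * E j x) \<le> (\<Sum>j\<in>Y. cmod (d j))" for d :: "'j \<Rightarrow> complex" and x
        by (rule order_trans[OF norm_sum]) (intro sum_mono, simp add: norm_mult mult_left_le Eb)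
      obtain CU where CU: "\<And>x. cmod (U x) \<le> CU" using trigb[of b] unfolding U_def by blast
      obtain CP where CP: "\<And>x. cmod (P x) \<le> CP" using trigb[of c'] unfolding P_def by blast
      define D where "D x = H x - U x" for x
      have [measurable]: "D \<in> borel_measurable M" unfolding D_def[abs_def] by measurable
      have Db: "cmod (D x) \<le> A + CU" for x
        unfolding D_def using norm_triangle_ineq4[of "H x" "U x"] Hb[of x] CU[of x] by linarith
      have A: "0 \<le> A + CU" using Db norm_ge_zero order_trans by blast
      have perp: "(LINT x|M. D x * cnj (E k x)) = 0" if "k \<in> Y" for k
      proof -
        have i1: "integrable M (\<lambda>x. H x * cnj (E k x))"
          by (rule bint[where C=A]) (auto simp: norm_mult intro!: order_trans[OF mult_mono[OF Hb Eb]] order_trans[OF norm_ge_zero Hb])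
        have i2: "integrable M (\<lambda>x. b j * (E j x * cnj (E k x)))" for j
          by (intro integrable_mult_right bint[where C=1]) (auto simp: norm_mult mult_le_one Eb)
        have "(LINT x|M. D x * cnj (E k x)) = (LINT x|M. H x * cnj (E k x) - (\<Sum>j\<in>Y. b j * (E j x * cnj (E k x))))"
          by (simp add: D_def U_def left_diff_distrib sum_distrib_right mult.assoc)
        also have "\<dots> = (LINT x|M. H x * cnj (E k x)) - (\<Sum>j\<in>Y. b j * (LINT x|M. E j x * cnj (E k x)))"
          using i1 i2 by (subst Bochner_Integration.integral_diff) (auto simp: Bochner_Integration.integral_sum)
        also have "\<dots> = (LINT x|M. H x * cnj (E k x)) - b k * of_real V"
          using that Y(1) by (simp add: orth if_distrib cong: if_cong)
        also have "\<dots> = 0" using V by (simp add: b_def)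
        finally show ?thesis .
      qed
      define W where "W x = U x - P x" for x
      have [measurable]: "W \<in> borel_measurable M" unfolding W_def[abs_def] by measurable
      have Wb: "cmod (W x) \<le> CU + CP" for x
        unfolding W_def using norm_triangle_ineq4[of "U x" "P x"] CP[of x] CU[of x] by linarith
      have W: "W x = (\<Sum>j\<in>Y. (b j - c' j) * E j x)" for x
        by (simp add: W_def U_def P_def algebra_simps sum_subtractf)
      have DW: "(LINT x|M. D x * cnj (W x)) = 0"
      proof -
        have i2: "integrable M (\<lambda>x. cnj (b j - c' j) * (D x * cnj (E j x)))" for j
          by (intro integrable_mult_right bint[where C="A + CU"])
            (auto simp: norm_mult intro!: order_trans[OF mult_mono[OF Db Eb]] A)
        have "(LINT x|M. D x * cnj (W x)) = (LINT x|M. (\<Sum>j\<in>Y. cnj (b j - c' j) * (D x * cnj (E j x))))"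
          by (simp add: W sum_distrib_left mult_ac)
        also have "\<dots> = (\<Sum>j\<in>Y. cnj (b j - c' j) * (LINT x|M. D x * cnj (E j x)))"
          using i2 by (subst Bochner_Integration.integral_sum) auto
        finally show ?thesis by (simp add: perp)
      qed
      have sq: "integrable M (\<lambda>x. (cmod (f x))\<^sup>2)" if "f \<in> borel_measurable M" "\<And>x. cmod (f x) \<le> C" for f :: "'a \<Rightarrow> complex" and C
        using that by (intro bint_real[where C="C\<^sup>2"]) (auto intro!: power_mono)
      have DWi: "integrable M (\<lambda>x. D x * cnj (W x))"
        by (rule bint[where C="(A + CU) * (CU + CP)"]) (auto simp: norm_mult intro!: mult_mono Db Wb A)
      \<comment> \<open>Pythagoras: \<open>H - P\<close> is the sum of the orthogonal functions \<open>D\<close> and \<open>W\<close>.\<close>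
      have "(LINT x|M. (cmod (D x))\<^sup>2) \<le> (LINT x|M. (cmod (D x))\<^sup>2) + (LINT x|M. (cmod (W x))\<^sup>2) + 2 * Re (LINT x|M. D x * cnj (W x))"
        unfolding DW by simp
      also have "\<dots> = (LINT x|M. (cmod (D x))\<^sup>2 + (cmod (W x))\<^sup>2 + 2 * Re (D x * cnj (W x)))"
      proof -
        have "(LINT x|M. (cmod (D x))\<^sup>2 + (cmod (W x))\<^sup>2 + 2 * Re (D x * cnj (W x)))
           = (LINT x|M. (cmod (D x))\<^sup>2 + (cmod (W x))\<^sup>2) + (LINT x|M. 2 * Re (D x * cnj (W x)))"
          using sq[of D, OF _ Db] sq[of W, OF _ Wb] integrable_Re[OF DWi]
          by (intro Bochner_Integration.integral_add Bochner_Integration.integrable_add integrable_mult_right) auto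
        moreover have "(LINT x|M. (cmod (D x))\<^sup>2 + (cmod (W x))\<^sup>2) = (LINT x|M. (cmod (D x))\<^sup>2) + (LINT x|M. (cmod (W x))\<^sup>2)"
          using sq[of D, OF _ Db] sq[of W, OF _ Wb] by (intro Bochner_Integration.integral_add) auto
        moreover have "(LINT x|M. 2 * Re (D x * cnj (W x))) = 2 * Re (LINT x|M. D x * cnj (W x))"
          using integral_Re[OF DWi] by (subst integral_mult_right_zero) (simp only:)
        ultimately show ?thesis by linarith
      qed
      also have "\<dots> \<le> (LINT x|M. e\<^sup>2)"
      proof (rule integral_mono)
        show "integrable M (\<lambda>x. (cmod (D x))\<^sup>2 + (cmod (W x))\<^sup>2 + 2 * Re (D x * cnj (W x)))"
          using sq[of D, OF _ Db] sq[of W, OF _ Wb] integrable_Re[OF DWi]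
          by (intro Bochner_Integration.integrable_add integrable_mult_right) auto
        fix x assume x: "x \<in> space M"
        have "(cmod (D x))\<^sup>2 + (cmod (W x))\<^sup>2 + 2 * Re (D x * cnj (W x)) = (cmod (D x + W x))\<^sup>2"
          unfolding cmod_power2 by (simp add: power2_eq_square algebra_simps)
        also have "D x + W x = H x - (\<Sum>j\<in>F. c j * E j x)" by (simp add: D_def W_def P)
        also have "(cmod (H x - (\<Sum>j\<in>F. c j * E j x)))\<^sup>2 \<le> e\<^sup>2" using Fc[OF x] by (intro power_mono) auto
        finally show "(cmod (D x))\<^sup>2 + (cmod (W x))\<^sup>2 + 2 * Re (D x * cnj (W x)) \<le> e\<^sup>2" .
      qed simp
      finally have L2: "(LINT x|M. (cmod (D x))\<^sup>2) \<le> e\<^sup>2 * m" by (simp add: m_def mult.commute)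
      have i\<Psi>H: "integrable M (\<lambda>x. \<Psi> x * H x)"
        by (rule bint[where C="B * A"]) (auto simp: norm_mult intro!: mult_mono \<Psi>b Hb order_trans[OF norm_ge_zero \<Psi>b])
      have i\<Psi>E: "integrable M (\<lambda>x. b j * (\<Psi> x * E j x))" for j
        by (intro integrable_mult_right bint[where C="B"]) (auto simp: norm_mult intro!: order_trans[OF mult_mono[OF \<Psi>b Eb]] order_trans[OF norm_ge_zero \<Psi>b])
      have "(LINT x|M. \<Psi> x * H x) - (\<Sum>j\<in>Y. b j * (LINT x|M. \<Psi> x * E j x)) = (LINT x|M. \<Psi> x * D x)"
      proof -
        have "(LINT x|M. \<Psi> x * D x) = (LINT x|M. \<Psi> x * H x - (\<Sum>j\<in>Y. b j * (\<Psi> x * E j x)))"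
          by (simp add: D_def U_def algebra_simps sum_distrib_left)
        also have "\<dots> = (LINT x|M. \<Psi> x * H x) - (\<Sum>j\<in>Y. b j * (LINT x|M. \<Psi> x * E j x))"
          using i\<Psi>H i\<Psi>E by (subst Bochner_Integration.integral_diff) (auto simp: Bochner_Integration.integral_sum)
        finally show ?thesis ..
      qed
      then have "dist (\<Sum>j\<in>Y. b j * (LINT x|M. \<Psi> x * E j x)) (LINT x|M. \<Psi> x * H x) = cmod (LINT x|M. \<Psi> x * D x)"
        by (simp add: dist_norm norm_minus_commute)
      also have "\<dots> \<le> (LINT x|M. cmod (\<Psi> x * D x))" by (rule integral_norm_bound)
      also have "\<dots> \<le> (LINT x|M. e * B\<^sup>2 / 2 + (cmod (D x))\<^sup>2 / (2 * e))"
      proof (rule integral_mono)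
        show "integrable M (\<lambda>x. cmod (\<Psi> x * D x))"
          by (rule bint_real[where C="B * (A + CU)"]) (auto simp: norm_mult intro!: mult_mono \<Psi>b Db order_trans[OF norm_ge_zero \<Psi>b])
        show "integrable M (\<lambda>x. e * B\<^sup>2 / 2 + (cmod (D x))\<^sup>2 / (2 * e))"
          using sq[of D, OF _ Db] by auto
        fix x
        \<comment> \<open>Arithmetic-geometric mean with weight \<open>e\<close>, so that the integral is of order \<open>e\<close>.\<close>
        have "0 \<le> (e * cmod (\<Psi> x) - cmod (D x))\<^sup>2" by simp
        then have "2 * e * (cmod (\<Psi> x) * cmod (D x)) \<le> e\<^sup>2 * (cmod (\<Psi> x))\<^sup>2 + (cmod (D x))\<^sup>2"
          by (simp add: power2_eq_square algebra_simps)
        also have "(cmod (\<Psi> x))\<^sup>2 \<le> B\<^sup>2" using \<Psi>b by (intro power_mono) auto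
        finally have "2 * e * (cmod (\<Psi> x) * cmod (D x)) \<le> e\<^sup>2 * B\<^sup>2 + (cmod (D x))\<^sup>2"
          using e by (simp add: mult_left_mono)
        then show "cmod (\<Psi> x * D x) \<le> e * B\<^sup>2 / 2 + (cmod (D x))\<^sup>2 / (2 * e)"
          using e by (simp add: norm_mult field_simps power2_eq_square)
      qed
      also have "\<dots> = e * B\<^sup>2 / 2 * m + (LINT x|M. (cmod (D x))\<^sup>2) / (2 * e)"
        using sq[of D, OF _ Db] by (subst Bochner_Integration.integral_add) (auto simp: m_def)
      also have "\<dots> \<le> e * B\<^sup>2 / 2 * m + e\<^sup>2 * m / (2 * e)"
        using L2 e by (intro add_left_mono divide_right_mono) auto
      also have "\<dots> = e * ((B\<^sup>2 * m + m) / 2)" using e by (simp add: power2_eq_square field_simps)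
      also have "\<dots> < e * K" using e m by (intro mult_strict_left_mono) (auto simp: K_def add_nonneg_pos)
      also have "\<dots> = \<epsilon>0" using K by (simp add: e_def)
      finally show ?thesis .
    qed
    then show "\<exists>X. finite X \<and> X \<subseteq> UNIV \<and> (\<forall>Y. finite Y \<and> X \<subseteq> Y \<and> Y \<subseteq> UNIV \<longrightarrow>
       dist (\<Sum>j\<in>Y. (LINT x|M. H x * cnj (E j x)) / of_real V * (LINT x|M. \<Psi> x * E j x)) (LINT x|M. \<Psi> x * H x) < \<epsilon>0)"
      using F unfolding b_def by (intro exI[of _ F]) auto
  qed
qed

definition int_vec :: "int ^ 'n::finite \<Rightarrow> real ^ 'n" where
  "int_vec j = (\<chi> i. real_of_int (j $ i))"

definition cube :: "real \<Rightarrow> (real ^ 'n::finite) set" where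
  "cube s = {\<zeta>. \<forall>i. \<bar>\<zeta> $ i\<bar> \<le> pi / s}"

text \<open>The sign is such that multiplication by \<open>character s j\<close> on the Fourier side translates by \<open>s *\<^sub>R int_vec j\<close>, that is,
  moves a window to a node of the lattice.\<close>
definition character :: "real \<Rightarrow> int ^ 'n::finite \<Rightarrow> real ^ 'n \<Rightarrow> complex" where
  "character s j \<zeta> = exp (- (\<i> * complex_of_real (s * (int_vec j \<bullet> \<zeta>))))"

lemma cube_eq: "cube s = cbox (\<chi> i. - pi / s) (\<chi> i. pi / s)"
  by (auto simp: cube_def mem_box_cart abs_le_iff minus_le_iff)

lemma cube_meas[measurable]: "cube s \<in> sets borel"
  by (simp add: cube_eq)

lemma integral_exp_interval:
  fixes k :: int
  assumes "s > 0"
  shows "integrable lborel (\<lambda>x. indicator {- pi / s..pi / s} x *\<^sub>R iexp (s * k * x))" (is ?A)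
    and "(LINT x|lborel. indicator {- pi / s..pi / s} x *\<^sub>R iexp (s * k * x))
     = (if k = 0 then complex_of_real (2 * pi / s) else 0)" (is ?B)
proof -
  have c: "continuous_on {- pi / s..pi / s} (\<lambda>x. iexp (s * k * x))"
    by (intro continuous_intros)
  show ?A using borel_integrable_atLeastAtMost'[OF c] by (simp add: set_integrable_def)
  show ?B
  proof (cases "k = 0")
    case True
    then show ?thesis using assms by (simp add: scaleR_conv_of_real)
  next
    case False
    define F where "F x = iexp (s * k * x) / (\<i> * (s * k))" for x
    have "(LINT x|lborel. indicator {- pi / s..pi / s} x *\<^sub>R iexp (s * k * x)) = F (pi / s) - F (- pi / s)"
    proof (rule integral_FTC_Icc)
      show "- pi / s \<le> pi / s" using assms by (simp add: field_simps)
      show "(F has_vector_derivative iexp (s * k * x)) (at x within {- pi / s..pi / s})" for x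
      proof -
        have "((\<lambda>z. exp (\<i> * (s * k * z)) / (\<i> * (s * k))) has_field_derivative exp (\<i> * (s * k * of_real x))) (at (of_real x))"
          using assms False by (auto intro!: derivative_eq_intros simp: field_simps)
        from has_vector_derivative_real_field[OF this]
        show ?thesis unfolding F_def by (simp add: has_vector_derivative_at_within)
      qed
    qed (rule c)
    also have "F (pi / s) = F (- pi / s)"
    proof -
      have "iexp (s * k * (pi / s)) = iexp (s * k * (- pi / s)) * exp (2 * of_int k * of_real pi * \<i>)"
      proof -
        have "\<i> * complex_of_real (s * k * (pi / s)) = \<i> * complex_of_real (s * k * (- pi / s)) + 2 * of_int k * of_real pi * \<i>"
          using assms by (simp add: field_simps)
        then show ?thesis by (simp only: exp_add)
      qed
      also have "exp (2 * of_int k * of_real pi * \<i>) = 1"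
        using exp_integer_2pi[of "of_int k"] by (simp add: mult_ac)
      finally show ?thesis by (simp add: F_def)
    qed
    finally show ?thesis using False by simp
  qed
qed

lemma integral_character:
  fixes j :: "int ^ 'n::finite"
  assumes "s > 0"
  shows "(LINT \<zeta>|lborel. indicator (cube s) \<zeta> *\<^sub>R iexp (s * (int_vec j \<bullet> \<zeta>)))
     = (if j = 0 then complex_of_real ((2 * pi / s) ^ CARD('n)) else 0)"
proof -
  have eq: "indicator (cube s) \<zeta> *\<^sub>R iexp (s * (int_vec j \<bullet> \<zeta>))
      = (\<Prod>i\<in>UNIV. indicator {- pi / s..pi / s} (\<zeta> $ i) *\<^sub>R iexp (s * real_of_int (j $ i) * \<zeta> $ i))" for \<zeta>
  proof -
    have "indicator (cube s) \<zeta> = (\<Prod>i\<in>UNIV. indicator {- pi / s..pi / s} (\<zeta> $ i) :: real)"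
    proof (cases "\<zeta> \<in> cube s")
      case True
      then have "\<bar>\<zeta> $ i\<bar> \<le> pi / s" for i by (simp add: cube_def)
      then have "\<zeta> $ i \<in> {- pi / s..pi / s}" for i by (simp add: abs_le_iff minus_le_iff)
      then show ?thesis using True by simp
    next
      case False
      then obtain i where "\<not> \<bar>\<zeta> $ i\<bar> \<le> pi / s" by (auto simp: cube_def)
      then have "\<zeta> $ i \<notin> {- pi / s..pi / s}" by (auto simp: abs_le_iff)
      then have "(\<Prod>i\<in>UNIV. indicator {- pi / s..pi / s} (\<zeta> $ i) :: real) = 0"
      proof (intro prod_zero bexI[of _ i])
        show "indicator {- pi / s..pi / s} (\<zeta> $ i) = (0::real)"
          using \<open>\<zeta> $ i \<notin> {- pi / s..pi / s}\<close> by (rule indicator_simps(2))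
      qed auto
      then show ?thesis using False by simp
    qed
    moreover have "iexp (s * (int_vec j \<bullet> \<zeta>)) = (\<Prod>i\<in>UNIV. iexp (s * real_of_int (j $ i) * \<zeta> $ i))"
      by (simp add: exp_sum[symmetric] int_vec_def inner_vec_def sum_distrib_left mult_ac)
    ultimately show ?thesis by (simp add: scaleR_conv_of_real prod.distrib)
  qed
  have "(LINT \<zeta>|lborel. indicator (cube s) \<zeta> *\<^sub>R iexp (s * (int_vec j \<bullet> \<zeta>)))
     = (\<Prod>i\<in>UNIV. (if j $ i = 0 then complex_of_real (2 * pi / s) else 0))"
    unfolding eq by (subst integral_prod_cart[OF integral_exp_interval(1)[OF assms]]) (simp only: integral_exp_interval(2)[OF assms])
  also have "\<dots> = (if j = 0 then complex_of_real ((2 * pi / s) ^ CARD('n)) else 0)"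
    by (auto simp: vec_eq_iff)
  finally show ?thesis .
qed

definition monom_torus :: "int ^ 'n::finite \<Rightarrow> complex ^ 'n \<Rightarrow> complex" where
  "monom_torus j z = (\<Prod>i\<in>UNIV. z $ i powi j $ i)"

definition torus :: "(complex ^ 'n::finite) set" where
  "torus = {z. \<forall>i. cmod (z $ i) = 1}"

text \<open>An inductive class makes closure under products a double rule induction; the finite sum is recovered by
  \<open>trig_poly_expand\<close>.\<close>
inductive trig_poly :: "(complex ^ 'n::finite \<Rightarrow> complex) \<Rightarrow> bool" where
  trig_monom: "trig_poly (\<lambda>z. c * monom_torus j z)"
| trig_add: "trig_poly f \<Longrightarrow> trig_poly g \<Longrightarrow> trig_poly (\<lambda>z. f z + g z)"

lemma trig_poly_expand:
  "trig_poly h \<Longrightarrow> \<exists>F c. finite F \<and> (\<forall>z. h z = (\<Sum>j\<in>F. c j * monom_torus j z))"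
proof (induction rule: trig_poly.induct)
  case (trig_monom c j)
  show ?case by (intro exI[of _ "{j}"] exI[of _ "\<lambda>_. c"]) simp
next
  case (trig_add f g)
  obtain F c where F: "finite F" "\<And>z. f z = (\<Sum>j\<in>F. c j * monom_torus j z)" using trig_add by blast
  obtain G d where G: "finite G" "\<And>z. g z = (\<Sum>j\<in>G. d j * monom_torus j z)" using trig_add by blast
  define a where "a j = (if j \<in> F then c j else 0) + (if j \<in> G then d j else 0)" for j
  have "f z + g z = (\<Sum>j\<in>F \<union> G. a j * monom_torus j z)" for z
  proof -
    have "f z = (\<Sum>j\<in>F \<union> G. (if j \<in> F then c j else 0) * monom_torus j z)"
      unfolding F(2) using F(1) G(1) by (intro sum.mono_neutral_cong_left) auto
    moreover have "g z = (\<Sum>j\<in>F \<union> G. (if j \<in> G then d j else 0) * monom_torus j z)"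
      unfolding G(2) using F(1) G(1) by (intro sum.mono_neutral_cong_left) auto
    ultimately show ?thesis by (simp add: a_def sum.distrib distrib_right)
  qed
  then show ?case using F(1) G(1) by (intro exI[of _ "F \<union> G"] exI[of _ a]) auto
qed

text \<open>The product is only matched on the torus, because \<open>z powi a * z powi b = z powi (a + b)\<close> fails at \<open>z = 0\<close> when the
  exponents have opposite signs.\<close>
lemma trig_poly_mult:
  assumes "trig_poly f" "trig_poly g"
  shows "\<exists>h. trig_poly h \<and> (\<forall>z\<in>torus. h z = f z * g z)"
  using assms(1)
proof (induction rule: trig_poly.induct)
  case (trig_monom c j)
  show ?case using assms(2)
  proof (induction rule: trig_poly.induct)
    case (trig_monom d k)
    have "c * d * monom_torus (j + k) z = c * monom_torus j z * (d * monom_torus k z)" if "z \<in> torus" for z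
    proof -
      have "z $ i \<noteq> 0" for i using that by (auto simp: torus_def) (metis norm_zero zero_neq_one)
      then show ?thesis by (simp add: monom_torus_def power_int_add prod.distrib)
    qed
    then show ?case using trig_poly.trig_monom[of "c * d" "j + k"] by blast
  next
    case (trig_add f g)
    then obtain a b where "trig_poly a" "\<forall>z\<in>torus. a z = c * monom_torus j z * f z"
       "trig_poly b" "\<forall>z\<in>torus. b z = c * monom_torus j z * g z" by blast
    then show ?case using trig_poly.trig_add[of a b] by (intro exI[of _ "\<lambda>z. a z + b z"]) (auto simp: distrib_left)
  qed
next
  case (trig_add f f')
  then obtain a b where "trig_poly a" "\<forall>z\<in>torus. a z = f z * g z"
     "trig_poly b" "\<forall>z\<in>torus. b z = f' z * g z" by blast
  then show ?case using trig_poly.trig_add[of a b] by (intro exI[of _ "\<lambda>z. a z + b z"]) (auto simp: distrib_right)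
qed

lemma compact_torus: "compact (torus :: (complex ^ 'n::finite) set)"
proof -
  have "torus = (\<Inter>i. {z::complex^'n. cmod (z $ i) = 1})" by (auto simp: torus_def)
  moreover have "closed (\<Inter>i. {z::complex^'n. cmod (z $ i) = 1})"
    by (intro closed_INT ballI closed_Collect_eq continuous_intros)
  ultimately have "closed (torus :: (complex ^ 'n) set)" by simp
  moreover have "norm z \<le> real CARD('n)" if "z \<in> torus" for z :: "complex ^ 'n"
  proof -
    have "norm z \<le> (\<Sum>i\<in>UNIV. norm (z $ i))" unfolding norm_vec_def by (rule L2_set_le_sum) simp
    also have "\<dots> = real CARD('n)" using that by (simp add: torus_def)
    finally show ?thesis .
  qed
  then have "bounded (torus :: (complex ^ 'n) set)" unfolding bounded_iff by blast
  ultimately show ?thesis by (simp add: compact_eq_bounded_closed)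
qed

lemma monom_torus_cont: "continuous_on torus (monom_torus j)"
proof -
  have "z $ i \<noteq> 0" if "z \<in> torus" for z :: "complex ^ 'a" and i
    using that by (auto simp: torus_def) (metis norm_zero zero_neq_one)
  then have "continuous_on torus (\<lambda>z::complex ^ 'a. z $ i powi j $ i)" for i
    by (intro continuous_on_power_int continuous_intros) auto
  then show ?thesis unfolding monom_torus_def by (intro continuous_on_prod)
qed

lemma monom_axis: "monom_torus (axis i k) z = z $ i powi k"
proof -
  have "monom_torus (axis i k) z = (\<Prod>l\<in>UNIV. if l = i then z $ i powi k else 1)"
    unfolding monom_torus_def by (intro prod.cong) (auto simp: axis_def)
  then show ?thesis by simp
qed

text \<open>The Stone-Weierstrass theorem. On the unit circle \<open>inverse z = cnj z\<close>, so real and imaginary parts of the coordinates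
  are trigonometric polynomials, and these separate points.\<close>
lemma trig_poly_dense_real:
  fixes f :: "complex ^ 'n::finite \<Rightarrow> real"
  assumes "continuous_on torus f" "0 < e"
  shows "\<exists>h. trig_poly h \<and> (\<forall>z\<in>torus. cmod (of_real (f z) - h z) < e)"
proof -
  define R where "R = {g :: complex ^ 'n \<Rightarrow> real. \<exists>h. trig_poly h \<and> (\<forall>z\<in>torus. complex_of_real (g z) = h z)}"
  interpret function_ring_on R torus
  proof
    show "compact (torus :: (complex ^ 'n) set)" by (rule compact_torus)
    show "continuous_on torus g" if "g \<in> R" for g
    proof -
      obtain h where h: "trig_poly h" "\<forall>z\<in>torus. complex_of_real (g z) = h z" using \<open>g \<in> R\<close> by (auto simp: R_def)
      have "continuous_on torus h" using h(1)
        by (induction rule: trig_poly.induct) (auto intro!: continuous_intros monom_torus_cont)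
      then have "continuous_on torus (\<lambda>z. Re (h z))" by (intro continuous_intros)
      moreover have "Re (h z) = g z" if "z \<in> torus" for z using h(2) that by (metis Re_complex_of_real)
      ultimately show ?thesis by (simp cong: continuous_on_cong)
    qed
    show "(\<lambda>x. g x + g' x) \<in> R" if gg: "g \<in> R" "g' \<in> R" for g g'
    proof -
      obtain h h' where h: "trig_poly h" "\<forall>z\<in>torus. complex_of_real (g z) = h z"
        "trig_poly h'" "\<forall>z\<in>torus. complex_of_real (g' z) = h' z" using gg by (auto simp: R_def)
      then show ?thesis unfolding R_def using trig_poly.trig_add[OF h(1,3)] by (intro CollectI exI[of _ "\<lambda>z. h z + h' z"]) auto
    qed
    show "(\<lambda>x. g x * g' x) \<in> R" if gg: "g \<in> R" "g' \<in> R" for g g'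
    proof -
      obtain h h' where h: "trig_poly h" "\<forall>z\<in>torus. complex_of_real (g z) = h z"
        "trig_poly h'" "\<forall>z\<in>torus. complex_of_real (g' z) = h' z" using gg by (auto simp: R_def)
      then show ?thesis unfolding R_def using trig_poly_mult[OF h(1,3)] by auto
    qed
    show "(\<lambda>_. c) \<in> R" for c
      unfolding R_def by (intro CollectI exI[of _ "\<lambda>z. of_real c * monom_torus 0 z"] conjI trig_poly.trig_monom) (simp add: monom_torus_def)
    fix x y :: "complex ^ 'n" assume xy: "x \<in> torus" "y \<in> torus" "x \<noteq> y"
    then obtain i where i: "x $ i \<noteq> y $ i" by (auto simp: vec_eq_iff)
    have inv: "inverse (z $ i) = cnj (z $ i)" if "z \<in> torus" for z :: "complex ^ 'n"
      using that complex_norm_square[of "z $ i"] by (intro inverse_unique) (simp add: torus_def)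
    have "(\<lambda>z. Re (z $ i)) \<in> R"
    proof -
      have "trig_poly (\<lambda>z. 1/2 * monom_torus (axis i 1) z + 1/2 * monom_torus (axis i (-1)) z)"
        by (intro trig_poly.intros)
      moreover have "complex_of_real (Re (z $ i)) = 1/2 * monom_torus (axis i 1) z + 1/2 * monom_torus (axis i (-1)) z" if "z \<in> torus" for z
        using inv[OF that] by (simp add: monom_axis power_int_minus complex_eq_iff)
      ultimately show ?thesis unfolding R_def by blast
    qed
    moreover have "(\<lambda>z. Im (z $ i)) \<in> R"
    proof -
      have "trig_poly (\<lambda>z. - \<i>/2 * monom_torus (axis i 1) z + \<i>/2 * monom_torus (axis i (-1)) z)"
        by (intro trig_poly.intros)
      moreover have "complex_of_real (Im (z $ i)) = - \<i>/2 * monom_torus (axis i 1) z + \<i>/2 * monom_torus (axis i (-1)) z" if "z \<in> torus" for z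
        using inv[OF that] by (simp add: monom_axis power_int_minus complex_eq_iff)
      ultimately show ?thesis unfolding R_def by blast
    qed
    ultimately show "\<exists>f\<in>R. f x \<noteq> f y" using i complex_eq_iff by metis
  qed
  obtain g where g: "g \<in> R" "\<forall>z\<in>torus. \<bar>f z - g z\<bar> < e" using Stone_Weierstrass_basic[OF assms] by blast
  obtain h where h: "trig_poly h" "\<forall>z\<in>torus. complex_of_real (g z) = h z" using g(1) by (auto simp: R_def)
  have "cmod (of_real (f z) - h z) < e" if "z \<in> torus" for z
    using g(2)[rule_format, OF that] h(2)[rule_format, OF that, symmetric] by (simp flip: of_real_diff)
  then show ?thesis using h(1) by blast
qed

lemma trig_poly_dense:
  fixes f :: "complex ^ 'n::finite \<Rightarrow> complex"
  assumes "continuous_on torus f" "0 < e"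
  shows "\<exists>h. trig_poly h \<and> (\<forall>z\<in>torus. cmod (f z - h z) < e)"
proof -
  have e: "0 < e / 2" using assms by simp
  obtain h1 where h1: "trig_poly h1" "\<forall>z\<in>torus. cmod (of_real (Re (f z)) - h1 z) < e / 2"
    using trig_poly_dense_real[OF continuous_on_Re[OF assms(1)] e] by blast
  obtain h2 where h2: "trig_poly h2" "\<forall>z\<in>torus. cmod (of_real (Im (f z)) - h2 z) < e / 2"
    using trig_poly_dense_real[OF continuous_on_Im[OF assms(1)] e] by blast
  obtain h3 where h3: "trig_poly h3" "\<forall>z\<in>torus. h3 z = (\<i> * monom_torus 0 z) * h2 z"
    using trig_poly_mult[OF trig_monom h2(1)] by blast
  have "cmod (f z - (h1 z + h3 z)) < e" if z: "z \<in> torus" for z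
  proof -
    have "f z - (h1 z + h3 z) = (of_real (Re (f z)) - h1 z) + \<i> * (of_real (Im (f z)) - h2 z)"
      using h3(2)[rule_format, OF z] by (subst complex_eq[of "f z"]) (simp add: monom_torus_def algebra_simps)
    also have "cmod \<dots> \<le> cmod (of_real (Re (f z)) - h1 z) + cmod (of_real (Im (f z)) - h2 z)"
      by (rule order_trans[OF norm_triangle_ineq]) (simp add: norm_mult)
    also have "\<dots> < e" using h1(2)[rule_format, OF z] h2(2)[rule_format, OF z] by simp
    finally show ?thesis .
  qed
  then show ?thesis using trig_add[OF h1(1) h3(1)] by blast
qed

lemma cis_eq_in_interval:
  assumes "cis (- (s * a)) = cis (- (s * b))" "\<bar>a\<bar> \<le> pi / s" "\<bar>b\<bar> \<le> pi / s" "s > 0" "a \<noteq> b"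
  shows "\<bar>a\<bar> = pi / s \<and> \<bar>b\<bar> = pi / s"
proof -
  have "iexp (- (s * a)) = iexp (- (s * b))"
    using assms(1) by (simp only: cis_conv_exp)
  then obtain n :: int where "\<i> * complex_of_real (- (s * a)) = \<i> * complex_of_real (- (s * b)) + (of_int (2 * n) * pi) * \<i>"
    unfolding exp_eq by blast
  then have "Im (\<i> * complex_of_real (- (s * a))) = Im (\<i> * complex_of_real (- (s * b)) + (of_int (2 * n) * pi) * \<i>)"
    by (rule arg_cong)
  then have n: "s * (b - a) = 2 * n * pi" by (simp add: algebra_simps)
  have sa: "\<bar>s * a\<bar> \<le> pi" "\<bar>s * b\<bar> \<le> pi" using assms by (simp_all add: abs_mult field_simps)
  have "n \<noteq> 0" using n assms by auto
  then have "1 \<le> \<bar>real_of_int n\<bar>" by linarith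
  then have "2 * pi \<le> \<bar>2 * n * pi\<bar>" by (simp add: abs_mult)
  then have "2 * pi \<le> \<bar>s * b - s * a\<bar>" using n by (simp add: algebra_simps)
  then have "\<bar>s * a\<bar> = pi" "\<bar>s * b\<bar> = pi" using sa by linarith+
  then show ?thesis using assms(4) by (simp add: abs_mult field_simps)
qed

text \<open>Wrapping the cube around the torus identifies boundary points only, and \<open>H\<close> vanishes there; so \<open>H\<close> descends to a
  function on the torus, where trigonometric polynomials are dense.\<close>
lemma character_dense:
  fixes H :: "real ^ 'n::finite \<Rightarrow> complex"
  assumes s: "s > 0" and cont: "continuous_on UNIV H" and van: "\<And>\<zeta> i. pi / s \<le> \<bar>\<zeta> $ i\<bar> \<Longrightarrow> H \<zeta> = 0" and e: "e > 0"
  shows "\<exists>F c. finite F \<and> (\<forall>\<zeta>\<in>cube s. cmod (H \<zeta> - (\<Sum>j\<in>F. c j * character s j \<zeta>)) \<le> e)"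
proof -
  define P :: "real ^ 'n \<Rightarrow> complex ^ 'n" where "P \<zeta> = (\<chi> i. cis (- (s * \<zeta> $ i)))" for \<zeta>
  have Pc: "continuous_on UNIV P" unfolding P_def
    by (intro continuous_on_vec_lambda continuous_intros) 
  have PK: "P \<zeta> \<in> torus" for \<zeta> by (simp add: P_def torus_def)
  have onto: "\<exists>\<zeta>\<in>cube s. P \<zeta> = z" if z: "z \<in> torus" for z
  proof -
    define \<zeta> :: "real ^ 'n" where "\<zeta> = (\<chi> i. - Arg (z $ i) / s)"
    have "\<bar>\<zeta> $ i\<bar> \<le> pi / s" for i
      using s Arg_bounded[of "z $ i"] by (auto simp: \<zeta>_def abs_le_iff field_simps)
    moreover have "P \<zeta> = z"
    proof -
      have "cis (Arg (z $ i)) = z $ i" for i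
      proof -
        have "cmod (z $ i) = 1" using z by (simp add: torus_def)
        moreover have "z $ i \<noteq> 0" using calculation by force
        ultimately show ?thesis by (simp add: cis_Arg sgn_div_norm)
      qed
      then show ?thesis using s by (simp add: P_def \<zeta>_def vec_eq_iff)
    qed
    ultimately show ?thesis by (auto simp: cube_def)
  qed
  have same: "H \<zeta> = H \<zeta>'" if "\<zeta> \<in> cube s" "\<zeta>' \<in> cube s" "P \<zeta> = P \<zeta>'" for \<zeta> \<zeta>'
  proof (cases "\<zeta> = \<zeta>'")
    case False
    then obtain i where i: "\<zeta> $ i \<noteq> \<zeta>' $ i" by (auto simp: vec_eq_iff)
    have "cis (- (s * \<zeta> $ i)) = cis (- (s * \<zeta>' $ i))" using that(3) by (simp add: P_def vec_eq_iff)
    from cis_eq_in_interval[OF this _ _ s i] that(1,2) have "\<bar>\<zeta> $ i\<bar> = pi / s" "\<bar>\<zeta>' $ i\<bar> = pi / s"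
      by (auto simp: cube_def)
    then show ?thesis using van[of \<zeta> i] van[of \<zeta>' i] by simp
  qed simp
  define G where "G z = H (SOME \<zeta>. \<zeta> \<in> cube s \<and> P \<zeta> = z)" for z
  have G: "G (P \<zeta>) = H \<zeta>" if "\<zeta> \<in> cube s" for \<zeta>
  proof -
    have "(SOME \<zeta>'. \<zeta>' \<in> cube s \<and> P \<zeta>' = P \<zeta>) \<in> cube s \<and> P (SOME \<zeta>'. \<zeta>' \<in> cube s \<and> P \<zeta>' = P \<zeta>) = P \<zeta>"
      by (rule someI[of _ \<zeta>]) (use that in simp)
    then show ?thesis unfolding G_def using same that by blast
  qed
  have "continuous_on torus G"
    unfolding continuous_on_closed_vimage[OF compact_imp_closed[OF compact_torus]]
  proof (intro allI impI)
    fix B :: "complex set" assume B: "closed B"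
    \<comment> \<open>Preimages of closed sets under \<open>G\<close> are continuous images of compact sets.\<close>
    have "G -` B \<inter> torus = P ` (cube s \<inter> H -` B)"
      using PK G onto by fastforce
    moreover have "compact (cube s \<inter> H -` B)"
      unfolding cube_eq using B cont by (intro compact_Int_closed compact_cbox closed_vimage)
    ultimately show "closed (G -` B \<inter> torus)"
      using Pc by (auto intro!: compact_imp_closed compact_continuous_image elim: continuous_on_subset)
  qed
  then obtain h where h: "trig_poly h" "\<forall>z\<in>torus. cmod (G z - h z) < e"
    using trig_poly_dense[OF _ e] by blast
  obtain F c where F: "finite F" "\<And>z. h z = (\<Sum>j\<in>F. c j * monom_torus j z)"
    using trig_poly_expand[OF h(1)] by blast
  have mono: "monom_torus j (P \<zeta>) = character s j \<zeta>" for j \<zeta>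
  proof -
    have "monom_torus j (P \<zeta>) = (\<Prod>i\<in>UNIV. cis (of_int (j $ i) * (- (s * \<zeta> $ i))))"
      by (simp add: monom_torus_def P_def cis_power_int)
    also have "\<dots> = character s j \<zeta>"
      by (simp add: character_def cis_conv_exp exp_sum[symmetric] int_vec_def inner_vec_def sum_distrib_left sum_negf mult_ac)
    finally show ?thesis .
  qed
  have "cmod (H \<zeta> - (\<Sum>j\<in>F. c j * character s j \<zeta>)) \<le> e" if "\<zeta> \<in> cube s" for \<zeta>
    using h(2)[rule_format, OF PK[of \<zeta>]] G[OF that] F(2)[of "P \<zeta>"] by (simp add: mono less_imp_le)
  then show ?thesis using F(1) by blast
qed

lemma fourier_series_has_sum:
  fixes H \<Psi> :: "real ^ 'n::finite \<Rightarrow> complex"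
  assumes s: "s > 0" and cont: "continuous_on UNIV H" and van: "\<And>\<zeta> i. pi / s \<le> \<bar>\<zeta> $ i\<bar> \<Longrightarrow> H \<zeta> = 0"
    and \<Psi>m[measurable]: "\<Psi> \<in> borel_measurable borel" and \<Psi>b: "\<And>x. cmod (\<Psi> x) \<le> B"
    and \<Psi>v: "\<And>\<zeta>. \<zeta> \<notin> cube s \<Longrightarrow> \<Psi> \<zeta> = 0"
  shows "((\<lambda>j. (LINT \<zeta>|lborel. H \<zeta> * cnj (character s j \<zeta>)) / complex_of_real ((2 * pi / s) ^ CARD('n)) *
            (LINT \<zeta>|lborel. \<Psi> \<zeta> * character s j \<zeta>)) has_sum (LINT \<zeta>|lborel. \<Psi> \<zeta> * H \<zeta>)) UNIV"
proof -
  define M where "M = restrict_space lborel (cube s :: (real ^ 'n) set)"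
  have [measurable]: "H \<in> borel_measurable borel" using cont by (rule borel_measurable_continuous_onI)
  have [measurable]: "character s j \<in> borel_measurable borel" for j :: "int ^ 'n"
    unfolding character_def by (intro borel_measurable_continuous_onI continuous_intros)
  have intM: "(LINT x|M. f x) = (LINT x|lborel. indicator (cube s) x *\<^sub>R f x)" for f :: "real ^ 'n \<Rightarrow> complex"
    unfolding M_def by (subst integral_restrict_space) (auto simp: set_lebesgue_integral_def)
  have HM: "(LINT x|M. f x) = (LINT x|lborel. f x)" if "\<And>\<zeta>. \<zeta> \<notin> cube s \<Longrightarrow> f \<zeta> = 0" for f :: "real ^ 'n \<Rightarrow> complex"
    unfolding intM using that by (intro Bochner_Integration.integral_cong) (auto simp: indicator_def)
  have Hv: "H \<zeta> = 0" if "\<zeta> \<notin> cube s" for \<zeta>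
    using that van[of \<zeta>] by (auto simp: cube_def not_le) (meson less_imp_le)
  have "compact (H ` cube s)" unfolding cube_eq
    by (intro compact_continuous_image continuous_on_subset[OF cont] compact_cbox) auto
  then obtain A where A: "\<And>x. x \<in> cube s \<Longrightarrow> cmod (H x) \<le> A" "0 \<le> A"
    using bounded_pos[of "H ` cube s"] compact_imp_bounded by (metis imageI less_imp_le)
  have "((\<lambda>j. (LINT \<zeta>|M. H \<zeta> * cnj (character s j \<zeta>)) / complex_of_real ((2 * pi / s) ^ CARD('n)) *
            (LINT \<zeta>|M. \<Psi> \<zeta> * character s j \<zeta>)) has_sum (LINT \<zeta>|M. \<Psi> \<zeta> * H \<zeta>)) UNIV"
  proof (rule orthogonal_expansion_has_sum)
    show "finite_measure M"
      unfolding M_def by (intro finite_measureI) (simp add: emeasure_restrict_space cube_eq emeasure_lborel_cbox_eq)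
    show "character s j \<in> borel_measurable M" for j :: "int ^ 'n" unfolding M_def by (intro measurable_restrict_space1) simp
    show "H \<in> borel_measurable M" "\<Psi> \<in> borel_measurable M" unfolding M_def by (intro measurable_restrict_space1; simp)+
    show "cmod (character s j x) \<le> 1" for j x by (simp add: character_def)
    show "0 < (2 * pi / s) ^ CARD('n)" using s by simp
    show "cmod (H x) \<le> A" for x using A Hv by (cases "x \<in> cube s") auto
    show "cmod (\<Psi> x) \<le> B" for x by (rule \<Psi>b)
    show "\<exists>F c. finite F \<and> (\<forall>x\<in>space M. cmod (H x - (\<Sum>j\<in>F. c j * character s j x)) \<le> e)" if "e > 0" for e
      using character_dense[OF s cont van that] by (simp add: M_def space_restrict_space)
    show "(LINT x|M. character s j x * cnj (character s k x)) = (if j = k then complex_of_real ((2 * pi / s) ^ CARD('n)) else 0)" for j k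
    proof -
      have "character s j x * cnj (character s k x) = iexp (s * (int_vec (k - j) \<bullet> x))" for x
      proof -
        have "int_vec (k - j) = int_vec k - int_vec j" by (simp add: int_vec_def vec_eq_iff)
        then have "int_vec (k - j) \<bullet> x = int_vec k \<bullet> x - int_vec j \<bullet> x" by (simp only: inner_diff_left)
        then show ?thesis by (simp add: character_def exp_cnj exp_add[symmetric] right_diff_distrib)
      qed
      then show ?thesis unfolding intM by (simp only: integral_character[OF s]) auto
    qed
  qed
  then show ?thesis by (simp add: HM Hv \<Psi>v)
qed

section \<open>Bounded derivatives in one direction\<close>

text \<open>\<open>F\<close> has \<open>M\<close> derivatives in the single direction \<open>i\<close> on \<open>S\<close>, and they and \<open>F\<close> are bounded by \<open>K\<close>. One coordinate at a
  time is what integration by parts consumes, and a common bound for all orders keeps the constants of the closure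
  properties below explicit, hence uniform over the infinitely many symbols to which they are applied.\<close>
primrec bounded_derivs :: "nat \<Rightarrow> (real ^ 'n::finite) set \<Rightarrow> 'n \<Rightarrow> real \<Rightarrow> (real ^ 'n \<Rightarrow> complex) \<Rightarrow> bool" where
  "bounded_derivs 0 S i K F \<longleftrightarrow> (\<forall>z\<in>S. cmod (F z) \<le> K)"
| "bounded_derivs (Suc M) S i K F \<longleftrightarrow> (\<forall>z\<in>S. cmod (F z) \<le> K) \<and>
     (\<exists>F'. (\<forall>z\<in>S. ((\<lambda>r. F (z + r *\<^sub>R axis i 1)) has_vector_derivative F' z) (at 0)) \<and> bounded_derivs M S i K F')"

lemma bounded_derivs_bound: "bounded_derivs M S i K F \<Longrightarrow> z \<in> S \<Longrightarrow> cmod (F z) \<le> K"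
  by (cases M) auto

lemma bounded_derivs_mono: "bounded_derivs M S i K F \<Longrightarrow> K \<le> L \<Longrightarrow> bounded_derivs M S i L F"
  proof (induction M arbitrary: F)
  case (Suc M)
  then show ?case by (auto intro: order_trans)
qed (auto intro: order_trans)

lemma bounded_derivs_Suc_le: "bounded_derivs (Suc M) S i K F \<Longrightarrow> bounded_derivs M S i K F"
  by (induction M arbitrary: F) auto

lemma bounded_derivs_subset: "bounded_derivs M T i K F \<Longrightarrow> S \<subseteq> T \<Longrightarrow> bounded_derivs M S i K F"
  by (induction M arbitrary: F) (auto, meson subsetD)

lemma bounded_derivs_add:
  "bounded_derivs M S i K F \<Longrightarrow> bounded_derivs M S i L G \<Longrightarrow> bounded_derivs M S i (K + L) (\<lambda>z. F z + G z)"
proof (induction M arbitrary: F G)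
  case 0 then show ?case by (auto intro: norm_triangle_mono)
next
  case (Suc M)
  obtain F' G' where "\<forall>z\<in>S. ((\<lambda>r. F (z + r *\<^sub>R axis i 1)) has_vector_derivative F' z) (at 0)" "bounded_derivs M S i K F'"
    "\<forall>z\<in>S. ((\<lambda>r. G (z + r *\<^sub>R axis i 1)) has_vector_derivative G' z) (at 0)" "bounded_derivs M S i L G'"
    using Suc.prems by auto
  then show ?case using Suc by (auto intro!: norm_triangle_mono exI[of _ "\<lambda>z. F' z + G' z"] derivative_intros)
qed

text \<open>By the product rule each derivative replaces a product by a sum of two products of the same kind, so the bound doubles
  with every order.\<close>
lemma bounded_derivs_mult:
  assumes "0 \<le> K" "0 \<le> L"
  shows "bounded_derivs M S i K F \<Longrightarrow> bounded_derivs M S i L G \<Longrightarrow> bounded_derivs M S i (2 ^ M * K * L) (\<lambda>z. F z * G z)"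
proof (induction M arbitrary: F G)
  case 0 then show ?case using assms by (auto simp: norm_mult intro: mult_mono)
next
  case (Suc M)
  obtain F' G' where *: "\<forall>z\<in>S. ((\<lambda>r. F (z + r *\<^sub>R axis i 1)) has_vector_derivative F' z) (at 0)" "bounded_derivs M S i K F'"
    "\<forall>z\<in>S. ((\<lambda>r. G (z + r *\<^sub>R axis i 1)) has_vector_derivative G' z) (at 0)" "bounded_derivs M S i L G'"
    using Suc.prems by auto
  have dd: "bounded_derivs M S i (2 ^ M * K * L + 2 ^ M * K * L) (\<lambda>z. F z * G' z + F' z * G z)"
    using Suc.prems[THEN bounded_derivs_Suc_le] * by (intro bounded_derivs_add Suc.IH) auto
  have bb: "cmod (F z * G z) \<le> 2 ^ Suc M * K * L" if "z \<in> S" for z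
  proof -
    have "cmod (F z * G z) \<le> K * L" unfolding norm_mult
      using Suc.prems[THEN bounded_derivs_bound[OF _ that]] assms by (intro mult_mono) auto
    also have "\<dots> \<le> 2 ^ Suc M * (K * L)" using mult_right_mono[OF one_le_power[of "2::real" "Suc M"], of "K * L"] assms by simp
    finally show ?thesis by (simp add: mult.assoc)
  qed
  have hh: "((\<lambda>r. F (z + r *\<^sub>R axis i 1) * G (z + r *\<^sub>R axis i 1)) has_vector_derivative F z * G' z + F' z * G z) (at 0)" if "z \<in> S" for z
    using has_vector_derivative_mult[OF *(1)[rule_format, OF that] *(3)[rule_format, OF that]] by simp
  have "2 ^ M * K * L + 2 ^ M * K * L = 2 ^ Suc M * K * L" by simp
  note dd = dd[unfolded this]
  show ?case unfolding bounded_derivs.simps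
    by (intro conjI ballI exI[of _ "\<lambda>z. F z * G' z + F' z * G z"] dd bb hh)
qed

lemma bounded_derivs_const: "cmod c \<le> K \<Longrightarrow> bounded_derivs M S i K (\<lambda>_. c)"
proof (induction M arbitrary: c)
  case (Suc M)
  have "0 \<le> K" using Suc.prems norm_ge_zero order_trans by blast
  then show ?case using Suc.prems Suc.IH[of 0] by (auto intro!: exI[of _ "\<lambda>_. 0"] derivative_eq_intros)
qed auto

lemma bounded_derivs_sum:
  fixes K :: real
  assumes "finite I" "\<And>k. k \<in> I \<Longrightarrow> bounded_derivs M S i K (F k)"
  shows "bounded_derivs M S i (card I * K) (\<lambda>z. \<Sum>k\<in>I. F k z)"
  using assms
proof (induction I rule: finite_induct)
  case empty show ?case by (simp add: bounded_derivs_const)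
next
  case (insert k I)
  have "bounded_derivs M S i (K + card I * K) (\<lambda>z. F k z + (\<Sum>k\<in>I. F k z))"
    using insert by (intro bounded_derivs_add) auto
  then show ?case using insert.hyps by (simp add: algebra_simps)
qed

lemma bounded_derivs_cnj: "bounded_derivs M S i K F \<Longrightarrow> bounded_derivs M S i K (\<lambda>z. cnj (F z))"
proof (induction M arbitrary: F)
  case (Suc M)
  then obtain F' where "\<forall>z\<in>S. ((\<lambda>r. F (z + r *\<^sub>R axis i 1)) has_vector_derivative F' z) (at 0)" "bounded_derivs M S i K F'"
    by auto
  then show ?case using Suc by (auto intro!: exI[of _ "\<lambda>z. cnj (F' z)"] has_vector_derivative_cnj)
qed auto

text \<open>Only an upper bound \<open>\<kappa>\<close> of the dilation enters, so one constant serves all dilations in a bounded range.\<close>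
lemma bounded_derivs_affine:
  assumes c: "\<bar>c\<bar> \<le> \<kappa>" "1 \<le> \<kappa>" and K: "0 \<le> K"
  shows "bounded_derivs M UNIV i K F \<Longrightarrow> bounded_derivs M S i (\<kappa> ^ M * K) (\<lambda>z. F (c *\<^sub>R z + w))"
proof (induction M arbitrary: F)
  case (Suc M)
  obtain F' where F': "\<And>z. ((\<lambda>r. F (z + r *\<^sub>R axis i 1)) has_vector_derivative F' z) (at 0)" "bounded_derivs M UNIV i K F'"
    using Suc.prems by auto
  have 1: "bounded_derivs M S i (\<kappa> ^ Suc M * K) (\<lambda>z. c *\<^sub>R F' (c *\<^sub>R z + w))"
  proof -
    have "bounded_derivs M S i (2 ^ M * 0 * 0 + \<kappa> ^ M * K) (\<lambda>z. F' (c *\<^sub>R z + w))" using Suc.IH[OF F'(2)] by simp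
    then have *: "bounded_derivs M S i (\<kappa> ^ M * K) (\<lambda>z. F' (c *\<^sub>R z + w))" by simp
    have scale: "bounded_derivs M S i (\<kappa> * L) (\<lambda>z. c *\<^sub>R G z)" if "bounded_derivs M S i L G" for L G
      using that
    proof (induction M arbitrary: G)
      case 0 then show ?case using c by (auto intro!: mult_mono)
    next
      case (Suc M)
      obtain G' where "\<forall>z\<in>S. ((\<lambda>r. G (z + r *\<^sub>R axis i 1)) has_vector_derivative G' z) (at 0)" "bounded_derivs M S i L G'"
        using Suc.prems by auto
      then show ?case using Suc.IH[of G'] Suc.prems c
        by (auto intro!: mult_mono exI[of _ "\<lambda>z. c *\<^sub>R G' z"] has_vector_derivative_scaleR[THEN has_vector_derivative_eq_rhs] derivative_eq_intros)
    qed
    show ?thesis using scale[OF *] by (simp add: mult.assoc)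
  qed
  have 2: "cmod (F z) \<le> \<kappa> ^ Suc M * K" for z
  proof -
    have "cmod (F z) \<le> K" using Suc.prems bounded_derivs_bound by blast
    also have "\<dots> \<le> \<kappa> ^ Suc M * K" using one_le_power[OF c(2), of "Suc M"] K by (simp add: mult_le_cancel_right1 del: power_Suc)
    finally show ?thesis .
  qed
  have 3: "((\<lambda>r. F (c *\<^sub>R (z + r *\<^sub>R axis i 1) + w)) has_vector_derivative c *\<^sub>R F' (c *\<^sub>R z + w)) (at 0)" for z
  proof -
    have "((\<lambda>r. F ((c *\<^sub>R z + w) + r *\<^sub>R axis i 1)) \<circ> (\<lambda>r. c * r) has_vector_derivative c *\<^sub>R F' (c *\<^sub>R z + w)) (at 0)"
      by (rule vector_diff_chain_at) (auto intro!: derivative_eq_intros F'(1))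
    then show ?thesis by (simp add: o_def algebra_simps)
  qed
  show ?case using 1 2 3 by (auto simp del: power_Suc intro!: exI[of _ "\<lambda>z. c *\<^sub>R F' (c *\<^sub>R z + w)"])
qed auto

text \<open>The derivative of \<open>1/F\<close> is \<open>- F' * (1/F) * (1/F)\<close>, a product of functions that are under control up to order \<open>M\<close> by
  induction. The bound is chosen before \<open>S\<close>, \<open>i\<close> and \<open>F\<close>: it depends on \<open>M\<close>, \<open>K\<close> and the lower bound only.\<close>
lemma bounded_derivs_inverse:
  assumes "0 < m"
  shows "\<exists>L\<ge>0. \<forall>S (i::'n::finite) F. bounded_derivs M S i K F \<and> (\<forall>z\<in>S. m \<le> cmod (F z)) \<longrightarrow> bounded_derivs M S i L (\<lambda>z. inverse (F z))"
proof (induction M)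
  case 0
  show ?case using assms by (intro exI[of _ "inverse m"]) (auto simp: norm_inverse intro!: le_imp_inverse_le)
next
  case (Suc M)
  then obtain L where L: "L \<ge> 0" "\<And>S (i::'n) F. bounded_derivs M S i K F \<Longrightarrow> (\<forall>z\<in>S. m \<le> cmod (F z)) \<Longrightarrow> bounded_derivs M S i L (\<lambda>z. inverse (F z))"
    by blast
  \<comment> \<open>A bound for \<open>1/F\<close> itself, and the product bound for its derivative.\<close>
  define N where "N = max (inverse m) (2 ^ M * (2 ^ M * L * \<bar>K\<bar>) * L)"
  have "bounded_derivs (Suc M) S i N (\<lambda>z. inverse (F z))"
    if F: "bounded_derivs (Suc M) S i K F" and m: "\<forall>z\<in>S. m \<le> cmod (F z)" for S and i :: 'n and F
  proof -
    obtain F' where F': "\<forall>z\<in>S. ((\<lambda>r. F (z + r *\<^sub>R axis i 1)) has_vector_derivative F' z) (at 0)" "bounded_derivs M S i K F'"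
      using F by auto
    have inv: "bounded_derivs M S i L (\<lambda>z. inverse (F z))"
      using L(2) bounded_derivs_Suc_le[OF F] m by blast
    have F'': "bounded_derivs M S i \<bar>K\<bar> F'" using F'(2) by (rule bounded_derivs_mono) simp
    have F''m: "bounded_derivs M S i \<bar>K\<bar> (\<lambda>z. - F' z)"
      using F''
    proof (induction M arbitrary: F')
      case (Suc M)
      then obtain G where "\<forall>z\<in>S. ((\<lambda>r. F' (z + r *\<^sub>R axis i 1)) has_vector_derivative G z) (at 0)" "bounded_derivs M S i \<bar>K\<bar> G"
        by auto
      then show ?case using Suc by (auto intro!: exI[of _ "\<lambda>z. - G z"] derivative_intros)
    qed auto
    have "bounded_derivs M S i (2 ^ M * (2 ^ M * L * \<bar>K\<bar>) * L) (\<lambda>z. inverse (F z) * (- F' z) * inverse (F z))"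
      using L(1) by (intro bounded_derivs_mult inv F''m) auto
    then have 1: "bounded_derivs M S i N (\<lambda>z. inverse (F z) * (- F' z) * inverse (F z))"
      by (rule bounded_derivs_mono) (simp add: N_def)
    have 2: "((\<lambda>r. inverse (F (z + r *\<^sub>R axis i 1))) has_vector_derivative inverse (F z) * (- F' z) * inverse (F z)) (at 0)" if z: "z \<in> S" for z
    proof -
      have nz: "F z \<noteq> 0" using m z assms by force
      have "(inverse \<circ> (\<lambda>r. F (z + r *\<^sub>R axis i 1)) has_vector_derivative F' z * (- (inverse (F z) ^ Suc (Suc 0)))) (at 0)"
        using F'(1) z DERIV_inverse[OF nz] by (intro field_vector_diff_chain_at) auto
      then show ?thesis by (simp add: o_def mult_ac)
    qed
    have 3: "cmod (inverse (F z)) \<le> N" if z: "z \<in> S" for z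
    proof -
      have "cmod (inverse (F z)) \<le> inverse m" using m z assms by (auto simp: norm_inverse intro!: le_imp_inverse_le)
      then show ?thesis by (simp add: N_def)
    qed
    show ?thesis unfolding bounded_derivs.simps
      by (intro conjI ballI exI[of _ "\<lambda>z. inverse (F z) * (- F' z) * inverse (F z)"] 1 2 3)
  qed
  note step = this
  have nonneg: "0 \<le> N" using assms by (simp add: N_def le_max_iff_disj)
  show ?case
    by (intro exI[of _ N] conjI allI impI nonneg) (elim conjE, rule step)
qed

lemma axis_line_eventually:
  fixes z :: "real ^ 'n::finite" and i :: 'n
  assumes "open S" "z \<in> S"
  shows "eventually (\<lambda>r. z + r *\<^sub>R axis i (1::real) \<in> S) (nhds 0)"
proof -
  have "((\<lambda>r. z + r *\<^sub>R axis i (1::real)) \<longlongrightarrow> z + 0 *\<^sub>R axis i 1) (nhds 0)"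
    by (intro tendsto_intros filterlim_ident)
  then show ?thesis using topological_tendstoD[OF _ assms(1)] assms(2) by fastforce
qed

lemma axis_derivative_cong:
  fixes z :: "real ^ 'n::finite" and i :: 'n and F G :: "real ^ 'n \<Rightarrow> complex"
  assumes "open S" "z \<in> S" "\<And>y. y \<in> S \<Longrightarrow> F y = G y"
    and "((\<lambda>r. F (z + r *\<^sub>R axis i 1)) has_vector_derivative D) (at 0)"
  shows "((\<lambda>r. G (z + r *\<^sub>R axis i 1)) has_vector_derivative D) (at 0)"
proof -
  have "eventually (\<lambda>r. F (z + r *\<^sub>R axis i 1) = G (z + r *\<^sub>R axis i 1)) (nhds 0)"
    using axis_line_eventually[OF assms(1,2), of i] by eventually_elim (auto simp: assms(3))
  then have "((\<lambda>r. F (z + r *\<^sub>R axis i 1)) has_vector_derivative D) (at 0) = ((\<lambda>r. G (z + r *\<^sub>R axis i 1)) has_vector_derivative D) (at 0)"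
    by (intro has_vector_derivative_cong_ev) (auto simp: assms)
  with assms(4) show ?thesis by simp
qed

lemma bounded_derivs_cong:
  assumes "open S" "\<And>y. y \<in> S \<Longrightarrow> F y = G y" "bounded_derivs M S i K F"
  shows "bounded_derivs M S i K G"
proof (cases M)
  case (Suc M')
  obtain F' where F': "\<forall>z\<in>S. ((\<lambda>r. F (z + r *\<^sub>R axis i 1)) has_vector_derivative F' z) (at 0)" "bounded_derivs M' S i K F'"
    using assms(3) Suc by auto
  have "((\<lambda>r. G (z + r *\<^sub>R axis i 1)) has_vector_derivative F' z) (at 0)" if "z \<in> S" for z
    using axis_derivative_cong[OF assms(1) that, of F G i] assms(2) F'(1) that by blast
  then show ?thesis using Suc assms F' by auto
qed (use assms in auto)

text \<open>A function vanishing off a closed subset of \<open>S\<close> has vanishing derivatives there, by uniqueness of derivatives, so the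
  derivatives on \<open>S\<close> can be continued by 0. This globalises bounds for a quotient whose denominator is only
  controlled on \<open>S\<close>.\<close>
lemma bounded_derivs_extend:
  fixes F :: "real ^ 'n::finite \<Rightarrow> complex"
  assumes "open S" "closed C" "C \<subseteq> S" "0 \<le> K"
  shows "bounded_derivs M S i K F \<Longrightarrow> (\<And>z. z \<notin> C \<Longrightarrow> F z = 0) \<Longrightarrow> bounded_derivs M UNIV i K F"
proof (induction M arbitrary: F)
  case 0
  have "cmod (F z) \<le> K" for z using 0 assms(3,4) by (cases "z \<in> C") auto
  then show ?case by simp
next
  case (Suc M)
  obtain F' where F': "\<And>z. z \<in> S \<Longrightarrow> ((\<lambda>r. F (z + r *\<^sub>R axis i 1)) has_vector_derivative F' z) (at 0)" "bounded_derivs M S i K F'"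
    using Suc.prems(1) by auto
  define G where "G z = (if z \<in> S then F' z else 0)" for z
  have oC: "open (- C)" using assms by auto
  have off: "((\<lambda>r. F (z + r *\<^sub>R axis i 1)) has_vector_derivative 0) (at 0)" if "z \<notin> C" for z
    using axis_derivative_cong[OF oC, of z "\<lambda>_. 0" F i 0] that Suc.prems(2) by auto
  have G: "((\<lambda>r. F (z + r *\<^sub>R axis i 1)) has_vector_derivative G z) (at 0)" for z
    using F'(1)[of z] off[of z] assms(3) by (auto simp: G_def)
  have "G z = 0" if "z \<notin> C" for z
    using vector_derivative_unique_at[OF G off[OF that]] by simp
  moreover have "bounded_derivs M S i K G"
    by (rule bounded_derivs_cong[OF assms(1) _ F'(2)]) (simp add: G_def)
  ultimately have "bounded_derivs M UNIV i K G" using Suc.IH by blast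
  moreover have "cmod (F z) \<le> K" for z
    using bounded_derivs_bound[OF Suc.prems(1), of z] Suc.prems(2)[of z] assms by (cases "z \<in> C") auto
  ultimately show ?case unfolding bounded_derivs.simps using G by (intro conjI ballI exI[of _ G])
qed

section \<open>Decay of Fourier integrals\<close>

lemma axis_derivative_shift:
  fixes F :: "real ^ 'n::finite \<Rightarrow> complex"
  assumes "\<And>z. ((\<lambda>r. F (z + r *\<^sub>R axis i 1)) has_vector_derivative F' z) (at 0)"
  shows "((\<lambda>r. F (z + r *\<^sub>R axis i 1)) has_vector_derivative F' (z + r0 *\<^sub>R axis i 1)) (at r0 within T)"
proof -
  have "((\<lambda>r. F ((z + r0 *\<^sub>R axis i 1) + r *\<^sub>R axis i 1)) \<circ> (\<lambda>r. r - r0) has_vector_derivative 1 *\<^sub>R F' (z + r0 *\<^sub>R axis i 1)) (at r0)"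
    by (rule vector_diff_chain_at) (auto intro!: derivative_eq_intros assms)
  then have "((\<lambda>r. F (z + r *\<^sub>R axis i 1)) has_vector_derivative F' (z + r0 *\<^sub>R axis i 1)) (at r0)"
    by (simp add: o_def algebra_simps)
  then show ?thesis by (rule has_vector_derivative_at_within)
qed

lemma axis_difference_bound:
  fixes F :: "real ^ 'n::finite \<Rightarrow> complex"
  assumes "\<And>z. ((\<lambda>r. F (z + r *\<^sub>R axis i 1)) has_vector_derivative F' z) (at 0)" "\<And>z. cmod (F' z) \<le> L"
  shows "cmod (F (z + h *\<^sub>R axis i 1) - F z) \<le> L * \<bar>h\<bar>"
proof -
  have "norm ((\<lambda>r. F (z + r *\<^sub>R axis i 1)) h - (\<lambda>r. F (z + r *\<^sub>R axis i 1)) 0) \<le> L * norm (h - 0)"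
  proof (rule differentiable_bound[of UNIV _ "\<lambda>r t. t *\<^sub>R F' (z + r *\<^sub>R axis i 1)"])
    show "((\<lambda>r. F (z + r *\<^sub>R axis i 1)) has_derivative (\<lambda>t. t *\<^sub>R F' (z + r *\<^sub>R axis i 1))) (at r within UNIV)" for r
      using axis_derivative_shift[OF assms(1), of z r UNIV] by (simp add: has_vector_derivative_def)
    show "onorm (\<lambda>t. t *\<^sub>R F' (z + r *\<^sub>R axis i 1)) \<le> L" for r
      by (rule onorm_le) (metis abs_ge_zero assms(2) mult.commute mult_left_mono norm_scaleR real_norm_def)
  qed auto
  then show ?thesis by simp
qed

lemma
  fixes F :: "real ^ 'n::finite \<Rightarrow> complex"
  assumes der: "\<And>z. ((\<lambda>r. F (z + r *\<^sub>R axis i 1)) has_vector_derivative F' z) (at 0)"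
    and m[measurable]: "F \<in> borel_measurable borel"
  shows axis_difference_quotient_tendsto: "\<And>z. (\<lambda>m. (F (z + inverse (real (Suc m)) *\<^sub>R axis i 1) - F z) /\<^sub>R inverse (real (Suc m))) \<longlonglongrightarrow> F' z"
    and axis_derivative_borel: "F' \<in> borel_measurable borel"
proof -
  show lim: "(\<lambda>m. (F (z + inverse (real (Suc m)) *\<^sub>R axis i 1) - F z) /\<^sub>R inverse (real (Suc m))) \<longlonglongrightarrow> F' z" for z
  proof -
    have "((\<lambda>r. (F (z + r *\<^sub>R axis i 1) - F z) /\<^sub>R r) \<longlongrightarrow> F' z) (at 0)"
    proof -
      have "((\<lambda>r. norm (F (z + r *\<^sub>R axis i 1) - F z - r *\<^sub>R F' z) / norm r) \<longlongrightarrow> 0) (at 0)"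
        using der[of z] unfolding has_vector_derivative_def has_derivative_at by simp
      then have "((\<lambda>r. norm ((F (z + r *\<^sub>R axis i 1) - F z) /\<^sub>R r - F' z)) \<longlongrightarrow> 0) (at 0)"
      proof (rule Lim_transform_eventually)
        have "norm (F (z + r *\<^sub>R axis i 1) - F z - r *\<^sub>R F' z) / norm r = norm ((F (z + r *\<^sub>R axis i 1) - F z) /\<^sub>R r - F' z)" if "r \<noteq> 0" for r
        proof -
          have "(F (z + r *\<^sub>R axis i 1) - F z) /\<^sub>R r - F' z = (F (z + r *\<^sub>R axis i 1) - F z - r *\<^sub>R F' z) /\<^sub>R r"
            using that by (simp add: scaleR_diff_right)
          then show ?thesis by (simp only: norm_scaleR norm_inverse) (simp add: divide_inverse mult.commute)
        qed
        then show "\<forall>\<^sub>F r in at 0. norm (F (z + r *\<^sub>R axis i 1) - F z - r *\<^sub>R F' z) / norm r = norm ((F (z + r *\<^sub>R axis i 1) - F z) /\<^sub>R r - F' z)"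
          by (simp add: eventually_at_filter)
      qed
      then show ?thesis by (rule Lim_null[THEN iffD2, OF tendsto_norm_zero_cancel])
    qed
    moreover have "filterlim (\<lambda>m. inverse (real (Suc m))) (at 0) sequentially"
      unfolding filterlim_at using LIMSEQ_inverse_real_of_nat by auto
    ultimately show ?thesis by (rule filterlim_compose)
  qed
  show "F' \<in> borel_measurable borel"
    by (rule borel_measurable_LIMSEQ_metric[OF _ lim]) measurable
qed

lemma continuous_compact_support_bounded:
  fixes F :: "real ^ 'n::finite \<Rightarrow> complex"
  assumes "continuous_on UNIV F" "\<And>z. R < norm z \<Longrightarrow> F z = 0"
  obtains K where "0 < K" "\<And>z. cmod (F z) \<le> K"
proof -
  have "compact (F ` cball 0 R)"
    using assms(1) by (intro compact_continuous_image) (auto elim: continuous_on_subset)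
  then obtain K where K: "0 < K" "\<And>z. z \<in> cball 0 R \<Longrightarrow> cmod (F z) \<le> K"
    using bounded_pos[of "F ` cball 0 R"] compact_imp_bounded by auto
  have "cmod (F z) \<le> K" for z using K assms(2)[of z] by (cases "norm z \<le> R") auto
  then show ?thesis using that K(1) by blast
qed

lemma integrable_bounded_support:
  fixes G :: "real ^ 'n::finite \<Rightarrow> complex"
  assumes [measurable]: "G \<in> borel_measurable borel" and "\<And>z. cmod (G z) \<le> K" "\<And>z. R < norm z \<Longrightarrow> G z = 0"
  shows "integrable lborel G" "cmod (LINT z|lborel. G z) \<le> K * measure lborel (cball 0 R :: (real ^ 'n) set)"
proof -
  have i: "integrable lborel (\<lambda>z. K * indicator (cball 0 R) z :: real)" (is "integrable _ ?k")
    by (intro integrable_mult_right integrable_real_indicator) (simp, rule emeasure_bounded_finite[OF bounded_cball])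
  have le: "cmod (G z) \<le> K * indicator (cball 0 R) z" for z
    using assms(2,3)[of z] by (auto simp: indicator_def not_le)
  show "integrable lborel G"
  proof (rule Bochner_Integration.integrable_bound[OF i])
    show "AE z in lborel. norm (G z) \<le> norm (K * indicator (cball 0 R) z)"
      using order_trans[OF le abs_ge_self] by (intro AE_I2) (simp only: real_norm_def)
  qed simp
  have "cmod (LINT z|lborel. G z) \<le> (LINT z|lborel. K * indicator (cball (0::real^'n) R) z)"
    using \<open>integrable lborel G\<close> i le by (intro order_trans[OF integral_norm_bound] integral_mono) auto
  then show "cmod (LINT z|lborel. G z) \<le> K * measure lborel (cball 0 R :: (real ^ 'n) set)" by simp
qed

lemma continuous_compact_support_integrable:
  fixes F :: "real ^ 'n::finite \<Rightarrow> complex"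
  assumes "continuous_on UNIV F" "\<And>z. R < norm z \<Longrightarrow> F z = 0"
  shows "integrable lborel F"
proof -
  obtain K where "0 < K" "\<And>z. cmod (F z) \<le> K"
    using continuous_compact_support_bounded[OF assms] by blast
  then show ?thesis
    using assms by (intro integrable_bounded_support(1)[of F K R] borel_measurable_continuous_onI)
qed

text \<open>The difference quotients have integral 0 by translation invariance; they are dominated by the derivative bound on a
  fixed ball and converge to \<open>G'\<close>.\<close>
lemma integral_axis_derivative_zero:
  fixes G :: "real ^ 'n::finite \<Rightarrow> complex"
  assumes der: "\<And>z. ((\<lambda>r. G (z + r *\<^sub>R axis i 1)) has_vector_derivative G' z) (at 0)"
    and m[measurable]: "G \<in> borel_measurable borel" and bd: "\<And>z. cmod (G' z) \<le> L" and bd0: "\<And>z. cmod (G z) \<le> K"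
    and supp: "\<And>z. R < norm z \<Longrightarrow> G z = 0"
  shows "(LINT z|lborel. G' z) = 0"
proof -
  define h where "h m = inverse (real (Suc m))" for m
  have h: "0 < h m" "h m \<le> 1" for m by (auto simp: h_def inverse_le_1_iff)
  define q where "q m z = (G (z + h m *\<^sub>R axis i 1) - G z) /\<^sub>R h m" for m z
  have L: "0 \<le> L" using bd[of 0] norm_ge_zero order_trans by blast
  have [measurable]: "G' \<in> borel_measurable borel" using axis_derivative_borel[OF der m] .
  have Gi: "integrable lborel G"
    by (rule integrable_bounded_support(1)[where K=K and R=R]) (use bd0 supp in auto)
  have "(\<lambda>m. LINT z|lborel. q m z) \<longlonglongrightarrow> (LINT z|lborel. G' z)"
  proof (rule integral_dominated_convergence)
    show "integrable lborel (\<lambda>z. L * indicator (cball 0 (R + 1)) z :: real)" 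
      by (intro integrable_mult_right integrable_real_indicator) (simp, rule emeasure_bounded_finite[OF bounded_cball])
    show "AE z in lborel. (\<lambda>m. q m z) \<longlonglongrightarrow> G' z"
      unfolding q_def h_def using axis_difference_quotient_tendsto[OF der m] by auto
    show "AE z in lborel. norm (q m z) \<le> L * indicator (cball 0 (R + 1)) z" for m
    proof (intro AE_I2)
      fix z :: "real ^ 'n"
      show "norm (q m z) \<le> L * indicator (cball 0 (R + 1)) z"
      proof (cases "norm z \<le> R + 1")
        case True
        have "norm (q m z) = cmod (G (z + h m *\<^sub>R axis i 1) - G z) / h m" using h[of m] by (simp add: q_def divide_inverse mult.commute)
        also have "\<dots> \<le> L * \<bar>h m\<bar> / h m" using h[of m] by (intro divide_right_mono axis_difference_bound[OF der bd]) auto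
        also have "\<dots> = L" using h[of m] by simp
        finally show ?thesis using True by simp
      next
        case False
        have "norm z - norm (h m *\<^sub>R axis i (1::real)) \<le> norm (z + h m *\<^sub>R axis i 1)" by (metis norm_diff_ineq)
        then have "R < norm (z + h m *\<^sub>R axis i 1)" using False h[of m] by simp
        then show ?thesis using False L supp by (simp add: q_def)
      qed
    qed
  qed (auto simp: q_def[abs_def])
  moreover have "(LINT z|lborel. q m z) = 0" for m
  proof -
    have "integrable lborel (\<lambda>z. G (h m *\<^sub>R axis i 1 + 1 *\<^sub>R z))"
      using Gi by (subst lborel_integrable_affine) auto
    moreover have "(LINT z|lborel. G (h m *\<^sub>R axis i 1 + 1 *\<^sub>R z)) = (LINT z|lborel. G z)"
      by (subst lborel_integral_affine) auto
    ultimately show ?thesis using Gi unfolding q_def by (simp add: add.commute)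
  qed
  ultimately show ?thesis by (simp add: LIMSEQ_const_iff)
qed

text \<open>Integration by parts \<open>M\<close> times in the coordinate \<open>i\<close>.\<close>
lemma fourier_decay:
  fixes F :: "real ^ 'n::finite \<Rightarrow> complex"
  assumes "bounded_derivs M UNIV i K F" "F \<in> borel_measurable borel" "\<And>z. R < norm z \<Longrightarrow> F z = 0"
  shows "\<bar>v $ i\<bar> ^ M * cmod (LINT z|lborel. F z * iexp (v \<bullet> z)) \<le> K * measure lborel (cball 0 R :: (real ^ 'n) set)"
  using assms
proof (induction M arbitrary: F)
  case 0
  then have [measurable]: "F \<in> borel_measurable borel" by simp
  show ?case
    using 0 by (auto intro!: integrable_bounded_support(2) simp: norm_mult)
next
  case (Suc M)
  note [measurable] = Suc.prems(2)
  obtain F' where F': "\<And>z. ((\<lambda>r. F (z + r *\<^sub>R axis i 1)) has_vector_derivative F' z) (at 0)" "bounded_derivs M UNIV i K F'"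
    using Suc.prems(1) by auto
  have [measurable]: "F' \<in> borel_measurable borel" using axis_derivative_borel[OF F'(1)] by simp
  have F'0: "F' z = 0" if "R < norm z" for z
  proof -
    have "open {z::real^'n. R < norm z}" by (intro open_Collect_less continuous_intros)
    from axis_derivative_cong[OF this _ _ F'(1), of z "\<lambda>_. 0"] that Suc.prems(3)
    have "((\<lambda>r. 0) has_vector_derivative F' z) (at (0::real))" by auto
    from vector_derivative_unique_at[OF this has_vector_derivative_const] show ?thesis .
  qed
  let ?e = "\<lambda>z. iexp (v \<bullet> z)"
  have bF: "cmod (F z) \<le> K" for z using bounded_derivs_bound[OF Suc.prems(1)] by simp
  have bF': "cmod (F' z) \<le> K" for z using bounded_derivs_bound[OF F'(2)] by simp
  have e': "((\<lambda>r. ?e (z + r *\<^sub>R axis i 1)) has_vector_derivative \<i> * v $ i * ?e z) (at 0)" for z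
  proof -
    have "((\<lambda>w. exp (\<i> * (complex_of_real (v \<bullet> z) + w * v $ i))) has_field_derivative \<i> * v $ i * ?e z) (at (of_real 0))"
      by (auto intro!: derivative_eq_intros)
    from has_vector_derivative_real_field[OF this] show ?thesis
      by (simp add: inner_add_right inner_axis)
  qed
  have der: "((\<lambda>r. F (z + r *\<^sub>R axis i 1) * ?e (z + r *\<^sub>R axis i 1)) has_vector_derivative F z * (\<i> * v $ i * ?e z) + F' z * ?e z) (at 0)" for z
    using has_vector_derivative_mult[OF F'(1) e', of z z] by simp
  have "(LINT z|lborel. F z * (\<i> * v $ i * ?e z) + F' z * ?e z) = 0"
  proof (rule integral_axis_derivative_zero[OF der, where R=R and K=K and L="K * \<bar>v $ i\<bar> + K"])
    show "cmod (F z * (\<i> * v $ i * ?e z) + F' z * ?e z) \<le> K * \<bar>v $ i\<bar> + K" for z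
      by (rule norm_triangle_mono) (use bF bF' in \<open>auto simp: norm_mult intro: mult_right_mono\<close>)
  qed (use bF Suc.prems(3) in \<open>auto simp: norm_mult\<close>)
  moreover have "integrable lborel (\<lambda>z. F' z * ?e z)"
    by (rule integrable_bounded_support(1)[where K=K and R=R]) (use bF' F'0 in \<open>auto simp: norm_mult\<close>)
  moreover have i1: "integrable lborel (\<lambda>z. F z * ?e z)"
    by (rule integrable_bounded_support(1)[where K=K and R=R]) (use bF Suc.prems(3) in \<open>auto simp: norm_mult\<close>)
  moreover have "integrable lborel (\<lambda>z. F z * (\<i> * v $ i * ?e z))"
    using integrable_mult_right[OF i1, of "\<i> * v $ i"] by (simp add: mult_ac)
  moreover have "(LINT z|lborel. F z * (\<i> * v $ i * ?e z)) = \<i> * v $ i * (LINT z|lborel. F z * ?e z)"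
    by (subst integral_mult_right_zero[symmetric]) (simp add: mult_ac)
  ultimately have "\<i> * v $ i * (LINT z|lborel. F z * ?e z) = - (LINT z|lborel. F' z * ?e z)"
    by (simp add: add_eq_0_iff2)
  then have "cmod (\<i> * v $ i * (LINT z|lborel. F z * ?e z)) = cmod (LINT z|lborel. F' z * ?e z)" by simp
  then have "\<bar>v $ i\<bar> * cmod (LINT z|lborel. F z * ?e z) = cmod (LINT z|lborel. F' z * ?e z)"
    by (simp add: norm_mult)
  then have "\<bar>v $ i\<bar> ^ Suc M * cmod (LINT z|lborel. F z * ?e z) = \<bar>v $ i\<bar> ^ M * cmod (LINT z|lborel. F' z * ?e z)"
    by (simp add: mult_ac)
  also have "\<dots> \<le> K * measure lborel (cball 0 R :: (real ^ 'n) set)"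
    by (rule Suc.IH[OF F'(2) _ F'0]) auto
  finally show ?case .
qed

lemma smooth_partial_deriv: "smooth F \<Longrightarrow> smooth (partial_deriv i F)"
  unfolding smooth_def
proof (intro allI)
  fix "is" and t :: "real ^ 'a" assume "\<forall>is t. partial_derivs is F differentiable (at t)"
  then have "partial_derivs (is @ [i]) F differentiable (at t)" by blast
  then show "partial_derivs is (partial_deriv i F) differentiable (at t)" by (simp add: partial_derivs_def)
qed

lemma smooth_differentiable: "smooth F \<Longrightarrow> F differentiable (at t)"
  unfolding smooth_def by (metis foldr.simps(1) id_apply partial_derivs_def)

lemma smooth_cont: "smooth F \<Longrightarrow> continuous_on UNIV F"
  by (meson continuous_at_imp_continuous_on differentiable_imp_continuous_within smooth_differentiable)

lemma partial_deriv_line: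
  assumes "F differentiable (at z)"
  shows "((\<lambda>r. F (z + r *\<^sub>R axis i 1)) has_vector_derivative partial_deriv i F z) (at 0)"
proof -
  have "(F has_derivative frechet_derivative F (at z)) (at (z + 0 *\<^sub>R axis i 1))"
    using assms frechet_derivative_works[of F "at z"] by simp
  moreover have "((\<lambda>r. z + r *\<^sub>R axis i 1) has_derivative (\<lambda>h. h *\<^sub>R axis i 1)) (at 0)"
    by (auto intro!: derivative_eq_intros)
  ultimately have "((\<lambda>r. F (z + r *\<^sub>R axis i 1)) has_derivative (\<lambda>h. frechet_derivative F (at z) (h *\<^sub>R axis i 1))) (at 0)"
    by (metis has_derivative_compose)
  moreover have "frechet_derivative F (at z) (h *\<^sub>R axis i 1) = h *\<^sub>R partial_deriv i F z" for h
    unfolding partial_deriv_def using linear_frechet_derivative[OF assms] by (simp add: linear_cmul)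
  ultimately show ?thesis by (simp add: has_vector_derivative_def)
qed

text \<open>Smooth functions of compact support satisfy the bounds of every order: partial derivatives are again smooth with the
  same support, and continuous functions of compact support are bounded.\<close>
lemma smooth_compact_support_bounded_derivs:
  fixes F :: "real ^ 'n::finite \<Rightarrow> complex"
  assumes "smooth F" "\<And>z. R < norm z \<Longrightarrow> F z = 0"
  shows "\<exists>K\<ge>0. \<forall>i. bounded_derivs M UNIV i K F"
  using assms
proof (induction M arbitrary: F)
  case 0
  obtain K where "0 < K" "\<And>z. cmod (F z) \<le> K"
    using continuous_compact_support_bounded[OF smooth_cont[OF 0(1)] 0(2)] by blast
  then show ?case by (intro exI[of _ K]) auto
next
  case (Suc M)
  have "\<exists>K\<ge>0. \<forall>j. bounded_derivs M UNIV j K (partial_deriv i F)" for i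
  proof (rule Suc.IH[OF smooth_partial_deriv[OF Suc.prems(1)]])
    fix z :: "real ^ 'n" assume "R < norm z"
    moreover have "open {z::real^'n. R < norm z}" by (intro open_Collect_less continuous_intros)
    ultimately have "((\<lambda>r. 0) has_vector_derivative partial_deriv i F z) (at (0::real))"
      using axis_derivative_cong[of "{z. R < norm z}" z F "\<lambda>_. 0", OF _ _ _ partial_deriv_line[OF smooth_differentiable]] Suc.prems by auto
    from vector_derivative_unique_at[OF this has_vector_derivative_const] show "partial_deriv i F z = 0" .
  qed
  then obtain K where K: "\<And>i. K i \<ge> 0" "\<And>i. bounded_derivs M UNIV i (K i) (partial_deriv i F)" by metis
  obtain K0 where K0: "0 < K0" and bF: "\<And>z. cmod (F z) \<le> K0"
    using continuous_compact_support_bounded[OF smooth_cont[OF Suc.prems(1)] Suc.prems(2)] by blast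
  define L where "L = K0 + (\<Sum>i\<in>UNIV. K i)"
  have "K i \<le> L" for i
  proof -
    have "K i \<le> (\<Sum>i\<in>UNIV. K i)" by (rule member_le_sum) (auto simp: K)
    then show ?thesis using K0 by (simp add: L_def)
  qed
  moreover have "0 \<le> (\<Sum>i\<in>UNIV. K i)" by (intro sum_nonneg) (simp add: K)
  ultimately have "bounded_derivs (Suc M) UNIV i L F" for i
    using K(2)[of i] bF partial_deriv_line[OF smooth_differentiable[OF Suc.prems(1)]]
    by (auto intro!: exI[of _ "partial_deriv i F"] intro: bounded_derivs_mono simp: L_def add_increasing2)
  moreover have "0 \<le> L" using K0 \<open>0 \<le> (\<Sum>i\<in>UNIV. K i)\<close> by (simp add: L_def)
  ultimately show ?case by blast
qed

section \<open>Schwartz functions and their series\<close>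

lemma partial_derivs_Nil: "partial_derivs [] g = g"
  by (simp add: partial_derivs_def)

lemma partial_derivs_Cons: "partial_derivs (i # is) g = partial_deriv i (partial_derivs is g)"
  by (simp add: partial_derivs_def)

lemma partial_derivs_snoc: "partial_derivs (is @ [i]) g = partial_derivs is (partial_deriv i g)"
  by (simp add: partial_derivs_def)

lemma smooth_partial_derivs: "smooth g \<Longrightarrow> partial_derivs is g differentiable (at t)"
  by (simp add: smooth_def)

lemma partial_derivI: "(g has_derivative D) (at t) \<Longrightarrow> partial_deriv i g t = D (axis i 1)"
  unfolding partial_deriv_def using frechet_derivative_at by metis

lemma differentiable_has_frechet: "g differentiable (at t) \<Longrightarrow> (g has_derivative frechet_derivative g (at t)) (at t)"
  using frechet_derivative_works[of g "at t"] by simp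

lemma partial_derivs_lincomb:
  assumes "smooth f" "smooth g"
  shows "partial_derivs is (\<lambda>t. a * f t + b * g t) = (\<lambda>t. a * partial_derivs is f t + b * partial_derivs is g t)"
proof (induction "is")
  case (Cons i "is")
  have "partial_deriv i (\<lambda>t. a * partial_derivs is f t + b * partial_derivs is g t) t
     = a * partial_deriv i (partial_derivs is f) t + b * partial_deriv i (partial_derivs is g) t" for t
    by (subst partial_derivI, rule has_derivative_add, (rule has_derivative_mult_right, rule differentiable_has_frechet, rule smooth_partial_derivs, fact)+)
      (simp add: partial_deriv_def)
  then show ?case by (simp add: partial_derivs_Cons Cons fun_eq_iff)
qed (simp add: partial_derivs_Nil)

lemma schwartz_smooth: "g \<in> schwartz \<Longrightarrow> smooth g"
  by (simp add: schwartz_def)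

lemma schwartz_bound: "g \<in> schwartz \<Longrightarrow> (1 + norm t) ^ N * cmod (partial_derivs is g t) \<le> schwartz_seminorm N is g"
  unfolding schwartz_def schwartz_seminorm_def by (intro cSUP_upper) auto

lemma schwartz_seminorm_nonneg: "g \<in> schwartz \<Longrightarrow> 0 \<le> schwartz_seminorm N is g"
  by (rule order_trans[OF _ schwartz_bound[of g 0]]) simp_all

lemma schwartz_seminorm_le: "(\<And>t. (1 + norm t) ^ N * cmod (partial_derivs is g t) \<le> B) \<Longrightarrow> schwartz_seminorm N is g \<le> B"
  unfolding schwartz_seminorm_def by (rule cSUP_least) auto

lemma schwartzI:
  assumes "smooth g" "\<And>N is t. (1 + norm t) ^ N * cmod (partial_derivs is g t) \<le> B N is"
  shows "g \<in> schwartz"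
  using assms by (auto simp: schwartz_def bdd_above_def)

lemma schwartz_lincomb:
  assumes "f \<in> schwartz" "g \<in> schwartz"
  shows "(\<lambda>t. a * f t + b * g t) \<in> schwartz"
proof (rule schwartzI)
  note sm = assms[THEN schwartz_smooth]
  show "smooth (\<lambda>t. a * f t + b * g t)"
    unfolding smooth_def partial_derivs_lincomb[OF sm]
    using sm by (auto intro!: differentiable_add differentiable_mult differentiable_const smooth_partial_derivs)
  show "(1 + norm t) ^ N * cmod (partial_derivs is (\<lambda>t. a * f t + b * g t) t)
     \<le> cmod a * schwartz_seminorm N is f + cmod b * schwartz_seminorm N is g" for N "is" t
  proof -
    have "cmod (a * partial_derivs is f t + b * partial_derivs is g t) \<le> cmod a * cmod (partial_derivs is f t) + cmod b * cmod (partial_derivs is g t)"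
      using norm_triangle_ineq[of "a * partial_derivs is f t" "b * partial_derivs is g t"] by (simp add: norm_mult)
    then have "(1 + norm t) ^ N * cmod (a * partial_derivs is f t + b * partial_derivs is g t)
       \<le> (1 + norm t) ^ N * (cmod a * cmod (partial_derivs is f t) + cmod b * cmod (partial_derivs is g t))"
      by (intro mult_left_mono) auto
    also have "\<dots> = cmod a * ((1 + norm t) ^ N * cmod (partial_derivs is f t)) + cmod b * ((1 + norm t) ^ N * cmod (partial_derivs is g t))"
      by (simp add: algebra_simps)
    also have "\<dots> \<le> cmod a * schwartz_seminorm N is f + cmod b * schwartz_seminorm N is g"
      by (intro add_mono mult_left_mono schwartz_bound assms) auto
    finally show ?thesis by (simp add: partial_derivs_lincomb[OF sm])
  qed
qed

lemma schwartz_add: "f \<in> schwartz \<Longrightarrow> g \<in> schwartz \<Longrightarrow> (\<lambda>t. f t + g t) \<in> schwartz"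
  using schwartz_lincomb[of f g 1 1] by simp

lemma schwartz_mult: "f \<in> schwartz \<Longrightarrow> (\<lambda>t. a * f t) \<in> schwartz"
  using schwartz_lincomb[of f f a 0] by simp

lemma schwartz_zero: "(\<lambda>t. 0) \<in> schwartz"
proof -
  have "partial_derivs is (\<lambda>t::real^'a. 0) = (\<lambda>t. 0)" for "is"
  proof (induction "is")
    case (Cons i "is")
    have "partial_deriv i (\<lambda>t::real^'a. 0) t = 0" for t by (subst partial_derivI[OF has_derivative_const]) simp
    then show ?case by (simp add: partial_derivs_Cons Cons fun_eq_iff)
  qed (simp add: partial_derivs_Nil)
  then show ?thesis by (intro schwartzI[of _ "\<lambda>_ _. 0"]) (auto simp: smooth_def)
qed

lemma schwartz_sum: "finite I \<Longrightarrow> (\<And>k. k \<in> I \<Longrightarrow> u k \<in> schwartz) \<Longrightarrow> (\<lambda>t. \<Sum>k\<in>I. u k t) \<in> schwartz"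
  by (induction I rule: finite_induct) (auto intro: schwartz_add schwartz_zero)

lemma schwartz_partial_deriv: "g \<in> schwartz \<Longrightarrow> partial_deriv i g \<in> schwartz"
  by (rule schwartzI[where B="\<lambda>N is. schwartz_seminorm N (is @ [i]) g"])
    (auto intro: smooth_partial_deriv schwartz_smooth simp: partial_derivs_snoc[symmetric] schwartz_bound)

lemma tempered_add:
  assumes "tempered_distribution f" "g \<in> schwartz" "h \<in> schwartz"
  shows "f (\<lambda>t. g t + h t) = f g + f h"
proof -
  have "\<forall>g\<in>schwartz. \<forall>h\<in>schwartz. f (\<lambda>t. g t + h t) = f g + f h"
    using assms(1) unfolding tempered_distribution_def by (elim conjE)
  from this[rule_format, OF assms(2,3)] show ?thesis .
qed

lemma tempered_mult:
  assumes "tempered_distribution f" "g \<in> schwartz"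
  shows "f (\<lambda>t. c * g t) = c * f g"
proof -
  have "\<forall>c. \<forall>g\<in>schwartz. f (\<lambda>t. c * g t) = c * f g"
    using assms(1) unfolding tempered_distribution_def by (elim conjE)
  from this[rule_format, OF assms(2)] show ?thesis .
qed

lemma tempered_bound:
  assumes "tempered_distribution f"
  obtains C N m where "\<And>g. g \<in> schwartz \<Longrightarrow> cmod (f g) \<le> C * (\<Sum>is | length is \<le> m. schwartz_seminorm N is g)"
proof -
  have "\<exists>C N m. \<forall>g\<in>schwartz. cmod (f g) \<le> C * (\<Sum>is | length is \<le> m. schwartz_seminorm N is g)"
    using assms unfolding tempered_distribution_def by (elim conjE)
  then obtain C N m where *: "\<forall>g\<in>schwartz. cmod (f g) \<le> C * (\<Sum>is | length is \<le> m. schwartz_seminorm N is g)"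
    by (elim exE)
  show ?thesis by (rule that[of C N m]) (rule *[rule_format], assumption)
qed

lemma tempered_sum:
  assumes "tempered_distribution f" "finite I" "\<And>k. k \<in> I \<Longrightarrow> u k \<in> schwartz"
  shows "f (\<lambda>t. \<Sum>k\<in>I. u k t) = (\<Sum>k\<in>I. f (u k))"
  using assms(2,3)
proof (induction I rule: finite_induct)
  case empty
  show ?case using tempered_mult[OF assms(1) schwartz_zero, of 0] by simp
next
  case (insert k I)
  have "f (\<lambda>t. u k t + (\<Sum>k\<in>I. u k t)) = f (u k) + f (\<lambda>t. \<Sum>k\<in>I. u k t)"
    using insert by (intro tempered_add[OF assms(1)] schwartz_sum) auto
  then show ?case using insert by simp
qed

text \<open>A packet with free amplitude and without its normalising factor. The complex conjugate of a packet is such a wave at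
  the frequency \<open>- \<xi>\<close>.\<close>
definition wave :: "real \<Rightarrow> real ^ 'n::finite \<Rightarrow> real ^ 'n \<Rightarrow> (real ^ 'n \<Rightarrow> complex) \<Rightarrow> real ^ 'n \<Rightarrow> complex" where
  "wave l x \<xi> g = (\<lambda>t. g (l *\<^sub>R (t - x)) * iexp (t \<bullet> \<xi>))"

text \<open>The effect of a partial derivative of a wave on its amplitude. It does not involve the position \<open>x\<close>.\<close>
definition wave_deriv :: "real \<Rightarrow> real ^ 'n::finite \<Rightarrow> 'n \<Rightarrow> (real ^ 'n \<Rightarrow> complex) \<Rightarrow> real ^ 'n \<Rightarrow> complex" where
  "wave_deriv l \<xi> i g = (\<lambda>y. of_real l * partial_deriv i g y + \<i> * of_real (\<xi> $ i) * g y)"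

lemma wave_has_derivative:
  assumes "g differentiable (at (l *\<^sub>R (t - x)))"
  shows "(wave l x \<xi> g has_derivative (\<lambda>h. g (l *\<^sub>R (t - x)) * (\<i> * complex_of_real (h \<bullet> \<xi>) * iexp (t \<bullet> \<xi>))
     + frechet_derivative g (at (l *\<^sub>R (t - x))) (l *\<^sub>R h) * iexp (t \<bullet> \<xi>))) (at t)"
proof -
  have "((\<lambda>t. l *\<^sub>R (t - x)) has_derivative (\<lambda>h. l *\<^sub>R h)) (at t)" by (auto intro!: derivative_eq_intros)
  from has_derivative_compose[OF this differentiable_has_frechet[OF assms]]
  have 1: "((\<lambda>t. g (l *\<^sub>R (t - x))) has_derivative (\<lambda>h. frechet_derivative g (at (l *\<^sub>R (t - x))) (l *\<^sub>R h))) (at t)" .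
  have "((\<lambda>t. \<i> * complex_of_real (t \<bullet> \<xi>)) has_derivative (\<lambda>h. \<i> * complex_of_real (h \<bullet> \<xi>))) (at t)"
    by (auto intro!: derivative_eq_intros)
  moreover have "(exp has_derivative (\<lambda>z. iexp (t \<bullet> \<xi>) * z)) (at (\<i> * complex_of_real (t \<bullet> \<xi>)))"
    using DERIV_exp[of "\<i> * complex_of_real (t \<bullet> \<xi>)"] unfolding has_field_derivative_def .
  ultimately have "((\<lambda>t. iexp (t \<bullet> \<xi>)) has_derivative (\<lambda>h. iexp (t \<bullet> \<xi>) * (\<i> * complex_of_real (h \<bullet> \<xi>)))) (at t)"
    by (rule has_derivative_compose)
  then have 2: "((\<lambda>t. iexp (t \<bullet> \<xi>)) has_derivative (\<lambda>h. \<i> * complex_of_real (h \<bullet> \<xi>) * iexp (t \<bullet> \<xi>))) (at t)"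
    by (simp only: mult.commute)
  show ?thesis unfolding wave_def by (rule has_derivative_mult[OF 1 2])
qed

lemma partial_deriv_wave:
  assumes "\<And>y. g differentiable (at y)"
  shows "partial_deriv i (wave l x \<xi> g) = wave l x \<xi> (wave_deriv l \<xi> i g)"
proof
  fix t
  have "frechet_derivative g (at y) (l *\<^sub>R axis i 1) = l *\<^sub>R partial_deriv i g y" for y
    unfolding partial_deriv_def using linear_frechet_derivative[OF assms] by (simp add: linear_cmul)
  then show "partial_deriv i (wave l x \<xi> g) t = wave l x \<xi> (wave_deriv l \<xi> i g) t"
    by (subst partial_derivI[OF wave_has_derivative[OF assms]])
      (simp add: wave_def wave_deriv_def inner_axis' scaleR_conv_of_real[where 'a=complex] algebra_simps)
qed

lemma wave_deriv_schwartz: "g \<in> schwartz \<Longrightarrow> wave_deriv l \<xi> i g \<in> schwartz"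
  unfolding wave_deriv_def by (intro schwartz_lincomb schwartz_partial_deriv)

lemma foldr_wave_deriv_schwartz: "g \<in> schwartz \<Longrightarrow> foldr (wave_deriv l \<xi>) is g \<in> schwartz"
  by (induction "is") (auto intro: wave_deriv_schwartz)

lemma partial_derivs_wave:
  assumes "g \<in> schwartz"
  shows "partial_derivs is (wave l x \<xi> g) = wave l x \<xi> (foldr (wave_deriv l \<xi>) is g)"
proof (induction "is")
  case (Cons i "is")
  show ?case
    unfolding partial_derivs_Cons Cons foldr.simps o_apply
    by (intro partial_deriv_wave smooth_differentiable schwartz_smooth foldr_wave_deriv_schwartz assms)
qed (simp add: partial_derivs_Nil)

text \<open>Differentiation changes the amplitude in a way that is independent of \<open>x\<close>, so moving the wave costs no more than the
  weight factor in \<open>1 + |t| \<le> (1 + |x|) (1 + |t - x|)\<close>. The growth in \<open>x\<close> is polynomial and will be compensated by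
  rapidly decaying coefficients.\<close>
lemma wave_schwartz_bound:
  assumes g: "g \<in> schwartz" and l: "0 < l"
  shows "\<exists>C\<ge>0. \<forall>x t. (1 + norm t) ^ N * cmod (partial_derivs is (wave l x \<xi> g) t) \<le> C * (1 + norm x) ^ N"
proof -
  define h where "h = foldr (wave_deriv l \<xi>) is g"
  have h: "h \<in> schwartz" unfolding h_def by (rule foldr_wave_deriv_schwartz[OF g])
  define \<kappa> where "\<kappa> = max 1 (1 / l)"
  define S where "S = schwartz_seminorm N [] h"
  have S: "0 \<le> S" unfolding S_def by (rule schwartz_seminorm_nonneg[OF h])
  have \<kappa>: "1 \<le> \<kappa>" "1 \<le> \<kappa> * l" using l by (auto simp: \<kappa>_def max_def field_simps)
  have "(1 + norm t) ^ N * cmod (wave l x \<xi> h t) \<le> \<kappa> ^ N * S * (1 + norm x) ^ N" for x t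
  proof -
    let ?y = "l *\<^sub>R (t - x)"
    have n: "norm ?y = l * norm (t - x)" using l by simp
    have "norm t \<le> norm x + norm (t - x)" using norm_triangle_ineq[of x "t - x"] by simp
    moreover have "(1 + norm x) * (1 + norm (t - x)) = 1 + norm x + norm (t - x) + norm x * norm (t - x)"
      by (simp add: algebra_simps)
    moreover have "0 \<le> norm x * norm (t - x)" by simp
    ultimately have "1 + norm t \<le> (1 + norm x) * (1 + norm (t - x))" by linarith
    also have "\<dots> \<le> (1 + norm x) * (\<kappa> * (1 + norm ?y))"
    proof (rule mult_left_mono)
      have "norm (t - x) \<le> \<kappa> * l * norm (t - x)" using mult_right_mono[OF \<kappa>(2), of "norm (t - x)"] by simp
      then show "1 + norm (t - x) \<le> \<kappa> * (1 + norm ?y)"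
        using \<kappa>(1) unfolding n distrib_left by (simp add: mult.assoc)
    qed simp
    finally have "1 + norm t \<le> (1 + norm x) * (\<kappa> * (1 + norm ?y))" .
    then have "(1 + norm t) ^ N \<le> ((1 + norm x) * (\<kappa> * (1 + norm ?y))) ^ N" by (intro power_mono) auto
    then have "(1 + norm t) ^ N * cmod (wave l x \<xi> h t) \<le> ((1 + norm x) * (\<kappa> * (1 + norm ?y))) ^ N * cmod (h ?y)"
      by (auto simp: wave_def norm_mult intro: mult_right_mono)
    also have "\<dots> = \<kappa> ^ N * (1 + norm x) ^ N * ((1 + norm ?y) ^ N * cmod (h ?y))"
      by (simp only: power_mult_distrib mult_ac)
    also have "\<dots> \<le> \<kappa> ^ N * (1 + norm x) ^ N * S"
      using schwartz_bound[OF h, of ?y N "[]"] \<kappa> by (intro mult_left_mono) (auto simp: S_def partial_derivs_Nil)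
    finally show ?thesis by (simp add: mult_ac)
  qed
  then show ?thesis using S \<kappa> unfolding partial_derivs_wave[OF g] h_def by (intro exI[of _ "\<kappa> ^ N * S"]) auto
qed

lemma wave_schwartz:
  assumes "g \<in> schwartz" "0 < l"
  shows "wave l x \<xi> g \<in> schwartz"
proof -
  obtain C where C: "\<And>N is t. (1 + norm t) ^ N * cmod (partial_derivs is (wave l x \<xi> g) t) \<le> C N is * (1 + norm x) ^ N"
    using wave_schwartz_bound[OF assms, of _ _ \<xi>] by metis
  show ?thesis
  proof (rule schwartzI[OF _ C])
    show "smooth (wave l x \<xi> g)"
      unfolding smooth_def partial_derivs_wave[OF assms(1)] differentiable_def
      using wave_has_derivative[OF smooth_differentiable[OF schwartz_smooth[OF foldr_wave_deriv_schwartz[OF assms(1)]]]] by blast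
  qed
qed

lemma frechet_derivative_cart:
  fixes F :: "real ^ 'n::finite \<Rightarrow> complex"
  assumes "F differentiable (at t)"
  shows "(F has_derivative (\<lambda>h. \<Sum>i\<in>UNIV. h $ i *\<^sub>R partial_deriv i F t)) (at t)"
proof -
  have lin: "linear (frechet_derivative F (at t))" by (rule linear_frechet_derivative[OF assms])
  have "frechet_derivative F (at t) h = (\<Sum>i\<in>UNIV. h $ i *\<^sub>R partial_deriv i F t)" for h
  proof -
    have "frechet_derivative F (at t) h = frechet_derivative F (at t) (\<Sum>i\<in>UNIV. h $ i *\<^sub>R axis i 1)"
      by (simp add: basis_expansion flip: scalar_mult_eq_scaleR)
    also have "\<dots> = (\<Sum>i\<in>UNIV. h $ i *\<^sub>R partial_deriv i F t)"
      by (simp add: linear_sum[OF lin] linear_cmul[OF lin] partial_deriv_def)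
    finally show ?thesis .
  qed
  then show ?thesis using differentiable_has_frechet[OF assms] by presburger
qed

text \<open>The Weierstrass M-test for each of the finitely many partial derivatives gives uniform convergence of the
  derivative as a linear map.\<close>
lemma has_derivative_suminf_cart:
  fixes U :: "nat \<Rightarrow> real ^ 'n::finite \<Rightarrow> complex"
  assumes diff: "\<And>n t. U n differentiable (at t)" and sU: "\<And>t. summable (\<lambda>n. U n t)"
    and M: "\<And>n i t. cmod (partial_deriv i (U n) t) \<le> M i n" and sM: "\<And>i. summable (M i)"
  shows "((\<lambda>t. \<Sum>n. U n t) has_derivative (\<lambda>h. \<Sum>i\<in>UNIV. h $ i *\<^sub>R (\<Sum>n. partial_deriv i (U n) t))) (at t)"
proof -
  let ?f' = "\<lambda>n t h. \<Sum>i\<in>UNIV. h $ i *\<^sub>R partial_deriv i (U n) t"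
  let ?g' = "\<lambda>t h. \<Sum>i\<in>UNIV. h $ i *\<^sub>R (\<Sum>n. partial_deriv i (U n) t)"
  have "\<exists>g. \<forall>x\<in>UNIV. (\<lambda>n. U n x) sums (g x) \<and> (g has_derivative ?g' x) (at x within UNIV)"
  proof (rule has_derivative_series[where f'="?f'" and x=t and l="\<Sum>n. U n t"])
    show "(U n has_derivative ?f' n x) (at x within UNIV)" for n x using frechet_derivative_cart[OF diff] by simp
    show "(\<lambda>n. U n t) sums (\<Sum>n. U n t)" using sU by (rule summable_sums)
    show "\<forall>\<^sub>F n in sequentially. \<forall>x\<in>UNIV. \<forall>h. norm ((\<Sum>k<n. ?f' k x h) - ?g' x h) \<le> e * norm h" if e: "e > 0" for e
    proof -
      define \<delta> where "\<delta> = e / real CARD('n)"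
      have \<delta>: "\<delta> > 0" using e by (simp add: \<delta>_def)
      have "\<forall>\<^sub>F n in sequentially. \<forall>x\<in>UNIV. dist (\<Sum>k<n. partial_deriv i (U k) x) (\<Sum>k. partial_deriv i (U k) x) < \<delta>" for i
        using Weierstrass_m_test[of UNIV "\<lambda>n x. partial_deriv i (U n) x" "M i", OF M sM] \<delta> unfolding uniform_limit_iff by blast
      then have "\<forall>\<^sub>F n in sequentially. \<forall>i\<in>UNIV. \<forall>x\<in>UNIV. dist (\<Sum>k<n. partial_deriv i (U k) x) (\<Sum>k. partial_deriv i (U k) x) < \<delta>"
        by (intro eventually_ball_finite) auto
      then show ?thesis
      proof eventually_elim
        case (elim n)
        show ?case
        proof (intro ballI allI)
          fix x h :: "real ^ 'n"
          let ?d = "\<lambda>i. (\<Sum>k<n. partial_deriv i (U k) x) - (\<Sum>k. partial_deriv i (U k) x)"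
          have "(\<Sum>k<n. ?f' k x h) - ?g' x h = (\<Sum>i\<in>UNIV. h $ i *\<^sub>R ?d i)"
            by (subst sum.swap) (simp add: sum_subtractf scaleR_diff_right flip: scaleR_sum_right)
          also have "norm \<dots> \<le> (\<Sum>i\<in>(UNIV::'n set). norm h * \<delta>)"
          proof (rule sum_norm_le)
            fix i
            have "norm (?d i) \<le> \<delta>" using elim by (auto simp: dist_norm less_imp_le)
            then show "norm (h $ i *\<^sub>R ?d i) \<le> norm h * \<delta>"
              using component_le_norm_cart[of h i] by (auto intro!: mult_mono)
          qed
          also have "\<dots> = e * norm h" by (simp add: \<delta>_def)
          finally show "norm ((\<Sum>k<n. ?f' k x h) - ?g' x h) \<le> e * norm h" .
        qed
      qed
    qed
  qed auto
  then obtain g where g: "\<And>x. (\<lambda>n. U n x) sums (g x)" "\<And>x. (g has_derivative ?g' x) (at x)" by auto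
  have "g = (\<lambda>t. \<Sum>n. U n t)" using g(1) sums_unique by blast
  then show ?thesis using g(2) by simp
qed

context
  fixes u :: "nat \<Rightarrow> real ^ 'n::finite \<Rightarrow> complex"
  assumes u: "\<And>n. u n \<in> schwartz" and su: "\<And>N is. summable (\<lambda>n. schwartz_seminorm N is (u n))"
begin

lemma series_term_bound: "(1 + norm t) ^ N * cmod (partial_derivs is (u n) t) \<le> schwartz_seminorm N is (u n)"
  by (rule schwartz_bound[OF u])

lemma series_term_bound0: "cmod (partial_derivs is (u n) t) \<le> schwartz_seminorm 0 is (u n)"
  using series_term_bound[of t 0] by simp

lemma series_summable: "summable (\<lambda>n. partial_derivs is (u n) t)"
  by (rule summable_comparison_test[OF _ su[of 0 "is"]]) (use series_term_bound0 in blast)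

lemma series_derivative:
  "((\<lambda>t. \<Sum>n. partial_derivs is (u n) t) has_derivative (\<lambda>h. \<Sum>i\<in>UNIV. h $ i *\<^sub>R (\<Sum>n. partial_derivs (i # is) (u n) t))) (at t)"
  unfolding partial_derivs_Cons
  by (rule has_derivative_suminf_cart[where M="\<lambda>i n. schwartz_seminorm 0 (i # is) (u n)"])
    (use series_term_bound0[of "_ # is"] su in \<open>auto simp: partial_derivs_Cons intro: smooth_partial_derivs schwartz_smooth u series_summable\<close>)

lemma partial_derivs_series: "partial_derivs is (\<lambda>t. \<Sum>n. u n t) = (\<lambda>t. \<Sum>n. partial_derivs is (u n) t)"
proof (induction "is")
  case (Cons i "is")
  show ?case
    unfolding partial_derivs_Cons[of i "is" "\<lambda>t. \<Sum>n. u n t"] Cons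
    by (rule ext, subst partial_derivI[OF series_derivative])
      (simp add: axis_def if_distrib[of "\<lambda>c. c *\<^sub>R _"] cong: if_cong)
qed (simp add: partial_derivs_Nil)

lemma series_weighted_bound:
  "(1 + norm t) ^ N * cmod (partial_derivs is (\<lambda>t. \<Sum>n. u n t) t) \<le> (\<Sum>n. schwartz_seminorm N is (u n))"
proof -
  have s: "summable (\<lambda>n. cmod (partial_derivs is (u n) t))"
    by (rule summable_comparison_test[OF _ su[of 0 "is"]]) (use series_term_bound0 in auto)
  have "cmod (\<Sum>n. partial_derivs is (u n) t) \<le> (\<Sum>n. cmod (partial_derivs is (u n) t))" by (rule summable_norm[OF s])
  then have "(1 + norm t) ^ N * cmod (\<Sum>n. partial_derivs is (u n) t) \<le> (1 + norm t) ^ N * (\<Sum>n. cmod (partial_derivs is (u n) t))"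
    by (intro mult_left_mono) auto
  also have "\<dots> = (\<Sum>n. (1 + norm t) ^ N * cmod (partial_derivs is (u n) t))" by (rule suminf_mult[OF s, symmetric])
  also have "\<dots> \<le> (\<Sum>n. schwartz_seminorm N is (u n))"
    by (intro suminf_le series_term_bound summable_mult s su)
  finally show ?thesis by (simp add: partial_derivs_series)
qed

lemma schwartz_series: "(\<lambda>t. \<Sum>n. u n t) \<in> schwartz"
proof (rule schwartzI[OF _ series_weighted_bound])
  show "smooth (\<lambda>t. \<Sum>n. u n t)"
    unfolding smooth_def partial_derivs_series differentiable_def using series_derivative by blast
qed

lemma schwartz_seminorm_series: "schwartz_seminorm N is (\<lambda>t. \<Sum>n. u n t) \<le> (\<Sum>n. schwartz_seminorm N is (u n))"
  by (rule schwartz_seminorm_le[OF series_weighted_bound])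

end

text \<open>A tail of the series is a series of the same kind, and each of its seminorms is at most the tail of the sum of the
  seminorms. Continuity of \<open>f\<close> therefore makes the value at the tail tend to 0.\<close>
lemma tempered_sums:
  fixes u :: "nat \<Rightarrow> real ^ 'n::finite \<Rightarrow> complex"
  assumes f: "tempered_distribution f"
    and u: "\<And>n. u n \<in> schwartz" and su: "\<And>N is. summable (\<lambda>n. schwartz_seminorm N is (u n))"
  shows "(\<lambda>n. f (u n)) sums f (\<lambda>t. \<Sum>n. u n t)"
proof -
  define tl where "tl m = (\<lambda>t. \<Sum>n. u (n + m) t)" for m
  have su': "summable (\<lambda>n. schwartz_seminorm N is (u (n + m)))" for N "is" m
    by (rule summable_ignore_initial_segment[OF su])
  have tl: "tl m \<in> schwartz" for m unfolding tl_def by (rule schwartz_series[OF u su'])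
  have pt: "summable (\<lambda>n. u n t)" for t using series_summable[OF u su, of "[]" t] by (simp add: partial_derivs_Nil)
  obtain C N k where C: "\<And>g. g \<in> schwartz \<Longrightarrow> cmod (f g) \<le> C * (\<Sum>is | length is \<le> k. schwartz_seminorm N is g)"
    using tempered_bound[OF f] by metis
  \<comment> \<open>\<open>tl m\<close> is the tail of the series from the index \<open>m\<close> on.\<close>
  have split: "f (\<lambda>t. \<Sum>n. u n t) = (\<Sum>n<m. f (u n)) + f (tl m)" for m
  proof -
    have "(\<lambda>t. \<Sum>n. u n t) = (\<lambda>t. (\<lambda>t. \<Sum>n<m. u n t) t + tl m t)"
      unfolding tl_def using suminf_split_initial_segment[OF pt, of _ m] by (simp add: add.commute)
    then have "f (\<lambda>t. \<Sum>n. u n t) = f (\<lambda>t. \<Sum>n<m. u n t) + f (tl m)"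
      by (simp only:) (intro tempered_add[OF f] schwartz_sum tl u finite_lessThan)
    then show ?thesis using tempered_sum[OF f, of "{..<m}" u] u by simp
  qed
  have fin: "finite {is :: 'n list. length is \<le> k}" using finite_lists_length_le[of "UNIV :: 'n set" k] by simp
  have "(\<lambda>m. \<Sum>n. schwartz_seminorm N is (u (n + m))) \<longlonglongrightarrow> 0" for "is"
  proof -
    have "(\<lambda>m. (\<Sum>n. schwartz_seminorm N is (u n)) - (\<Sum>n<m. schwartz_seminorm N is (u n))) \<longlonglongrightarrow> (\<Sum>n. schwartz_seminorm N is (u n)) - (\<Sum>n. schwartz_seminorm N is (u n))"
      by (intro tendsto_intros summable_LIMSEQ su)
    then show ?thesis by (simp add: suminf_minus_initial_segment[OF su])
  qed
  then have lim: "(\<lambda>m. \<bar>C\<bar> * (\<Sum>is | length is \<le> k. \<Sum>n. schwartz_seminorm N is (u (n + m)))) \<longlonglongrightarrow> \<bar>C\<bar> * (\<Sum>is::'n list | length is \<le> k. 0)"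
    by (intro tendsto_intros) 
  have "cmod (f (tl m)) \<le> \<bar>C\<bar> * (\<Sum>is | length is \<le> k. \<Sum>n. schwartz_seminorm N is (u (n + m)))" for m
  proof -
    have "cmod (f (tl m)) \<le> C * (\<Sum>is | length is \<le> k. schwartz_seminorm N is (tl m))" by (rule C[OF tl])
    also have "\<dots> \<le> \<bar>C\<bar> * (\<Sum>is | length is \<le> k. schwartz_seminorm N is (tl m))"
      by (intro mult_right_mono sum_nonneg schwartz_seminorm_nonneg tl) auto
    also have "\<dots> \<le> \<bar>C\<bar> * (\<Sum>is | length is \<le> k. \<Sum>n. schwartz_seminorm N is (u (n + m)))"
      unfolding tl_def by (intro mult_left_mono sum_mono schwartz_seminorm_series u su') auto
    finally show ?thesis .
  qed
  then have "(\<lambda>m. f (tl m)) \<longlonglongrightarrow> 0"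
    using lim by (intro Lim_null_comparison[OF always_eventually, of "\<lambda>m. f (tl m)"]) auto
  then have "(\<lambda>m. f (\<lambda>t. \<Sum>n. u n t) - f (tl m)) \<longlonglongrightarrow> f (\<lambda>t. \<Sum>n. u n t) - 0" by (intro tendsto_intros)
  moreover have "f (\<lambda>t. \<Sum>n. u n t) - f (tl m) = (\<Sum>n<m. f (u n))" for m using split[of m] by simp
  ultimately show ?thesis by (simp add: sums_def)
qed

section \<open>The Schur test in mixed sequence norms\<close>

lemma ennreal_summable: "(f :: 'i \<Rightarrow> ennreal) summable_on A"
  by (rule nonneg_summable_on_complete) simp

lemma ennreal_sum_le_infsum:
  fixes f :: "'i \<Rightarrow> ennreal"
  assumes "finite F" shows "sum f F \<le> infsum f UNIV"
proof -
  have "infsum f F \<le> infsum f UNIV"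
    by (rule infsum_mono_neutral[OF ennreal_summable ennreal_summable]) auto
  then show ?thesis using assms by simp
qed

lemma ennreal_infsum_le:
  fixes f :: "'i \<Rightarrow> ennreal"
  assumes "\<And>F. finite F \<Longrightarrow> sum f F \<le> B" shows "infsum f UNIV \<le> B"
  by (rule infsum_le_finite_sums[OF ennreal_summable]) (use assms in auto)

lemma ennreal_infsum_mono:
  fixes f g :: "'i \<Rightarrow> ennreal"
  assumes "\<And>i. f i \<le> g i" shows "infsum f UNIV \<le> infsum g UNIV"
  by (rule infsum_mono[OF ennreal_summable ennreal_summable assms])

lemma ennreal_infsum_SUP: "infsum (f :: 'i \<Rightarrow> ennreal) UNIV = (SUP F\<in>Collect finite. sum f F)"
  by (rule antisym) (auto intro!: ennreal_infsum_le SUP_least ennreal_sum_le_infsum SUP_upper)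

lemma ennreal_infsum_cmult:
  fixes f :: "'i \<Rightarrow> ennreal"
  shows "infsum (\<lambda>i. c * f i) UNIV = c * infsum f UNIV"
  unfolding ennreal_infsum_SUP by (simp add: SUP_mult_left_ennreal sum_distrib_left)

lemma ennreal_infsum_add:
  fixes f g :: "'i \<Rightarrow> ennreal"
  shows "infsum (\<lambda>i. f i + g i) UNIV = infsum f UNIV + infsum g UNIV"
  by (rule infsum_add[OF ennreal_summable ennreal_summable])

lemma ennreal_infsum_sum:
  fixes f :: "'k \<Rightarrow> 'i \<Rightarrow> ennreal"
  assumes "finite F"
  shows "infsum (\<lambda>i. \<Sum>k\<in>F. f k i) UNIV = (\<Sum>k\<in>F. infsum (f k) UNIV)"
  using assms by (induction F rule: finite_induct) (auto simp: ennreal_infsum_add)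

text \<open>One inequality of Tonelli's theorem: it suffices to bound finite partial sums, and these commute with infinite sums.\<close>
lemma ennreal_infsum_swap_le:
  fixes g :: "'b \<Rightarrow> 'a \<Rightarrow> ennreal"
  shows "infsum (\<lambda>b. infsum (g b) UNIV) UNIV \<le> infsum (\<lambda>a. infsum (\<lambda>b. g b a) UNIV) UNIV"
proof (rule ennreal_infsum_le)
  fix F :: "'b set" assume F: "finite F"
  have "(\<Sum>b\<in>F. infsum (g b) UNIV) = infsum (\<lambda>a. \<Sum>b\<in>F. g b a) UNIV" by (rule ennreal_infsum_sum[OF F, symmetric])
  also have "\<dots> \<le> infsum (\<lambda>a. infsum (\<lambda>b. g b a) UNIV) UNIV"
    by (intro ennreal_infsum_mono ennreal_sum_le_infsum F)
  finally show "(\<Sum>b\<in>F. infsum (g b) UNIV) \<le> infsum (\<lambda>a. infsum (\<lambda>b. g b a) UNIV) UNIV" .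
qed

lemma ennpow_top: "ennpow \<infinity> r = \<infinity>" by (simp add: ennpow_def)

lemma ennpow_ennreal: "0 \<le> x \<Longrightarrow> ennpow (ennreal x) r = ennreal (x powr r)"
  by (simp add: ennpow_def)

lemma ennpow_mono: "x \<le> y \<Longrightarrow> 0 < r \<Longrightarrow> ennpow x r \<le> ennpow y r"
  by (cases x rule: ennreal_cases; cases y rule: ennreal_cases)
    (auto simp: ennpow_ennreal ennpow_def top_unique intro!: ennreal_leI powr_mono2)

lemma ennpow_cmult:
  assumes "0 < c" "0 < r"
  shows "ennpow (ennreal c * y) r = ennreal (c powr r) * ennpow y r"
proof (cases y rule: ennreal_cases)
  case (real x)
  then show ?thesis using assms by (simp add: ennreal_mult[symmetric] ennpow_ennreal powr_mult)
next
  case top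
  have "ennreal c * y = \<infinity>" using top assms by (simp add: ennreal_mult_top)
  moreover have "ennreal (c powr r) * \<infinity> = \<infinity>" using assms by (simp add: ennreal_mult_top)
  ultimately show ?thesis using top ennpow_top[of r] by simp
qed

text \<open>The convex function \<open>u \<mapsto> u powr r\<close> lies above its tangent at \<open>y\<close>.\<close>
lemma young_tangent:
  fixes u y r :: real
  assumes "0 \<le> u" "0 < y" "1 \<le> r"
  shows "r * y powr (r - 1) * u \<le> u powr r + (r - 1) * y powr r"
proof (cases "r = 1")
  case False
  then have r: "1 < r" using assms by simp
  have "u * y powr (r - 1) \<le> u powr r / r + (y powr (r - 1)) powr (r / (r - 1)) / (r / (r - 1))"
    using assms r by (intro Youngs_inequality) (auto simp: field_simps)
  also have "(y powr (r - 1)) powr (r / (r - 1)) = y powr r" using r by (simp add: powr_powr)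
  finally have "r * (u * y powr (r - 1)) \<le> r * (u powr r / r + y powr r / (r / (r - 1)))"
    using r by (intro mult_left_mono) auto
  also have "\<dots> = u powr r + (r - 1) * y powr r" using r by (simp add: field_simps)
  finally show ?thesis by (simp add: mult_ac)
qed (use assms in simp)

text \<open>Jensen's inequality for weights of total mass at most \<open>C\<close>: sum the tangent inequality at \<open>y\<close> against \<open>K\<close> and take
  \<open>y = A/C\<close>, where \<open>A\<close> is the weighted sum of \<open>u\<close>. If \<open>A\<close> is infinite, \<open>y = 1\<close> shows that the right-hand side is
  infinite too.\<close>
lemma ennreal_weighted_power_mean:
  fixes K u :: "'a \<Rightarrow> ennreal"
  assumes KC: "infsum K UNIV \<le> ennreal C" and C: "0 < C" and r: "1 \<le> r"
  shows "ennpow (infsum (\<lambda>a. K a * u a) UNIV) r \<le> ennreal (C powr (r - 1)) * infsum (\<lambda>a. K a * ennpow (u a) r) UNIV"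
    (is "ennpow ?A r \<le> _ * ?X")
proof -
  have young: "ennreal (r * y powr (r - 1)) * ?A \<le> ?X + ennreal ((r - 1) * y powr r * C)" if y: "0 < y" for y
  proof -
    have pt: "ennreal (r * y powr (r - 1)) * w \<le> ennpow w r + ennreal ((r - 1) * y powr r)" for w
    proof (cases w rule: ennreal_cases)
      case (real v)
      then show ?thesis using young_tangent[OF real(1) y r] r
        by (simp add: ennpow_ennreal ennreal_mult[symmetric] ennreal_plus[symmetric] del: ennreal_plus)
    qed (simp add: ennpow_def)
    have "ennreal (r * y powr (r - 1)) * ?A = infsum (\<lambda>a. K a * (ennreal (r * y powr (r - 1)) * u a)) UNIV"
      by (simp add: ennreal_infsum_cmult[symmetric] mult_ac)
    also have "\<dots> \<le> infsum (\<lambda>a. K a * ennpow (u a) r + ennreal ((r - 1) * y powr r) * K a) UNIV"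
      by (rule ennreal_infsum_mono) (use mult_left_mono[OF pt] in \<open>auto simp: distrib_left mult_ac\<close>)
    also have "\<dots> = ?X + ennreal ((r - 1) * y powr r) * infsum K UNIV"
      by (simp add: ennreal_infsum_add ennreal_infsum_cmult)
    also have "\<dots> \<le> ?X + ennreal ((r - 1) * y powr r) * ennreal C"
      by (intro add_left_mono mult_left_mono KC) auto
    finally show ?thesis using r C by (simp add: ennreal_mult)
  qed
  show ?thesis
  proof (cases "?X = \<infinity>")
    case True
    then show ?thesis using C by (simp add: ennreal_mult_top)
  next
    case False
    then obtain X where X: "?X = ennreal X" "0 \<le> X" by (metis ennreal_cases infinity_ennreal_def)
    show ?thesis
    proof (cases "?A = \<infinity>")
      case True
      have "ennreal r * \<infinity> \<le> ?X + ennreal ((r - 1) * C)" using young[of 1] True by simp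
      then have False using False r by (simp add: ennreal_mult_top top_unique)
      then show ?thesis ..
    next
      case fin: False
      then obtain a where a: "?A = ennreal a" "0 \<le> a" by (metis ennreal_cases infinity_ennreal_def)
      show ?thesis
      proof (cases "a = 0")
        case True
        then show ?thesis using a by (simp add: ennpow_def)
      next
        case nz: False
        then have a0: "0 < a" using a by simp
        define y where "y = a / C"
        have y: "0 < y" using a0 C by (simp add: y_def)
        have "ennreal (r * y powr (r - 1) * a) \<le> ennreal (X + (r - 1) * y powr r * C)"
          using young[OF y] X a r C by (simp add: ennreal_mult)
        then have le: "r * y powr (r - 1) * a \<le> X + (r - 1) * y powr r * C"
          using X r C by (subst (asm) ennreal_le_iff) auto
        have ay: "a = y * C" using C by (simp add: y_def)
        have yr: "y powr r = y powr (r - 1) * y" using y powr_add[of y "r - 1" 1] by simp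
        have "y powr r * C \<le> X" using le unfolding ay yr by (simp add: algebra_simps)
        moreover have "a powr r = C powr (r - 1) * (y powr r * C)"
        proof -
          have "C powr r = C powr (r - 1) * C" using C powr_add[of C "r - 1" 1] by simp
          then show ?thesis unfolding ay using y C by (simp add: powr_mult)
        qed
        ultimately have "a powr r \<le> C powr (r - 1) * X" by (simp add: mult_left_mono)
        then show ?thesis using X a by (simp add: ennpow_ennreal ennreal_mult[symmetric])
      qed
    qed
  qed
qed

lemma enn2real_ge_1: "1 \<le> (p::ennreal) \<Longrightarrow> p \<noteq> \<infinity> \<Longrightarrow> 1 \<le> enn2real p"
  by (cases p rule: ennreal_cases) auto

text \<open>Schur's test. For a finite exponent \<open>r\<close>, Jensen's inequality contributes \<open>C powr (r - 1)\<close> from the rows and the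
  columns contribute one more factor \<open>C\<close>; the root of order \<open>r\<close> of the product is \<open>C\<close>, whatever \<open>r\<close> is.\<close>
lemma lp_norm_schur:
  fixes K :: "'b \<Rightarrow> 'a \<Rightarrow> ennreal"
  assumes rows: "\<And>b. infsum (K b) UNIV \<le> ennreal C" and cols: "\<And>a. infsum (\<lambda>b. K b a) UNIV \<le> ennreal C"
    and C: "0 < C" and p: "1 \<le> p"
  shows "lp_norm p (\<lambda>b. infsum (\<lambda>a. K b a * u a) UNIV) \<le> ennreal C * lp_norm p u"
proof (cases "p = \<infinity>")
  case True
  have "infsum (\<lambda>a. K b a * u a) UNIV \<le> ennreal C * (SUP a. u a)" for b
  proof -
    have "infsum (\<lambda>a. K b a * u a) UNIV \<le> infsum (\<lambda>a. (SUP a. u a) * K b a) UNIV"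
      by (rule ennreal_infsum_mono) (metis SUP_upper UNIV_I mult.commute mult_left_mono zero_le)
    also have "\<dots> = (SUP a. u a) * infsum (K b) UNIV" by (rule ennreal_infsum_cmult)
    also have "\<dots> \<le> (SUP a. u a) * ennreal C" by (intro mult_left_mono rows) auto
    finally show ?thesis by (simp add: mult.commute)
  qed
  then show ?thesis using True by (auto simp: lp_norm_def intro: SUP_least)
next
  case False
  define r where "r = enn2real p"
  have r: "1 \<le> r" unfolding r_def by (rule enn2real_ge_1[OF p False])
  have "infsum (\<lambda>b. ennpow (infsum (\<lambda>a. K b a * u a) UNIV) r) UNIV
     \<le> infsum (\<lambda>b. ennreal (C powr (r - 1)) * infsum (\<lambda>a. K b a * ennpow (u a) r) UNIV) UNIV"
    by (intro ennreal_infsum_mono ennreal_weighted_power_mean rows C r)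
  also have "\<dots> = ennreal (C powr (r - 1)) * infsum (\<lambda>b. infsum (\<lambda>a. K b a * ennpow (u a) r) UNIV) UNIV"
    by (rule ennreal_infsum_cmult)
  also have "\<dots> \<le> ennreal (C powr (r - 1)) * infsum (\<lambda>a. infsum (\<lambda>b. K b a * ennpow (u a) r) UNIV) UNIV"
    by (intro mult_left_mono ennreal_infsum_swap_le) auto
  also have "\<dots> \<le> ennreal (C powr (r - 1)) * infsum (\<lambda>a. ennreal C * ennpow (u a) r) UNIV"
  proof (intro mult_left_mono ennreal_infsum_mono)
    fix a
    have "infsum (\<lambda>b. K b a * ennpow (u a) r) UNIV = ennpow (u a) r * infsum (\<lambda>b. K b a) UNIV"
      by (subst ennreal_infsum_cmult[symmetric]) (simp add: mult.commute)
    also have "\<dots> \<le> ennpow (u a) r * ennreal C" by (intro mult_left_mono cols) auto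
    finally show "infsum (\<lambda>b. K b a * ennpow (u a) r) UNIV \<le> ennreal C * ennpow (u a) r" by (simp add: mult.commute)
  qed auto
  also have "\<dots> = ennreal (C powr r) * infsum (\<lambda>a. ennpow (u a) r) UNIV"
  proof -
    have "C powr r = C powr (r - 1) * C" using C powr_add[of C "r - 1" 1] by simp
    then show ?thesis using C by (simp add: ennreal_infsum_cmult ennreal_mult mult.assoc)
  qed
  finally have "ennpow (infsum (\<lambda>b. ennpow (infsum (\<lambda>a. K b a * u a) UNIV) r) UNIV) (1 / r)
     \<le> ennpow (ennreal (C powr r) * infsum (\<lambda>a. ennpow (u a) r) UNIV) (1 / r)"
    using r by (intro ennpow_mono) auto
  also have "\<dots> = ennreal C * ennpow (infsum (\<lambda>a. ennpow (u a) r) UNIV) (1 / r)"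
    using r C by (subst ennpow_cmult) (auto simp: powr_powr)
  finally show ?thesis using False by (simp add: lp_norm_def r_def)
qed

lemma lp_norm_mono:
  assumes "\<And>i. u i \<le> v i" "1 \<le> p" shows "lp_norm p u \<le> lp_norm p v"
proof (cases "p = \<infinity>")
  case True
  then show ?thesis using assms by (auto simp: lp_norm_def intro: SUP_mono)
next
  case False
  have "0 < enn2real p" using enn2real_ge_1[OF assms(2) False] by simp
  then show ?thesis using False assms by (auto simp: lp_norm_def intro!: ennpow_mono ennreal_infsum_mono)
qed

lemma sum_le_card_Max:
  fixes f :: "'k \<Rightarrow> ennreal"
  assumes "finite F" "F \<noteq> {}"
  shows "\<exists>k\<in>F. sum f F \<le> ennreal (card F) * f k"
proof -
  have "Max (f ` F) \<in> f ` F" using assms by (intro Max_in) auto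
  then obtain k where k: "k \<in> F" "f k = Max (f ` F)" by auto
  have "sum f F \<le> of_nat (card F) * f k"
    unfolding k(2) using assms by (intro sum_bounded_above) auto
  then show ?thesis using k(1) by (auto simp: ennreal_of_nat_eq_real_of_nat)
qed

text \<open>A crude form of Minkowski's inequality. The largest summand dominates the sum up to the number of terms, and here that
  number is bounded.\<close>
lemma lp_norm_sum_le:
  fixes u :: "'k \<Rightarrow> 'i \<Rightarrow> ennreal"
  assumes F: "finite F" and p: "1 \<le> p"
  shows "lp_norm p (\<lambda>i. \<Sum>k\<in>F. u k i) \<le> ennreal ((real (card F))\<^sup>2) * (\<Sum>k\<in>F. lp_norm p (u k))"
proof (cases "F = {}")
  case True
  then show ?thesis by (simp add: lp_norm_def ennpow_def)
next
  case ne: False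
  define n where "n = real (card F)"
  have n: "1 \<le> n" using F ne by (simp add: n_def Suc_le_eq card_gt_0_iff)
  show ?thesis
  proof (cases "p = \<infinity>")
    case True
    have "(\<Sum>k\<in>F. u k i) \<le> (\<Sum>k\<in>F. SUP i. u k i)" for i by (intro sum_mono SUP_upper) auto
    moreover have "1 * (\<Sum>k\<in>F. SUP i. u k i) \<le> ennreal (n\<^sup>2) * (\<Sum>k\<in>F. SUP i. u k i)"
      using n by (intro mult_right_mono) (auto simp: ennreal_1[symmetric] simp del: ennreal_1 intro!: ennreal_leI)
    ultimately show ?thesis using True unfolding lp_norm_def n_def[symmetric] by (auto intro!: SUP_least intro: order_trans)
  next
    case False
    define r where "r = enn2real p"
    have r: "1 \<le> r" unfolding r_def by (rule enn2real_ge_1[OF p False])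
    let ?X = "\<lambda>k. infsum (\<lambda>i. ennpow (u k i) r) UNIV"
    have "ennpow (\<Sum>k\<in>F. u k i) r \<le> ennreal (n powr r) * (\<Sum>k\<in>F. ennpow (u k i) r)" for i
    proof -
      obtain k where k: "k \<in> F" "(\<Sum>k\<in>F. u k i) \<le> ennreal n * u k i"
        using sum_le_card_Max[OF F ne, of "\<lambda>k. u k i"] by (auto simp: n_def)
      have "ennpow (\<Sum>k\<in>F. u k i) r \<le> ennpow (ennreal n * u k i) r" using k r by (intro ennpow_mono) auto
      also have "\<dots> = ennreal (n powr r) * ennpow (u k i) r" using n r by (intro ennpow_cmult) auto
      also have "\<dots> \<le> ennreal (n powr r) * (\<Sum>k\<in>F. ennpow (u k i) r)"
        using F k by (intro mult_left_mono member_le_sum) auto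
      finally show ?thesis .
    qed
    then have "infsum (\<lambda>i. ennpow (\<Sum>k\<in>F. u k i) r) UNIV \<le> infsum (\<lambda>i. ennreal (n powr r) * (\<Sum>k\<in>F. ennpow (u k i) r)) UNIV"
      by (rule ennreal_infsum_mono)
    also have "\<dots> = ennreal (n powr r) * (\<Sum>k\<in>F. ?X k)"
      by (simp add: ennreal_infsum_cmult ennreal_infsum_sum[OF F])
    finally have 1: "infsum (\<lambda>i. ennpow (\<Sum>k\<in>F. u k i) r) UNIV \<le> ennreal (n powr r) * (\<Sum>k\<in>F. ?X k)" .
    obtain k where k: "k \<in> F" "(\<Sum>k\<in>F. ?X k) \<le> ennreal n * ?X k"
      using sum_le_card_Max[OF F ne, of ?X] by (auto simp: n_def)
    have "ennreal (n powr r) * (\<Sum>k\<in>F. ?X k) \<le> ennreal (n powr r) * (ennreal n * ?X k)"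
      using k by (intro mult_left_mono) auto
    also have "\<dots> = ennreal (n powr r * n) * ?X k" using n by (simp add: ennreal_mult mult.assoc)
    also have "\<dots> \<le> ennreal (n powr (2 * r)) * ?X k"
    proof (intro mult_right_mono ennreal_leI)
      have "n powr r * n \<le> n powr r * n powr r"
        using n r powr_mono[of 1 r n] by (intro mult_left_mono) auto
      then show "n powr r * n \<le> n powr (2 * r)" by (simp flip: powr_add)
    qed auto
    finally have "infsum (\<lambda>i. ennpow (\<Sum>k\<in>F. u k i) r) UNIV \<le> ennreal (n powr (2 * r)) * ?X k"
      using 1 by (rule order_trans[rotated])
    then have "ennpow (infsum (\<lambda>i. ennpow (\<Sum>k\<in>F. u k i) r) UNIV) (1 / r) \<le> ennpow (ennreal (n powr (2 * r)) * ?X k) (1 / r)"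
      using r by (intro ennpow_mono) auto
    also have "\<dots> = ennreal (n\<^sup>2) * ennpow (?X k) (1 / r)"
      using r n by (subst ennpow_cmult) (auto simp: powr_powr powr_numeral)
    also have "\<dots> \<le> ennreal (n\<^sup>2) * (\<Sum>k\<in>F. ennpow (?X k) (1 / r))"
      using F k by (intro mult_left_mono member_le_sum) auto
    finally show ?thesis using False by (simp add: lp_norm_def r_def n_def)
  qed
qed

section \<open>Geometry of subdyadic centers\<close>

lemma candidate_order_norm_ge_1:
  assumes "candidate_order \<alpha> \<rho> e" shows "1 \<le> norm (e i)"
proof -
  obtain C where C: "\<And>n. candidate_set \<alpha> \<rho> n (C n)" "bij_betw e UNIV (\<Union>n. C n)"
    using assms by (auto simp: candidate_order_def)
  have "e i \<in> (\<Union>n. C n)" using C(2) by (auto simp: bij_betw_def)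
  then obtain n where "e i \<in> C n" by blast
  then have "e i \<in> annulus n" using candidate_set_subset[OF C(1)] by blast
  then have "2 ^ n \<le> norm (e i)" by (simp add: annulus_def)
  then show ?thesis using one_le_power[of "2::real" n] by linarith
qed

text \<open>The first candidate is always retained; that it lies in the first annulus makes its window cover the low frequencies.\<close>
lemma candidate_order_first:
  fixes e :: "nat \<Rightarrow> real ^ 'n::finite"
  assumes "candidate_order \<alpha> \<rho> e" shows "norm (e 0) < 2"
proof -
  obtain C where C: "\<And>n. candidate_set \<alpha> \<rho> n (C n)" "bij_betw e UNIV (\<Union>n. C n)"
    using assms by (auto simp: candidate_order_def)
  have ord: "i < j \<Longrightarrow> e i \<in> annulus m \<Longrightarrow> e j \<in> annulus n \<Longrightarrow> m \<le> n" for i j m n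
    using assms unfolding candidate_order_def by (elim conjE) simp
  have "(axis undefined 1 :: real ^ 'n) \<in> annulus 0" by (simp add: annulus_def)
  from candidate_set_near[OF C(1) this] obtain y where y: "y \<in> C 0" by blast
  then have y0: "y \<in> annulus 0" using candidate_set_subset[OF C(1)] by blast
  have "y \<in> (\<Union>n. C n)" using y by blast
  then obtain j where j: "y = e j" using C(2) by (metis bij_betw_imp_surj_on imageE)
  have "e 0 \<in> annulus 0"
  proof (cases "j = 0")
    case True then show ?thesis using j y0 by simp
  next
    case False
    have "1 \<le> norm (e 0)" by (rule candidate_order_norm_ge_1[OF assms])
    then obtain m where m: "e 0 \<in> annulus m" using annulus_ex by blast
    then have "m \<le> 0" using ord[of 0 j m 0] False j y0 by simp
    then show ?thesis using m by simp
  qed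
  then show ?thesis by (simp add: annulus_def)
qed

lemma retained_subset_range: "\<zeta> \<in> retained \<alpha> a \<rho> e i \<Longrightarrow> \<zeta> \<in> range e"
  by (induction i) (auto split: if_splits)

lemma retained_mono: "i \<le> j \<Longrightarrow> retained \<alpha> a \<rho> e i \<subseteq> retained \<alpha> a \<rho> e j"
  by (rule lift_Suc_mono_le) auto

lemma retained_disjoint:
  "\<zeta> \<in> retained \<alpha> a \<rho> e i \<Longrightarrow> \<zeta>' \<in> retained \<alpha> a \<rho> e i \<Longrightarrow> \<zeta> \<noteq> \<zeta>' \<Longrightarrow>
    separation_ball \<alpha> a \<rho> \<zeta> \<inter> separation_ball \<alpha> a \<rho> \<zeta>' = {}"
proof (induction i)
  case (Suc i)
  then show ?case by (auto split: if_splits)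
qed simp

lemma
  assumes "subdyadic_centers \<alpha> a \<rho> \<xi>"
  shows centers_norm_ge_1: "1 \<le> norm (\<xi> k)"
    and centers_separated: "k \<noteq> k' \<Longrightarrow> separation_ball \<alpha> a \<rho> (\<xi> k) \<inter> separation_ball \<alpha> a \<rho> (\<xi> k') = {}"
    and centers_first: "\<exists>k. norm (\<xi> k) < 2"
proof -
  obtain e where e: "candidate_order \<alpha> \<rho> e" and bij: "bij_betw \<xi> UNIV (\<Union>i. retained \<alpha> a \<rho> e i)"
    using assms by (auto simp: subdyadic_centers_def)
  have mem: "\<exists>i. \<xi> k \<in> retained \<alpha> a \<rho> e i" for k using bij by (auto simp: bij_betw_def)
  show "1 \<le> norm (\<xi> k)"
  proof -
    obtain i where "\<xi> k \<in> retained \<alpha> a \<rho> e i" using mem by blast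
    then have "\<xi> k \<in> range e" by (rule retained_subset_range)
    then show ?thesis using candidate_order_norm_ge_1[OF e] by auto
  qed
  show "\<exists>k. norm (\<xi> k) < 2"
  proof -
    have "e 0 \<in> retained \<alpha> a \<rho> e (Suc 0)" by simp
    then obtain k where "\<xi> k = e 0" using bij by (metis UN_I UNIV_I bij_betw_imp_surj_on imageE)
    then show ?thesis using candidate_order_first[OF e] by metis
  qed
  assume ne: "k \<noteq> k'"
  obtain i i' where i: "\<xi> k \<in> retained \<alpha> a \<rho> e i" "\<xi> k' \<in> retained \<alpha> a \<rho> e i'" using mem by metis
  have "\<xi> k \<in> retained \<alpha> a \<rho> e (max i i')" "\<xi> k' \<in> retained \<alpha> a \<rho> e (max i i')"
    using i retained_mono[of i "max i i'" \<alpha> a \<rho> e] retained_mono[of i' "max i i'" \<alpha> a \<rho> e] by auto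
  moreover have "\<xi> k \<noteq> \<xi> k'" using bij ne by (auto simp: bij_betw_def inj_eq)
  ultimately show "separation_ball \<alpha> a \<rho> (\<xi> k) \<inter> separation_ball \<alpha> a \<rho> (\<xi> k') = {}" by (rule retained_disjoint)
qed

lemma powr_comparable:
  fixes x y C s :: real
  assumes "0 < x" "0 < y" "1 \<le> C" "x \<le> C * y" "y \<le> C * x"
  shows "x powr s \<le> C powr \<bar>s\<bar> * y powr s"
proof (cases "0 \<le> s")
  case True
  have "x powr s \<le> (C * y) powr s" using assms True by (intro powr_mono2) auto
  with True assms show ?thesis by (simp add: powr_mult)
next
  case False
  have "x powr s \<le> (y / C) powr s"
    using assms False by (intro powr_mono2') (auto simp: field_simps)
  also have "\<dots> = C powr \<bar>s\<bar> * y powr s" using False assms by (simp add: powr_divide powr_minus field_simps)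
  finally show ?thesis .
qed

text \<open>Two frequency windows of radius \<open>R\<close>, in their own scales, have a common point.\<close>
definition touching :: "real \<Rightarrow> real \<Rightarrow> real ^ 'n::finite \<Rightarrow> real ^ 'n \<Rightarrow> bool" where
  "touching \<alpha> R \<xi> \<xi>' \<longleftrightarrow> (\<exists>\<eta>. norm (\<eta> - \<xi>) \<le> R * norm \<xi> powr (1 - \<alpha>) \<and> norm (\<eta> - \<xi>') \<le> R * norm \<xi>' powr (1 - \<alpha>))"

lemma touching_sym: "touching \<alpha> R \<xi> \<xi>' \<longleftrightarrow> touching \<alpha> R \<xi>' \<xi>"
  by (auto simp: touching_def)

text \<open>The radius \<open>R |\<xi>| powr (1 - \<alpha>)\<close> is at most \<open>|\<xi>| / 2\<close> unless \<open>|\<xi>|\<close> is bounded in terms of \<open>\<alpha> > 0\<close> and \<open>R\<close>. In both cases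
  \<open>|\<xi>|\<close> is comparable with \<open>1 + |\<eta>|\<close> for every \<open>\<eta>\<close> in the window.\<close>
lemma touching_norm_le:
  assumes \<alpha>: "0 < \<alpha>" and R: "0 < R"
  shows "\<exists>C\<ge>1. \<forall>\<xi> \<xi>' :: real ^ 'n::finite. 1 \<le> norm \<xi> \<and> 1 \<le> norm \<xi>' \<and> touching \<alpha> R \<xi> \<xi>' \<longrightarrow> norm \<xi> \<le> C * norm \<xi>'"
proof -
  \<comment> \<open>The second entry bounds \<open>|\<xi>|\<close> when the radius exceeds \<open>|\<xi>| / 2\<close>.\<close>
  define C0 where "C0 = max 2 ((2 * R) powr (1 / \<alpha>))"
  have C0: "2 \<le> C0" by (simp add: C0_def)
  have up: "norm \<xi> \<le> C0 * (1 + norm \<eta>)" if "1 \<le> norm \<xi>" "norm (\<eta> - \<xi>) \<le> R * norm \<xi> powr (1 - \<alpha>)" for \<xi> \<eta> :: "real ^ 'n"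
  proof (cases "R * norm \<xi> powr (- \<alpha>) \<le> 1 / 2")
    case True
    have "norm \<xi> powr (1 - \<alpha>) = norm \<xi> * norm \<xi> powr (- \<alpha>)"
      using that(1) powr_add[of "norm \<xi>" 1 "- \<alpha>"] by simp
    then have "R * norm \<xi> powr (1 - \<alpha>) = norm \<xi> * (R * norm \<xi> powr (- \<alpha>))" by simp
    also have "\<dots> \<le> norm \<xi> * (1 / 2)" using True by (intro mult_left_mono) auto
    finally have "norm (\<eta> - \<xi>) \<le> norm \<xi> / 2" using that(2) by simp
    then have "norm \<xi> \<le> 2 * norm \<eta>" using norm_triangle_ineq2[of \<xi> \<eta>] by (simp add: norm_minus_commute)
    also have "\<dots> \<le> C0 * norm \<eta>" using C0 by (intro mult_right_mono) auto
    also have "\<dots> \<le> C0 * (1 + norm \<eta>)" using C0 by (intro mult_left_mono) auto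
    finally show ?thesis .
  next
    case False
    have p: "0 < norm \<xi>" using that by linarith
    have "norm \<xi> powr \<alpha> \<le> 2 * R" using False p by (simp add: powr_minus field_simps)
    then have "(norm \<xi> powr \<alpha>) powr (1 / \<alpha>) \<le> (2 * R) powr (1 / \<alpha>)" using \<alpha> by (intro powr_mono2) auto
    then have "norm \<xi> \<le> C0" using \<alpha> p by (simp add: powr_powr C0_def)
    also have "\<dots> \<le> C0 * (1 + norm \<eta>)" using C0 by (simp add: algebra_simps)
    finally show ?thesis .
  qed
  have low: "1 + norm \<eta> \<le> (2 + R) * norm \<xi>" if "1 \<le> norm \<xi>" "norm (\<eta> - \<xi>) \<le> R * norm \<xi> powr (1 - \<alpha>)" for \<xi> \<eta> :: "real ^ 'n"
  proof -
    have "norm \<xi> powr (1 - \<alpha>) \<le> norm \<xi> powr 1" using that \<alpha> by (intro powr_mono) auto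
    then have "R * norm \<xi> powr (1 - \<alpha>) \<le> R * norm \<xi>" using R that by (intro mult_left_mono) auto
    then have "norm (\<eta> - \<xi>) \<le> R * norm \<xi>" using that by linarith
    moreover have "norm \<eta> \<le> norm \<xi> + norm (\<eta> - \<xi>)" using norm_triangle_ineq[of \<xi> "\<eta> - \<xi>"] by simp
    ultimately show ?thesis using that(1) by (simp add: algebra_simps)
  qed
  have "norm \<xi> \<le> C0 * (2 + R) * norm \<xi>'" if one: "1 \<le> norm \<xi>" "1 \<le> norm \<xi>'" and t: "touching \<alpha> R \<xi> \<xi>'" for \<xi> \<xi>' :: "real ^ 'n"
  proof -
    obtain \<eta> where \<eta>: "norm (\<eta> - \<xi>) \<le> R * norm \<xi> powr (1 - \<alpha>)" "norm (\<eta> - \<xi>') \<le> R * norm \<xi>' powr (1 - \<alpha>)"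
      using t by (auto simp: touching_def)
    have "norm \<xi> \<le> C0 * (1 + norm \<eta>)" by (rule up[OF one(1) \<eta>(1)])
    also have "\<dots> \<le> C0 * ((2 + R) * norm \<xi>')" using low[OF one(2) \<eta>(2)] C0 by (intro mult_left_mono) auto
    finally show ?thesis by (simp add: mult.assoc)
  qed
  moreover have "1 \<le> C0 * (2 + R)" using mult_mono[of 1 C0 1 "2 + R"] C0 R by simp
  ultimately show ?thesis by (intro exI[of _ "C0 * (2 + R)"]) auto
qed

lemma touching_powr_le:
  assumes \<alpha>: "0 < \<alpha>" and R: "0 < R"
  shows "\<exists>C\<ge>1. \<forall>\<xi> \<xi>' :: real ^ 'n::finite. 1 \<le> norm \<xi> \<and> 1 \<le> norm \<xi>' \<and> touching \<alpha> R \<xi> \<xi>' \<longrightarrow>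
    norm \<xi> powr s \<le> C * norm \<xi>' powr s \<and> (1 + norm \<xi>) powr s \<le> C * (1 + norm \<xi>') powr s"
proof -
  obtain C where C: "1 \<le> C" "\<And>\<xi> \<xi>' :: real ^ 'n. 1 \<le> norm \<xi> \<Longrightarrow> 1 \<le> norm \<xi>' \<Longrightarrow> touching \<alpha> R \<xi> \<xi>' \<Longrightarrow> norm \<xi> \<le> C * norm \<xi>'"
    using touching_norm_le[OF assms] by blast
  have "norm \<xi> powr s \<le> C powr \<bar>s\<bar> * norm \<xi>' powr s \<and> (1 + norm \<xi>) powr s \<le> C powr \<bar>s\<bar> * (1 + norm \<xi>') powr s"
    if "1 \<le> norm \<xi>" "1 \<le> norm \<xi>'" "touching \<alpha> R \<xi> \<xi>'" for \<xi> \<xi>' :: "real ^ 'n"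
  proof -
    have le: "norm \<xi> \<le> C * norm \<xi>'" "norm \<xi>' \<le> C * norm \<xi>"
      using C(2)[OF that] C(2)[OF that(2,1)] that(3) by (simp_all add: touching_sym)
    have "1 + norm \<xi> \<le> C * (1 + norm \<xi>')" "1 + norm \<xi>' \<le> C * (1 + norm \<xi>)"
      using le C(1) by (simp_all add: distrib_left)
    then show ?thesis using that le C(1) by (intro conjI powr_comparable) auto
  qed
  moreover have "1 \<le> C powr \<bar>s\<bar>" using C(1) by (simp add: ge_one_powr_ge_zero)
  ultimately show ?thesis by blast
qed

text \<open>Compare volumes.\<close>
lemma packing_bound:
  fixes p :: "'k \<Rightarrow> real ^ 'n::finite"
  assumes F: "finite F" and r: "0 < r" and T: "0 \<le> T"
    and disj: "\<And>k k'. k \<in> F \<Longrightarrow> k' \<in> F \<Longrightarrow> k \<noteq> k' \<Longrightarrow> ball (p k) r \<inter> ball (p k') r = {}"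
    and sub: "\<And>k. k \<in> F \<Longrightarrow> ball (p k) r \<subseteq> ball c T"
  shows "real (card F) * r ^ CARD('n) \<le> T ^ CARD('n)"
proof -
  have "(\<Sum>k\<in>F. measure lborel (ball (p k) r)) = measure lborel (\<Union>k\<in>F. ball (p k) r)"
    by (rule measure_finite_Union[symmetric])
      (use F disj r in \<open>auto simp: disjoint_family_on_def emeasure_ball\<close>)
  also have "\<dots> \<le> measure lborel (ball c T)"
    using sub F by (intro measure_mono_fmeasurable) (auto simp: fmeasurable_def emeasure_ball T)
  finally have "real (card F) * (unit_ball_vol (CARD('n)) * r ^ CARD('n)) \<le> unit_ball_vol (CARD('n)) * T ^ CARD('n)"
    using r T by (simp add: content_ball)
  then have "unit_ball_vol (CARD('n)) * (real (card F) * r ^ CARD('n)) \<le> unit_ball_vol (CARD('n)) * T ^ CARD('n)"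
    by (simp add: mult_ac)
  then show ?thesis using unit_ball_vol_pos[of "real CARD('n)"] by (subst (asm) mult_le_cancel_left_pos) auto
qed

text \<open>Windows that touch the window at \<open>\<omega>\<close> have scales comparable to that of \<open>\<omega>\<close>. So the disjoint separation balls contain
  balls of one common radius \<open>\<delta> l\<close>, all inside a ball about \<open>\<omega>\<close> of radius \<open>T l\<close>.\<close>
lemma touching_card_bound:
  assumes \<alpha>: "0 < \<alpha>" and R: "0 < R" and a: "0 < a" and \<rho>: "0 < \<rho>"
  shows "\<exists>N. \<forall>(\<xi> :: nat \<Rightarrow> real ^ 'n::finite) \<omega>. subdyadic_centers \<alpha> a \<rho> \<xi> \<and> 1 \<le> norm \<omega> \<longrightarrow>
     finite {k. touching \<alpha> R (\<xi> k) \<omega>} \<and> card {k. touching \<alpha> R (\<xi> k) \<omega>} \<le> N"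
proof -
  obtain \<kappa> where \<kappa>: "1 \<le> \<kappa>" "\<And>\<xi> \<xi>' :: real ^ 'n. 1 \<le> norm \<xi> \<Longrightarrow> 1 \<le> norm \<xi>' \<Longrightarrow> touching \<alpha> R \<xi> \<xi>' \<Longrightarrow> norm \<xi> powr (1 - \<alpha>) \<le> \<kappa> * norm \<xi>' powr (1 - \<alpha>)"
    using touching_powr_le[OF \<alpha> R, of "1 - \<alpha>"] by blast
  define \<delta> where "\<delta> = a * \<rho> / \<kappa>"
  define T where "T = R * \<kappa> + R + \<delta>"
  have \<delta>: "0 < \<delta>" using a \<rho> \<kappa> by (simp add: \<delta>_def)
  have T: "0 < T" using \<delta> R \<kappa> by (simp add: T_def add_pos_pos)
  define N where "N = nat \<lceil>(T / \<delta>) ^ CARD('n)\<rceil>"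
  have "finite {k. touching \<alpha> R (\<xi> k) \<omega>} \<and> card {k. touching \<alpha> R (\<xi> k) \<omega>} \<le> N"
    if cen: "subdyadic_centers \<alpha> a \<rho> \<xi>" and \<omega>: "1 \<le> norm \<omega>" for \<xi> :: "nat \<Rightarrow> real ^ 'n" and \<omega>
  proof (rule finite_if_finite_subsets_card_bdd)
    fix F assume F: "F \<subseteq> {k. touching \<alpha> R (\<xi> k) \<omega>}" "finite F"
    define l where "l = norm \<omega> powr (1 - \<alpha>)"
    have l: "0 < l" using \<omega> unfolding l_def by (intro powr_gt_zero[THEN iffD2]) auto
    have "real (card F) * (\<delta> * l) ^ CARD('n) \<le> (T * l) ^ CARD('n)"
    proof (rule packing_bound[OF F(2)])
      show "0 < \<delta> * l" "0 \<le> T * l" using \<delta> T l by simp_all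
      have sub: "ball (\<xi> k) (\<delta> * l) \<subseteq> separation_ball \<alpha> a \<rho> (\<xi> k)" if "k \<in> F" for k
      proof -
        have "l \<le> \<kappa> * norm (\<xi> k) powr (1 - \<alpha>)" unfolding l_def
          using F(1) that by (intro \<kappa>(2) \<omega> centers_norm_ge_1[OF cen]) (auto simp: touching_sym)
        then have "\<delta> * l \<le> \<delta> * (\<kappa> * norm (\<xi> k) powr (1 - \<alpha>))" using \<delta> by (intro mult_left_mono) auto
        also have "\<dots> = a * \<rho> * norm (\<xi> k) powr (1 - \<alpha>)" using \<kappa>(1) by (simp add: \<delta>_def)
        finally show ?thesis unfolding separation_ball_def by (rule subset_ball)
      qed
      show "ball (\<xi> k) (\<delta> * l) \<inter> ball (\<xi> k') (\<delta> * l) = {}" if "k \<in> F" "k' \<in> F" "k \<noteq> k'" for k k'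
        using sub[OF that(1)] sub[OF that(2)] centers_separated[OF cen that(3)] by blast
      show "ball (\<xi> k) (\<delta> * l) \<subseteq> ball \<omega> (T * l)" if k: "k \<in> F" for k
      proof
        fix z assume z: "z \<in> ball (\<xi> k) (\<delta> * l)"
        have t: "touching \<alpha> R (\<xi> k) \<omega>" using k F(1) by auto
        then obtain \<eta> where \<eta>: "norm (\<eta> - \<xi> k) \<le> R * norm (\<xi> k) powr (1 - \<alpha>)" "norm (\<eta> - \<omega>) \<le> R * l"
          unfolding touching_def l_def by blast
        have "norm (\<xi> k) powr (1 - \<alpha>) \<le> \<kappa> * l" unfolding l_def
          by (rule \<kappa>(2)[OF centers_norm_ge_1[OF cen] \<omega> t])
        then have "R * norm (\<xi> k) powr (1 - \<alpha>) \<le> R * (\<kappa> * l)" using R by (intro mult_left_mono) auto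
        moreover have "dist \<omega> z \<le> dist \<omega> \<eta> + dist \<eta> (\<xi> k) + dist (\<xi> k) z"
          using dist_triangle[of \<omega> z \<eta>] dist_triangle[of \<eta> z "\<xi> k"] by linarith
        ultimately have "dist \<omega> z < R * l + R * (\<kappa> * l) + \<delta> * l"
          using \<eta> z by (simp add: dist_norm norm_minus_commute)
        then show "z \<in> ball \<omega> (T * l)" by (simp add: T_def algebra_simps)
      qed
    qed
    then have "real (card F) * \<delta> ^ CARD('n) * l ^ CARD('n) \<le> T ^ CARD('n) * l ^ CARD('n)"
      by (simp add: power_mult_distrib mult.assoc)
    then have "real (card F) * \<delta> ^ CARD('n) \<le> T ^ CARD('n)"
      using l by (subst (asm) mult_le_cancel_right_pos) auto
    then have "real (card F) \<le> (T / \<delta>) ^ CARD('n)" using \<delta> by (simp add: power_divide field_simps)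
    then show "card F \<le> N" unfolding N_def by linarith
  qed
  then show ?thesis by blast
qed

text \<open>Frequencies with \<open>|\<eta>| < 1\<close> are covered by a center with \<open>1 \<le> |\<xi>\<^sub>k| < 2\<close>: there \<open>|\<eta> - \<xi>\<^sub>k| < 3\<close>, and the lower bound imposed
  on \<open>R\<^sub>0\<close> is exactly what makes the scaled radius at least 3, also when \<open>\<alpha> > 1\<close> shrinks the scale.\<close>
lemma frame_pair_cover:
  fixes \<xi> :: "nat \<Rightarrow> real ^ 'n::finite"
  assumes "subdyadic_frame_pair \<alpha> D \<phi> x \<xi>"
  shows "\<exists>k. norm (\<eta> - \<xi> k) \<le> R0 D * norm (\<xi> k) powr (1 - \<alpha>)"
proof -
  have cen: "subdyadic_centers \<alpha> (sep D) (rho D) \<xi>"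
    using assms by (simp add: subdyadic_frame_pair_def subdyadic_lattice_def)
  have R0: "3 * 2 powr (max (\<alpha> - 1) 0) < R0 D"
    using assms by (simp add: subdyadic_frame_pair_def subdyadic_window_def)
  show ?thesis
  proof (cases "1 \<le> norm \<eta>")
    case True
    have "{\<eta>. 1 \<le> norm \<eta>} \<subseteq> (\<Union>k. cball (\<xi> k) (Acov D * rho D * norm (\<xi> k) powr (1 - \<alpha>)))"
      using assms cen by (simp add: subdyadic_frame_pair_def subdyadic_geometry_def)
    then obtain k where k: "dist (\<xi> k) \<eta> \<le> Acov D * rho D * norm (\<xi> k) powr (1 - \<alpha>)" using True by auto
    also have "\<dots> \<le> R0 D * norm (\<xi> k) powr (1 - \<alpha>)"
      using assms by (intro mult_right_mono) (auto simp: subdyadic_frame_pair_def)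
    finally show ?thesis by (auto simp: dist_norm norm_minus_commute)
  next
    case False
    obtain k where k: "norm (\<xi> k) < 2" using centers_first[OF cen] by blast
    have k1: "1 \<le> norm (\<xi> k)" by (rule centers_norm_ge_1[OF cen])
    have "2 powr (- max (\<alpha> - 1) 0) \<le> norm (\<xi> k) powr (1 - \<alpha>)"
    proof (cases "\<alpha> \<le> 1")
      case True then show ?thesis using k1 by (simp add: max_def ge_one_powr_ge_zero)
    next
      case False
      then have "2 powr (1 - \<alpha>) \<le> norm (\<xi> k) powr (1 - \<alpha>)" using k k1 by (intro powr_mono2') auto
      then show ?thesis using False by (simp add: max_def)
    qed
    then have "3 * 2 powr (max (\<alpha> - 1) 0) * 2 powr (- max (\<alpha> - 1) 0) \<le> R0 D * norm (\<xi> k) powr (1 - \<alpha>)"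
      using R0 by (intro mult_mono) (auto intro: order_trans[OF _ less_imp_le[OF R0]])
    then have "3 \<le> R0 D * norm (\<xi> k) powr (1 - \<alpha>)" by (simp add: mult.assoc flip: powr_add)
    moreover have "norm (\<eta> - \<xi> k) \<le> norm \<eta> + norm (\<xi> k)" by (rule norm_triangle_ineq4)
    ultimately show ?thesis using False k by (intro exI[of _ k]) linarith
  qed
qed

section \<open>Sums over the integer lattice\<close>

text \<open>A product rather than a radial weight, so that sums over the lattice factor into one-dimensional sums.\<close>
definition lattice_weight :: "real ^ 'n::finite \<Rightarrow> real" where
  "lattice_weight v = (\<Prod>i\<in>UNIV. 1 / (1 + \<bar>v $ i\<bar>)\<^sup>2)"

lemma lattice_weight_pos: "0 < lattice_weight v"
  unfolding lattice_weight_def by (intro prod_pos) (auto simp: add_pos_nonneg)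

lemma int_sum_inverse_square:
  fixes A :: "int set"
  assumes "finite A"
  shows "(\<Sum>a\<in>A. 1 / (1 + \<bar>real_of_int (a - a0)\<bar>)\<^sup>2) \<le> 2 * (\<Sum>n. inverse (real (Suc n) ^ 2))"
proof -
  have sm: "summable (\<lambda>n. inverse (real (Suc n) ^ 2))"
    using inverse_power_summable[of 2, where 'a=real] by (subst summable_Suc_iff) simp
  let ?w = "\<lambda>a. 1 / (1 + \<bar>real_of_int (a - a0)\<bar>)\<^sup>2"
  let ?h = "\<lambda>n. inverse (real (Suc n) ^ 2)"
  have half_sum: "(\<Sum>a\<in>B. ?w a) \<le> (\<Sum>n. ?h n)" if B: "finite B" "inj_on (\<lambda>a. nat \<bar>a - a0\<bar>) B" for B
  proof -
    have "(\<Sum>a\<in>B. ?w a) = (\<Sum>a\<in>B. ?h (nat \<bar>a - a0\<bar>))"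
      by (intro sum.cong) (auto simp: inverse_eq_divide add.commute)
    also have "\<dots> = (\<Sum>n\<in>(\<lambda>a. nat \<bar>a - a0\<bar>) ` B. ?h n)" by (simp add: sum.reindex[OF B(2)])
    also have "\<dots> \<le> (\<Sum>n. ?h n)" using B sm by (intro sum_le_suminf) auto
    finally show ?thesis .
  qed
  have "(\<Sum>a\<in>A. ?w a) = (\<Sum>a\<in>{a\<in>A. a0 \<le> a}. ?w a) + (\<Sum>a\<in>{a\<in>A. a < a0}. ?w a)"
    using assms by (subst sum.union_disjoint[symmetric]) (auto intro!: sum.cong)
  also have "\<dots> \<le> (\<Sum>n. ?h n) + (\<Sum>n. ?h n)"
    using assms by (intro add_mono half_sum) (auto simp: inj_on_def)
  finally show ?thesis by simp
qed

text \<open>The bound is uniform in the shift \<open>v\<close> and in the step \<open>s \<ge> s0\<close>: with \<open>a0\<close> the integer part of \<open>v / s\<close>, the term at \<open>a\<close> is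
  controlled by \<open>|a - a0|\<close>.\<close>
lemma lattice_sum_1d:
  fixes s0 :: real
  assumes s0: "0 < s0"
  shows "\<exists>C>0. \<forall>s v A. s0 \<le> s \<and> finite A \<longrightarrow> (\<Sum>a\<in>A. 1 / (1 + \<bar>s * real_of_int a - v\<bar>)\<^sup>2) \<le> C"
proof -
  \<comment> \<open>Chosen such that \<open>c (1 + m) \<le> 1 + s (m - 1)\<close> for \<open>m \<ge> 1\<close> and \<open>c \<le> 1\<close>.\<close>
  define c where "c = min 1 s0 / 2"
  have c: "0 < c" "c \<le> 1 / 2" "2 * c \<le> s0" using s0 by (auto simp: c_def)
  define S where "S = (\<Sum>n. inverse (real (Suc n) ^ 2))"
  have "(\<Sum>a\<in>A. 1 / (1 + \<bar>s * real_of_int a - v\<bar>)\<^sup>2) \<le> 2 * \<bar>S\<bar> / c\<^sup>2 + 1" if s: "s0 \<le> s" and A: "finite A" for s v A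
  proof -
    define a0 where "a0 = \<lfloor>v / s\<rfloor>"
    have sp: "0 < s" using s s0 by simp
    have term_le: "1 / (1 + \<bar>s * real_of_int a - v\<bar>)\<^sup>2 \<le> (1 / (1 + \<bar>real_of_int (a - a0)\<bar>)\<^sup>2) / c\<^sup>2" for a
    proof -
      define m where "m = \<bar>real_of_int (a - a0)\<bar>"
      have m: "m = 0 \<or> 1 \<le> m" proof (cases "a = a0")
        case False
        then have "1 \<le> \<bar>a - a0\<bar>" by linarith
        then have "real_of_int 1 \<le> real_of_int \<bar>a - a0\<bar>" by (rule of_int_le_iff[THEN iffD2])
        then show ?thesis by (simp add: m_def)
      qed (simp add: m_def)
      have fl: "\<bar>v / s - real_of_int a0\<bar> \<le> 1" unfolding a0_def by linarith
      have "m - 1 \<le> \<bar>real_of_int a - v / s\<bar>" using fl unfolding m_def by linarith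
      then have "s * (m - 1) \<le> s * \<bar>real_of_int a - v / s\<bar>" using sp by (intro mult_left_mono) auto
      also have "\<dots> = \<bar>s * real_of_int a - v\<bar>" 
      proof -
        have "s * (real_of_int a - v / s) = s * real_of_int a - v" using sp by (simp add: right_diff_distrib)
        then show ?thesis using sp abs_mult[of s "real_of_int a - v / s"] by simp
      qed
      finally have low: "s * (m - 1) \<le> \<bar>s * real_of_int a - v\<bar>" .
      have "c * (1 + m) \<le> 1 + \<bar>s * real_of_int a - v\<bar>"
      proof (cases "m = 0")
        case True then show ?thesis using c by simp
      next
        case False
        then have m1: "1 \<le> m" using m by simp
        have "c * (1 + m) = 2 * c + c * (m - 1)" by (simp add: algebra_simps)
        also have "\<dots> \<le> 1 + s * (m - 1)" using c s m1 by (intro add_mono mult_right_mono) auto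
        finally show ?thesis using low by linarith
      qed
      moreover have "0 < c * (1 + m)" using c by (simp add: m_def add_pos_nonneg)
      ultimately have "(c * (1 + m))\<^sup>2 \<le> (1 + \<bar>s * real_of_int a - v\<bar>)\<^sup>2" by (intro power_mono) auto
      then have "1 / (1 + \<bar>s * real_of_int a - v\<bar>)\<^sup>2 \<le> 1 / (c * (1 + m))\<^sup>2"
        using \<open>0 < c * (1 + m)\<close> by (intro frac_le zero_less_power) auto
      then show ?thesis by (simp add: m_def power_mult_distrib mult.commute)
    qed
    have "(\<Sum>a\<in>A. 1 / (1 + \<bar>s * real_of_int a - v\<bar>)\<^sup>2) \<le> (\<Sum>a\<in>A. (1 / (1 + \<bar>real_of_int (a - a0)\<bar>)\<^sup>2) / c\<^sup>2)"
      by (intro sum_mono term_le)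
    also have "\<dots> = (\<Sum>a\<in>A. 1 / (1 + \<bar>real_of_int (a - a0)\<bar>)\<^sup>2) / c\<^sup>2" by (simp add: sum_divide_distrib)
    also have "\<dots> \<le> 2 * \<bar>S\<bar> / c\<^sup>2"
      using int_sum_inverse_square[OF A, of a0] c by (intro divide_right_mono) (auto simp: S_def)
    finally show ?thesis by simp
  qed
  moreover have "0 < 2 * \<bar>S\<bar> / c\<^sup>2 + 1" using c by (intro add_nonneg_pos) auto
  ultimately show ?thesis by blast
qed

lemma sum_vec_prod_le:
  fixes g :: "'n::finite \<Rightarrow> int \<Rightarrow> real" and F :: "(int ^ 'n) set"
  assumes F: "finite F" and g: "\<And>i a. 0 \<le> g i a" and S: "\<And>i A. finite A \<Longrightarrow> sum (g i) A \<le> C"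
  shows "(\<Sum>j\<in>F. \<Prod>i\<in>UNIV. g i (j $ i)) \<le> C ^ CARD('n)"
proof -
  define A where "A = (\<Union>j\<in>F. range (\<lambda>i. j $ i))"
  have A: "finite A" using F by (simp add: A_def)
  have "(\<Sum>j\<in>F. \<Prod>i\<in>UNIV. g i (j $ i)) = (\<Sum>f\<in>(\<lambda>j i. j $ i) ` F. \<Prod>i\<in>UNIV. g i (f i))"
    by (subst sum.reindex) (auto simp: inj_on_def vec_eq_iff fun_eq_iff)
  also have "\<dots> \<le> (\<Sum>f\<in>PiE UNIV (\<lambda>_. A). \<Prod>i\<in>UNIV. g i (f i))"
    using A g by (intro sum_mono2 finite_PiE) (auto simp: A_def intro!: prod_nonneg)
  also have "\<dots> = (\<Prod>i\<in>UNIV. \<Sum>a\<in>A. g i a)" by (rule prod_sum_PiE[symmetric]) (auto simp: A)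
  also have "\<dots> \<le> (\<Prod>i\<in>(UNIV::'n set). C)" using S[OF A] g by (intro prod_mono) (auto intro: sum_nonneg)
  finally show ?thesis by simp
qed

lemma lattice_weight_sum:
  assumes s0: "0 < (s0::real)"
  shows "\<exists>C>0. \<forall>s (v :: real ^ 'n::finite) F. s0 \<le> s \<and> finite F \<longrightarrow>
     (\<Sum>j\<in>F. lattice_weight (s *\<^sub>R (\<chi> i. real_of_int (j $ i)) - v)) \<le> C"
proof -
  obtain C where C: "0 < C" "\<And>s v A. s0 \<le> s \<Longrightarrow> finite A \<Longrightarrow> (\<Sum>a\<in>A. 1 / (1 + \<bar>s * real_of_int a - v\<bar>)\<^sup>2) \<le> C"
    using lattice_sum_1d[OF s0] by blast
  have "(\<Sum>j\<in>F. lattice_weight (s *\<^sub>R (\<chi> i. real_of_int (j $ i)) - v)) \<le> C ^ CARD('n)"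
    if "s0 \<le> s" "finite F" for s and v :: "real ^ 'n" and F
    using sum_vec_prod_le[OF that(2), of "\<lambda>i a. 1 / (1 + \<bar>s * real_of_int a - v $ i\<bar>)\<^sup>2" C] C(2)[OF that(1)]
    by (simp add: lattice_weight_def)
  then show ?thesis using C(1) by (intro exI[of _ "C ^ CARD('n)"]) auto
qed

lemma lattice_weight_le_norm: "1 / (1 + norm v) ^ (2 * CARD('n)) \<le> lattice_weight (v :: real ^ 'n::finite)"
proof -
  have "1 / (1 + norm v) ^ (2 * CARD('n)) = (\<Prod>i\<in>(UNIV::'n set). 1 / (1 + norm v)\<^sup>2)"
    by (simp add: power_mult power_one_over)
  also have "\<dots> \<le> lattice_weight v" unfolding lattice_weight_def
    by (intro prod_mono conjI divide_left_mono power_mono add_left_mono component_le_norm_cart mult_pos_pos zero_less_power)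
      (auto simp: add_pos_nonneg)
  finally show ?thesis .
qed

text \<open>Decay in each coordinate separately is decay in the norm, because the largest coordinate controls the norm.\<close>
lemma decay_norm:
  fixes v :: "real ^ 'n::finite"
  assumes "0 \<le> I" "\<And>i. \<bar>v $ i\<bar> ^ M * I \<le> K" "I \<le> K"
  shows "(1 + norm v) ^ M * I \<le> (1 + real CARD('n)) ^ M * K"
proof -
  obtain i where i: "\<And>l. \<bar>v $ l\<bar> \<le> \<bar>v $ i\<bar>"
  proof -
    have "Max (range (\<lambda>l. \<bar>v $ l\<bar>)) \<in> range (\<lambda>l. \<bar>v $ l\<bar>)" by (intro Max_in) auto
    then obtain i where i: "Max (range (\<lambda>l. \<bar>v $ l\<bar>)) = \<bar>v $ i\<bar>" by (rule imageE)
    show ?thesis by (rule that[of i], subst i[symmetric]) (auto intro!: Max_ge)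
  qed
  define T where "T = max 1 \<bar>v $ i\<bar>"
  have T: "1 \<le> T" by (simp add: T_def)
  have "norm v \<le> (\<Sum>l\<in>UNIV. \<bar>v $ l\<bar>)" by (rule norm_le_l1_cart)
  also have "\<dots> \<le> (\<Sum>l\<in>(UNIV::'n set). T)" using i by (intro sum_mono) (auto simp: T_def le_max_iff_disj)
  finally have "1 + norm v \<le> (1 + real CARD('n)) * T" using T by (simp add: distrib_right)
  then have "(1 + norm v) ^ M \<le> ((1 + real CARD('n)) * T) ^ M" by (intro power_mono) auto
  then have "(1 + norm v) ^ M * I \<le> ((1 + real CARD('n)) * T) ^ M * I"
    by (rule mult_right_mono[OF _ assms(1)])
  also have "\<dots> = (1 + real CARD('n)) ^ M * (T ^ M * I)"
    by (simp only: power_mult_distrib mult.assoc)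
  also have "T ^ M * I \<le> K" using assms(2)[of i] assms(3) by (cases "\<bar>v $ i\<bar> \<le> 1") (auto simp: T_def max_def)
  finally show ?thesis by (simp add: mult_left_mono)
qed

lemma decay_lattice_weight:
  fixes v :: "real ^ 'n::finite"
  assumes "0 \<le> I" "\<And>i. \<bar>v $ i\<bar> ^ (2 * CARD('n)) * I \<le> K" "I \<le> K"
  shows "I \<le> (1 + real CARD('n)) ^ (2 * CARD('n)) * K * lattice_weight v"
proof -
  have K: "0 \<le> (1 + real CARD('n)) ^ (2 * CARD('n)) * K" using assms(1,3) by simp
  have "0 < (1 + norm v) ^ (2 * CARD('n))" by (simp add: add_pos_nonneg)
  then have "I \<le> (1 + real CARD('n)) ^ (2 * CARD('n)) * K * (1 / (1 + norm v) ^ (2 * CARD('n)))"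
    using decay_norm[OF assms] by (simp add: pos_le_divide_eq mult.commute)
  also have "\<dots> \<le> (1 + real CARD('n)) ^ (2 * CARD('n)) * K * lattice_weight v"
    by (rule mult_left_mono[OF lattice_weight_le_norm K])
  finally show ?thesis .
qed

section \<open>Windows as Schwartz functions\<close>

lemma integrable_inverse_square: "integrable lborel (\<lambda>x::real. 1 / (1 + \<bar>x\<bar>)\<^sup>2)"
proof (rule Bochner_Integration.integrable_bound)
  show "integrable lborel (\<lambda>x::real. inverse (1 + x\<^sup>2))"
    using integrable_inverse_1_plus_square by (simp add: set_integrable_def)
  show "AE x::real in lborel. norm (1 / (1 + \<bar>x\<bar>)\<^sup>2) \<le> norm (inverse (1 + x\<^sup>2))"
  proof (intro AE_I2)
    fix x :: real
    have "1 + x\<^sup>2 \<le> (1 + \<bar>x\<bar>)\<^sup>2" by (simp add: power2_sum)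
    moreover have "0 < 1 + x\<^sup>2" by (simp add: add_pos_nonneg)
    ultimately have "1 / (1 + \<bar>x\<bar>)\<^sup>2 \<le> 1 / (1 + x\<^sup>2)" by (intro divide_left_mono mult_pos_pos) auto
    then show "norm (1 / (1 + \<bar>x\<bar>)\<^sup>2) \<le> norm (inverse (1 + x\<^sup>2))" by (simp add: inverse_eq_divide)
  qed
qed measurable

lemma integrable_lattice_weight: "integrable lborel (\<lambda>v::real^'n::finite. complex_of_real (lattice_weight v))"
  unfolding lattice_weight_def of_real_prod
  by (rule integrable_prod_cart[of "\<lambda>i x. complex_of_real (1 / (1 + \<bar>x\<bar>)\<^sup>2)"])
    (intro integrable_of_real integrable_inverse_square)

lemma schwartz_cont: "g \<in> schwartz \<Longrightarrow> continuous_on UNIV g"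
  by (intro smooth_cont schwartz_smooth)

lemma schwartz_integrable:
  fixes g :: "real ^ 'n::finite \<Rightarrow> complex"
  assumes g: "g \<in> schwartz" shows "integrable lborel g"
proof (rule Bochner_Integration.integrable_bound)
  define S where "S = schwartz_seminorm (2 * CARD('n)) [] g"
  have S: "0 \<le> S" unfolding S_def by (rule schwartz_seminorm_nonneg[OF g])
  show "integrable lborel (\<lambda>v::real^'n. S * complex_of_real (lattice_weight v))"
    by (intro integrable_mult_right integrable_lattice_weight)
  show "g \<in> borel_measurable lborel" using borel_measurable_continuous_onI[OF schwartz_cont[OF g]] by simp
  show "AE v in lborel. norm (g v) \<le> norm (S * complex_of_real (lattice_weight v))"
  proof (intro AE_I2)
    fix v :: "real ^ 'n"
    have pos: "0 < (1 + norm v) ^ (2 * CARD('n))" by (simp add: add_pos_nonneg)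
    have "(1 + norm v) ^ (2 * CARD('n)) * cmod (g v) \<le> S"
      using schwartz_bound[OF g, of v "2 * CARD('n)" "[]"] by (simp add: S_def partial_derivs_Nil)
    then have "cmod (g v) \<le> S * (1 / (1 + norm v) ^ (2 * CARD('n)))" using pos by (simp add: field_simps)
    also have "\<dots> \<le> S * lattice_weight v" using S by (intro mult_left_mono lattice_weight_le_norm)
    finally show "norm (g v) \<le> norm (S * complex_of_real (lattice_weight v))"
      using S less_imp_le[OF lattice_weight_pos[of v]] by (simp add: norm_mult)
  qed
qed

lemma schwartz_fourier_inversion:
  fixes \<phi> :: "real ^ 'n::finite \<Rightarrow> complex"
  assumes \<phi>: "\<phi> \<in> schwartz" and cont: "continuous_on UNIV (fourier \<phi>)" and van: "\<And>z. R < norm z \<Longrightarrow> fourier \<phi> z = 0"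
  shows "(LINT \<eta>|lborel. fourier \<phi> \<eta> * iexp (y \<bullet> \<eta>)) = (2 * pi) ^ CARD('n) * \<phi> y"
proof (rule fourier_inversion[OF schwartz_integrable[OF \<phi>] schwartz_cont[OF \<phi>]])
  show "cmod (\<phi> x) \<le> schwartz_seminorm 0 [] \<phi>" for x
    using schwartz_bound[OF \<phi>, of x 0 "[]"] by (simp add: partial_derivs_Nil)
  show "integrable lborel (fourier \<phi>)" by (rule continuous_compact_support_integrable[OF cont van])
qed

text \<open>The sampling formula. Since \<open>s R < \<pi>\<close>, both \<open>P\<close> and \<open>B\<close> live in one period cell of the characters; expanding \<open>B\<close>,
  modulated by \<open>v\<close>, into its Fourier series and integrating against \<open>P\<close> produces translates of \<open>\<phi>\<close> along the lattice.\<close>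
lemma windowed_fourier_series:
  fixes P B \<phi> :: "real ^ 'n::finite \<Rightarrow> complex"
  assumes s: "0 < s" and sR: "s * R < pi" and P: "continuous_on UNIV P" and PR: "\<And>z. R \<le> norm z \<Longrightarrow> P z = 0"
    and inv: "\<And>y. (LINT \<eta>|lborel. P \<eta> * iexp (y \<bullet> \<eta>)) = (2 * pi) ^ CARD('n) * \<phi> y"
    and B: "continuous_on UNIV B" and BR: "\<And>z. R \<le> norm z \<Longrightarrow> B z = 0"
  shows "((\<lambda>j. complex_of_real (s ^ CARD('n)) * (LINT \<zeta>|lborel. B \<zeta> * iexp ((s *\<^sub>R int_vec j - v) \<bullet> \<zeta>)) * \<phi> (\<tau> - s *\<^sub>R int_vec j))
     has_sum (LINT \<zeta>|lborel. P \<zeta> * B \<zeta> * iexp ((\<tau> - v) \<bullet> \<zeta>))) UNIV"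
proof -
  define H where "H \<zeta> = B \<zeta> * exp (- (\<i> * complex_of_real (v \<bullet> \<zeta>)))" for \<zeta>
  define \<Psi> where "\<Psi> \<zeta> = P \<zeta> * iexp (\<tau> \<bullet> \<zeta>)" for \<zeta>
  have big: "R \<le> norm \<zeta>" if "pi / s \<le> \<bar>\<zeta> $ i\<bar>" for \<zeta> :: "real ^ 'n" and i
  proof -
    have "R \<le> pi / s" using s sR by (simp add: field_simps)
    then show ?thesis using that component_le_norm_cart[of \<zeta> i] by linarith
  qed
  have Hc: "continuous_on UNIV H" unfolding H_def by (intro continuous_intros B)
  have \<Psi>c: "continuous_on UNIV \<Psi>" unfolding \<Psi>_def by (intro continuous_intros P)
  obtain K where "0 < K" "\<And>z. cmod (P z) \<le> K"
    using continuous_compact_support_bounded[OF P, of R] PR by (metis less_imp_le)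
  then have \<Psi>b: "cmod (\<Psi> z) \<le> K" for z by (simp add: \<Psi>_def norm_mult)
  have "((\<lambda>j. (LINT \<zeta>|lborel. H \<zeta> * cnj (character s j \<zeta>)) / complex_of_real ((2 * pi / s) ^ CARD('n)) *
            (LINT \<zeta>|lborel. \<Psi> \<zeta> * character s j \<zeta>)) has_sum (LINT \<zeta>|lborel. \<Psi> \<zeta> * H \<zeta>)) UNIV"
  proof (rule fourier_series_has_sum[OF s Hc _ _ \<Psi>b])
    show "H \<zeta> = 0" if "pi / s \<le> \<bar>\<zeta> $ i\<bar>" for \<zeta> i using BR[OF big[OF that]] by (simp add: H_def)
    show "\<Psi> \<in> borel_measurable borel" by (rule borel_measurable_continuous_onI[OF \<Psi>c])
    show "\<Psi> \<zeta> = 0" if out: "\<zeta> \<notin> cube s" for \<zeta>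
    proof -
      obtain i where "\<not> \<bar>\<zeta> $ i\<bar> \<le> pi / s" using out by (auto simp: cube_def)
      then have "pi / s \<le> \<bar>\<zeta> $ i\<bar>" by simp
      then show ?thesis using PR[OF big[of \<zeta> i]] by (simp add: \<Psi>_def)
    qed
  qed
  moreover have "(LINT \<zeta>|lborel. \<Psi> \<zeta> * H \<zeta>) = (LINT \<zeta>|lborel. P \<zeta> * B \<zeta> * iexp ((\<tau> - v) \<bullet> \<zeta>))"
  proof (rule Bochner_Integration.integral_cong)
    fix \<zeta>
    have "iexp ((\<tau> - v) \<bullet> \<zeta>) = iexp (\<tau> \<bullet> \<zeta>) * exp (- (\<i> * complex_of_real (v \<bullet> \<zeta>)))"
      by (simp add: exp_add[symmetric] inner_diff_left algebra_simps)
    then show "\<Psi> \<zeta> * H \<zeta> = P \<zeta> * B \<zeta> * iexp ((\<tau> - v) \<bullet> \<zeta>)"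
      by (simp add: \<Psi>_def H_def)
  qed simp
  moreover have "(LINT \<zeta>|lborel. \<Psi> \<zeta> * character s j \<zeta>) = (2 * pi) ^ CARD('n) * \<phi> (\<tau> - s *\<^sub>R int_vec j)" for j
  proof -
    have "\<Psi> \<zeta> * character s j \<zeta> = P \<zeta> * iexp ((\<tau> - s *\<^sub>R int_vec j) \<bullet> \<zeta>)" for \<zeta>
    proof -
      have "iexp ((\<tau> - s *\<^sub>R int_vec j) \<bullet> \<zeta>) = iexp (\<tau> \<bullet> \<zeta>) * character s j \<zeta>"
        unfolding character_def by (simp add: exp_add[symmetric] inner_diff_left algebra_simps)
      then show ?thesis by (simp add: \<Psi>_def)
    qed
    then show ?thesis using inv by simp
  qed
  moreover have "(LINT \<zeta>|lborel. H \<zeta> * cnj (character s j \<zeta>)) = (LINT \<zeta>|lborel. B \<zeta> * iexp ((s *\<^sub>R int_vec j - v) \<bullet> \<zeta>))" for j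
  proof (rule Bochner_Integration.integral_cong)
    fix \<zeta>
    have "iexp ((s *\<^sub>R int_vec j - v) \<bullet> \<zeta>) = exp (- (\<i> * complex_of_real (v \<bullet> \<zeta>))) * cnj (character s j \<zeta>)"
      unfolding character_def by (simp add: exp_cnj exp_add[symmetric] inner_diff_left algebra_simps)
    then show "H \<zeta> * cnj (character s j \<zeta>) = B \<zeta> * iexp ((s *\<^sub>R int_vec j - v) \<bullet> \<zeta>)"
      by (simp add: H_def)
  qed simp
  moreover have "a / complex_of_real ((2 * pi / s) ^ CARD('n)) * ((2 * pi) ^ CARD('n) * b) = complex_of_real (s ^ CARD('n)) * a * b" for a b :: complex
    using s by (simp add: power_divide field_simps)
  ultimately show ?thesis by simp
qed

text \<open>The constant depends only on bounds for \<open>P\<close> and \<open>Q\<close>, on the number of terms of the denominator, on the range of the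
  dilations and on the lower bound of the denominator.\<close>
lemma quotient_bounded_derivs:
  fixes P Q :: "real ^ 'n::finite \<Rightarrow> complex"
  assumes P: "\<And>i. bounded_derivs M UNIV i KP P" "0 \<le> KP" and Q: "\<And>i. bounded_derivs M UNIV i KQ Q" "0 \<le> KQ"
    and \<kappa>: "1 \<le> \<kappa>" and m: "0 < m"
  shows "\<exists>L\<ge>0. \<forall>S (i::'n) (I::nat set) c w c' w'. finite I \<and> card I \<le> N \<and> (\<forall>k\<in>I. \<bar>c k\<bar> \<le> \<kappa>) \<and> \<bar>c'\<bar> \<le> \<kappa> \<and>
     (\<forall>z\<in>S. m \<le> cmod (\<Sum>k\<in>I. P (c k *\<^sub>R z + w k) * cnj (P (c k *\<^sub>R z + w k)))) \<longrightarrow>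
     bounded_derivs M S i L (\<lambda>z. cnj (P z) * Q (c' *\<^sub>R z + w') * inverse (\<Sum>k\<in>I. P (c k *\<^sub>R z + w k) * cnj (P (c k *\<^sub>R z + w k))))"
proof -
  define Ka where "Ka = \<kappa> ^ M * KP"
  define Kb where "Kb = \<kappa> ^ M * KQ"
  have K0: "0 \<le> Ka" "0 \<le> Kb" using P Q \<kappa> by (simp_all add: Ka_def Kb_def)
  define Ks where "Ks = 2 ^ M * Ka * Ka"
  have Ks: "0 \<le> Ks" using K0 by (simp add: Ks_def)
  obtain L where L: "0 \<le> L" "\<forall>S (i::'n) F. bounded_derivs M S i (real N * Ks) F \<and> (\<forall>z\<in>S. m \<le> cmod (F z)) \<longrightarrow> bounded_derivs M S i L (\<lambda>z. inverse (F z))"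
    using bounded_derivs_inverse[OF m, of M "real N * Ks", where 'n='n] by (elim exE conjE)
  define L1 where "L1 = 2 ^ M * (2 ^ M * KP * Kb) * L"
  have "bounded_derivs M S i L1 (\<lambda>z. cnj (P z) * Q (c' *\<^sub>R z + w') * inverse (\<Sum>k\<in>I. P (c k *\<^sub>R z + w k) * cnj (P (c k *\<^sub>R z + w k))))"
    if I: "finite I" "card I \<le> N" and c: "\<And>k. k \<in> I \<Longrightarrow> \<bar>c k\<bar> \<le> \<kappa>" "\<bar>c'\<bar> \<le> \<kappa>"
      and low: "\<forall>z\<in>S. m \<le> cmod (\<Sum>k\<in>I. P (c k *\<^sub>R z + w k) * cnj (P (c k *\<^sub>R z + w k)))"
    for S and i :: 'n and I :: "nat set" and c w c' w'
  proof -
    have "bounded_derivs M S i Ks (\<lambda>z. P (c k *\<^sub>R z + w k) * cnj (P (c k *\<^sub>R z + w k)))" if "k \<in> I" for k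
    proof -
      have "bounded_derivs M S i Ka (\<lambda>z. P (c k *\<^sub>R z + w k))"
        unfolding Ka_def by (rule bounded_derivs_affine[OF c(1)[OF that] \<kappa> P(2) P(1)])
      then show ?thesis unfolding Ks_def by (intro bounded_derivs_mult bounded_derivs_cnj K0)
    qed
    then have "bounded_derivs M S i (real (card I) * Ks) (\<lambda>z. \<Sum>k\<in>I. P (c k *\<^sub>R z + w k) * cnj (P (c k *\<^sub>R z + w k)))"
      by (rule bounded_derivs_sum[OF I(1)])
    then have "bounded_derivs M S i (real N * Ks) (\<lambda>z. \<Sum>k\<in>I. P (c k *\<^sub>R z + w k) * cnj (P (c k *\<^sub>R z + w k)))"
      by (rule bounded_derivs_mono) (use I(2) Ks in \<open>auto intro: mult_right_mono\<close>)
    then have inv: "bounded_derivs M S i L (\<lambda>z. inverse (\<Sum>k\<in>I. P (c k *\<^sub>R z + w k) * cnj (P (c k *\<^sub>R z + w k))))"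
      using L(2)[rule_format, OF conjI] low by (simp only: Ball_def)
    have 1: "bounded_derivs M S i KP (\<lambda>z. cnj (P z))"
      by (intro bounded_derivs_cnj bounded_derivs_subset[OF P(1)]) simp
    have 2: "bounded_derivs M S i Kb (\<lambda>z. Q (c' *\<^sub>R z + w'))"
      unfolding Kb_def by (rule bounded_derivs_affine[OF c(2) \<kappa> Q(2) Q(1)])
    show ?thesis unfolding L1_def
      using P(2) K0 L(1) by (intro bounded_derivs_mult 1 2 inv) auto
  qed
  moreover have "0 \<le> L1" using P(2) K0 L(1) by (simp add: L1_def)
  ultimately show ?thesis by (intro exI[of _ L1] conjI allI impI) (assumption, elim conjE, simp only: Ball_def)
qed

section \<open>Frequency densities and dual symbols\<close>

definition freq_window :: "real \<Rightarrow> (real ^ 'n::finite \<Rightarrow> complex) \<Rightarrow> real ^ 'n \<Rightarrow> real ^ 'n \<Rightarrow> complex" where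
  "freq_window \<alpha> P \<xi> \<eta> = P ((\<eta> - \<xi>) /\<^sub>R norm \<xi> powr (1 - \<alpha>))"

text \<open>The sum of \<open>|P\<^sub>k|\<^sup>2\<close> over all centers. Summing over the indices with a nonzero term makes it a finite sum at every
  frequency.\<close>
definition freq_density :: "real \<Rightarrow> (real ^ 'n::finite \<Rightarrow> complex) \<Rightarrow> (nat \<Rightarrow> real ^ 'n) \<Rightarrow> real ^ 'n \<Rightarrow> complex" where
  "freq_density \<alpha> P \<xi> \<eta> = (\<Sum>k | freq_window \<alpha> P (\<xi> k) \<eta> \<noteq> 0. freq_window \<alpha> P (\<xi> k) \<eta> * cnj (freq_window \<alpha> P (\<xi> k) \<eta>))"

text \<open>Up to a constant, the factor of \<open>P\<^sub>k\<close> in the transform of a \<open>\<psi>\<close>-packet at \<open>\<omega>\<close>, in the coordinate \<open>z = (\<eta> - \<xi>\<^sub>k)/\<lambda>\<^sub>k\<close> and without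
  the phase that carries the position of the packet.\<close>
definition dual_symbol :: "real \<Rightarrow> (real ^ 'n::finite \<Rightarrow> complex) \<Rightarrow> (real ^ 'n \<Rightarrow> complex) \<Rightarrow> (nat \<Rightarrow> real ^ 'n) \<Rightarrow> nat \<Rightarrow> real ^ 'n \<Rightarrow> real ^ 'n \<Rightarrow> complex" where
  "dual_symbol \<alpha> P Q \<xi> k \<omega> z = cnj (P z) * freq_window \<alpha> Q \<omega> (\<xi> k + norm (\<xi> k) powr (1 - \<alpha>) *\<^sub>R z)
     * inverse (freq_density \<alpha> P \<xi> (\<xi> k + norm (\<xi> k) powr (1 - \<alpha>) *\<^sub>R z))"

lemma
  fixes \<phi> :: "real ^ 'n::finite \<Rightarrow> complex"
  assumes W: "subdyadic_window \<alpha> D \<phi>"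
  shows window_schwartz: "\<phi> \<in> schwartz"
    and window_real: "cnj (\<phi> t) = \<phi> t"
    and window_smooth: "smooth (fourier \<phi>)"
    and window_cont: "continuous_on UNIV (fourier \<phi>)"
    and window_support: "\<exists>C. closed C \<and> C \<subseteq> ball 0 (R1 D) \<and> (\<forall>z. z \<notin> C \<longrightarrow> fourier \<phi> z = 0)"
    and window_zero: "R1 D \<le> norm z \<Longrightarrow> fourier \<phi> z = 0"
    and window_lower: "0 < m0 D" "norm z \<le> R0 D \<Longrightarrow> m0 D \<le> cmod (fourier \<phi> z)"
    and window_radii: "0 < R1 D" "R0 D < R1 D"
    and window_inversion: "(LINT \<eta>|lborel. fourier \<phi> \<eta> * iexp (y \<bullet> \<eta>)) = (2 * pi) ^ CARD('n) * \<phi> y"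
proof -
  show schw: "\<phi> \<in> schwartz" and "0 < m0 D" and "norm z \<le> R0 D \<Longrightarrow> m0 D \<le> cmod (fourier \<phi> z)" and "R0 D < R1 D"
    using W by (auto simp: subdyadic_window_def)
  show "cnj (\<phi> t) = \<phi> t" using W by (simp add: subdyadic_window_def Reals_cnj_iff)
  show sm: "smooth (fourier \<phi>)" using W by (simp add: subdyadic_window_def)
  show cont: "continuous_on UNIV (fourier \<phi>)" by (rule smooth_cont[OF sm])
  have R: "3 * 2 powr (max (\<alpha> - 1) 0) < R0 D" "R0 D < R1 D" using W by (auto simp: subdyadic_window_def)
  have "0 < 3 * 2 powr (max (\<alpha> - 1) 0)" by simp
  then show "0 < R1 D" using R by linarith
  have sub: "closure {\<zeta>. fourier \<phi> \<zeta> \<noteq> 0} \<subseteq> ball 0 (R1 D)" using W by (simp add: subdyadic_window_def)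
  have out: "fourier \<phi> z = 0" if "z \<notin> closure {\<zeta>. fourier \<phi> \<zeta> \<noteq> 0}" for z
    using that closure_subset[of "{\<zeta>. fourier \<phi> \<zeta> \<noteq> 0}"] by blast
  show "\<exists>C. closed C \<and> C \<subseteq> ball 0 (R1 D) \<and> (\<forall>z. z \<notin> C \<longrightarrow> fourier \<phi> z = 0)"
    by (intro exI[of _ "closure {\<zeta>. fourier \<phi> \<zeta> \<noteq> 0}"] conjI allI impI closed_closure sub out)
  have zero: "fourier \<phi> z = 0" if "R1 D \<le> norm z" for z
  proof (rule out)
    have "z \<notin> ball 0 (R1 D)" using that by simp
    then show "z \<notin> closure {\<zeta>. fourier \<phi> \<zeta> \<noteq> 0}" using sub by blast
  qed
  then show "R1 D \<le> norm z \<Longrightarrow> fourier \<phi> z = 0" .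
  show "(LINT \<eta>|lborel. fourier \<phi> \<eta> * iexp (y \<bullet> \<eta>)) = (2 * pi) ^ CARD('n) * \<phi> y"
    by (rule schwartz_fourier_inversion[OF schw cont, of "R1 D"]) (simp add: zero)
qed

lemma
  assumes "subdyadic_frame_pair \<alpha> D \<phi> x \<xi>"
  shows frame_pair_window: "subdyadic_window \<alpha> D \<phi>"
    and frame_pair_centers: "subdyadic_centers \<alpha> (sep D) (rho D) \<xi>"
    and frame_pair_pos: "0 < sep D" "0 < rho D" "0 < stp D"
    and frame_pair_step: "stp D * rho D * R1 D < pi"
    and frame_pair_nodes: "x k j = (stp D * rho D * norm (\<xi> k) powr (\<alpha> - 1)) *\<^sub>R int_vec j"
    and frame_pair_norm: "1 \<le> norm (\<xi> k)"
  using assms centers_norm_ge_1 by (auto simp: subdyadic_frame_pair_def subdyadic_geometry_def subdyadic_lattice_def int_vec_def)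

lemma norm_inverse_scaleR_le_iff:
  fixes v :: "'a::real_normed_vector"
  assumes "0 < l" shows "norm (v /\<^sub>R l) \<le> r \<longleftrightarrow> norm v \<le> r * l"
proof -
  have "norm (v /\<^sub>R l) = norm v / l" using assms by (simp add: divide_inverse mult.commute)
  then show ?thesis using assms by (simp add: pos_divide_le_eq)
qed

lemma freq_window_near:
  assumes "\<And>z. R \<le> norm z \<Longrightarrow> P z = 0" "R \<le> Rb" "0 < norm \<xi>" "freq_window \<alpha> P \<xi> \<eta> \<noteq> 0"
  shows "norm (\<eta> - \<xi>) \<le> Rb * norm \<xi> powr (1 - \<alpha>)"
proof -
  have l: "0 < norm \<xi> powr (1 - \<alpha>)" using assms(3) by simp
  have "norm ((\<eta> - \<xi>) /\<^sub>R norm \<xi> powr (1 - \<alpha>)) \<le> R"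
    using assms(1)[of "(\<eta> - \<xi>) /\<^sub>R norm \<xi> powr (1 - \<alpha>)"] assms(4) unfolding freq_window_def by linarith
  then have "norm (\<eta> - \<xi>) \<le> R * norm \<xi> powr (1 - \<alpha>)" by (simp only: norm_inverse_scaleR_le_iff[OF l])
  also have "\<dots> \<le> Rb * norm \<xi> powr (1 - \<alpha>)" using assms(2) by (intro mult_right_mono) auto
  finally show ?thesis .
qed

lemma freq_density_eq:
  assumes "finite J" "{k. freq_window \<alpha> P (\<xi> k) \<eta> \<noteq> 0} \<subseteq> J"
  shows "freq_density \<alpha> P \<xi> \<eta> = (\<Sum>k\<in>J. freq_window \<alpha> P (\<xi> k) \<eta> * cnj (freq_window \<alpha> P (\<xi> k) \<eta>))"
  unfolding freq_density_def using assms by (intro sum.mono_neutral_left) auto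

lemma freq_density_lower:
  assumes J: "finite J" "k \<in> J" and m: "0 \<le> m" "m \<le> cmod (f k)"
  shows "m\<^sup>2 \<le> cmod (\<Sum>k\<in>J. f k * cnj (f k))"
proof -
  have "(\<Sum>k\<in>J. f k * cnj (f k)) = complex_of_real (\<Sum>k\<in>J. (cmod (f k))\<^sup>2)"
    by (simp only: complex_norm_square[symmetric] of_real_sum)
  then have "cmod (\<Sum>k\<in>J. f k * cnj (f k)) = (\<Sum>k\<in>J. (cmod (f k))\<^sup>2)"
    by (simp only: norm_of_real) (simp add: sum_nonneg)
  moreover have "(cmod (f k))\<^sup>2 \<le> (\<Sum>k\<in>J. (cmod (f k))\<^sup>2)" using J by (intro member_le_sum) auto
  moreover have "m\<^sup>2 \<le> (cmod (f k))\<^sup>2" using m by (intro power_mono) auto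
  ultimately show ?thesis by linarith
qed

text \<open>Near \<open>\<omega>\<close> the density is a sum over one fixed finite index set, and the covering property bounds it below.\<close>
lemma
  fixes \<xi> :: "nat \<Rightarrow> real ^ 'n::finite"
  assumes \<alpha>: "0 < \<alpha>" and pair: "subdyadic_frame_pair \<alpha> D \<phi> x \<xi>" and Rb: "R1 D \<le> Rb"
    and \<omega>: "1 \<le> norm \<omega>" and near: "norm (\<eta> - \<omega>) \<le> Rb * norm \<omega> powr (1 - \<alpha>)"
  shows freq_density_near_eq: "freq_density \<alpha> (fourier \<phi>) \<xi> \<eta> = (\<Sum>k | touching \<alpha> Rb (\<xi> k) \<omega>. freq_window \<alpha> (fourier \<phi>) (\<xi> k) \<eta> * cnj (freq_window \<alpha> (fourier \<phi>) (\<xi> k) \<eta>))"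
    and freq_density_near_lower: "(m0 D)\<^sup>2 \<le> cmod (freq_density \<alpha> (fourier \<phi>) \<xi> \<eta>)"
proof -
  note W = frame_pair_window[OF pair]
  have Rpos: "0 < Rb" using window_radii(1)[OF W] Rb by linarith
  let ?J = "{k. touching \<alpha> Rb (\<xi> k) \<omega>}"
  have fin: "finite ?J"
    using touching_card_bound[OF \<alpha> Rpos frame_pair_pos(1,2)[OF pair]] frame_pair_centers[OF pair] \<omega> by blast
  have sub: "k \<in> ?J" if "freq_window \<alpha> (fourier \<phi>) (\<xi> k) \<eta> \<noteq> 0" for k
  proof -
    have "norm (\<eta> - \<xi> k) \<le> Rb * norm (\<xi> k) powr (1 - \<alpha>)"
      by (rule freq_window_near[OF window_zero[OF W] Rb _ that]) (use frame_pair_norm[OF pair, of k] in auto)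
    then show ?thesis using near by (auto simp: touching_def)
  qed
  show eq: "freq_density \<alpha> (fourier \<phi>) \<xi> \<eta> = (\<Sum>k\<in>?J. freq_window \<alpha> (fourier \<phi>) (\<xi> k) \<eta> * cnj (freq_window \<alpha> (fourier \<phi>) (\<xi> k) \<eta>))"
    by (rule freq_density_eq[OF fin]) (use sub in auto)
  obtain k where k: "norm (\<eta> - \<xi> k) \<le> R0 D * norm (\<xi> k) powr (1 - \<alpha>)" using frame_pair_cover[OF pair] by blast
  have l: "0 < norm (\<xi> k) powr (1 - \<alpha>)" using frame_pair_norm[OF pair, of k] by (intro powr_gt_zero[THEN iffD2]) auto
  have "norm ((\<eta> - \<xi> k) /\<^sub>R norm (\<xi> k) powr (1 - \<alpha>)) \<le> R0 D" using k by (simp only: norm_inverse_scaleR_le_iff[OF l])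
  from window_lower(2)[OF W this] have low: "m0 D \<le> cmod (freq_window \<alpha> (fourier \<phi>) (\<xi> k) \<eta>)" by (simp add: freq_window_def)
  then have "freq_window \<alpha> (fourier \<phi>) (\<xi> k) \<eta> \<noteq> 0" using window_lower(1)[OF W] by auto
  then have "k \<in> ?J" by (rule sub)
  then show "(m0 D)\<^sup>2 \<le> cmod (freq_density \<alpha> (fourier \<phi>) \<xi> \<eta>)"
    unfolding eq using window_lower(1)[OF W] low by (intro freq_density_lower[OF fin]) auto
qed

lemma freq_window_affine:
  assumes "l' = norm \<xi>' powr (1 - \<alpha>)"
  shows "freq_window \<alpha> P \<xi>' (\<xi> + l *\<^sub>R z) = P ((l / l') *\<^sub>R z + (\<xi> - \<xi>') /\<^sub>R l')"
  unfolding freq_window_def assms by (rule arg_cong[of _ _ P]) (simp add: algebra_simps divide_inverse)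

text \<open>In the unit coordinate of \<open>\<xi>\<^sub>k\<close> every factor of the dual symbol is a fixed window composed with an affine map whose
  dilation is a quotient of two scales.\<close>
lemma
  fixes \<xi> :: "nat \<Rightarrow> real ^ 'n::finite" and k :: nat and Q and \<omega> z :: "real ^ 'n" and Rb :: real
  assumes \<alpha>: "0 < \<alpha>" and pair: "subdyadic_frame_pair \<alpha> D \<phi> x \<xi>" and Rb: "R1 D \<le> Rb" and z: "z \<in> ball 0 (R1 D)"
  defines "l \<equiv> \<lambda>k. norm (\<xi> k) powr (1 - \<alpha>)"
  defines "S \<equiv> \<lambda>z. \<Sum>k' | touching \<alpha> Rb (\<xi> k') (\<xi> k). fourier \<phi> ((l k / l k') *\<^sub>R z + (\<xi> k - \<xi> k') /\<^sub>R l k') * cnj (fourier \<phi> ((l k / l k') *\<^sub>R z + (\<xi> k - \<xi> k') /\<^sub>R l k'))"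
  shows dual_symbol_ball_eq: "dual_symbol \<alpha> (fourier \<phi>) Q \<xi> k \<omega> z = cnj (fourier \<phi> z) * Q ((l k / norm \<omega> powr (1 - \<alpha>)) *\<^sub>R z + (\<xi> k - \<omega>) /\<^sub>R norm \<omega> powr (1 - \<alpha>)) * inverse (S z)"
    and dual_symbol_ball_lower: "(m0 D)\<^sup>2 \<le> cmod (S z)"
proof -
  have "l k * norm z \<le> l k * Rb" using z Rb by (intro mult_left_mono) (auto simp: l_def)
  then have near: "norm ((\<xi> k + l k *\<^sub>R z) - \<xi> k) \<le> Rb * norm (\<xi> k) powr (1 - \<alpha>)"
    by (simp add: l_def mult.commute)
  have S: "freq_density \<alpha> (fourier \<phi>) \<xi> (\<xi> k + l k *\<^sub>R z) = S z"
    unfolding freq_density_near_eq[OF \<alpha> pair Rb frame_pair_norm[OF pair] near] S_def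
    by (intro sum.cong refl) (simp only: freq_window_affine[OF meta_eq_to_obj_eq[OF l_def, THEN fun_cong]])
  show "dual_symbol \<alpha> (fourier \<phi>) Q \<xi> k \<omega> z = cnj (fourier \<phi> z) * Q ((l k / norm \<omega> powr (1 - \<alpha>)) *\<^sub>R z + (\<xi> k - \<omega>) /\<^sub>R norm \<omega> powr (1 - \<alpha>)) * inverse (S z)"
    unfolding dual_symbol_def S[symmetric] by (simp add: l_def freq_window_affine)
  show "(m0 D)\<^sup>2 \<le> cmod (S z)"
    using freq_density_near_lower[OF \<alpha> pair Rb frame_pair_norm[OF pair] near] by (simp only: S)
qed

lemma dual_symbol_zero:
  assumes "subdyadic_window \<alpha> D \<phi>" "R1 D \<le> norm z"
  shows "dual_symbol \<alpha> (fourier \<phi>) Q \<xi> k \<omega> z = 0"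
  using window_zero[OF assms] by (simp add: dual_symbol_def)

text \<open>On the open ball the symbol is a quotient with nonvanishing denominator, and off the support of \<open>P\<close> it is 0; these two
  open sets cover the space.\<close>
lemma dual_symbol_cont:
  fixes \<xi> :: "nat \<Rightarrow> real ^ 'n::finite"
  assumes \<alpha>: "0 < \<alpha>" and pair: "subdyadic_frame_pair \<alpha> D \<phi> x \<xi>" and Q: "continuous_on UNIV Q"
  shows "continuous_on UNIV (dual_symbol \<alpha> (fourier \<phi>) Q \<xi> k \<omega>)"
proof -
  note W = frame_pair_window[OF pair]
  obtain C where C: "closed C" "C \<subseteq> ball 0 (R1 D)" "\<And>z. z \<notin> C \<Longrightarrow> fourier \<phi> z = 0"
    using window_support[OF W] by blast
  note eq = dual_symbol_ball_eq[OF \<alpha> pair order_refl]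
  note low = dual_symbol_ball_lower[OF \<alpha> pair order_refl]
  have Pc: "continuous_on X (\<lambda>z. fourier \<phi> (c *\<^sub>R z + w))" for c w X
    by (rule continuous_on_compose2[OF window_cont[OF W]]) (auto intro!: continuous_intros)
  have Qc: "continuous_on X (\<lambda>z. Q (c *\<^sub>R z + w))" for c w X
    by (rule continuous_on_compose2[OF Q]) (auto intro!: continuous_intros)
  have pos: "0 < (m0 D)\<^sup>2" using window_lower(1)[OF W] by simp
  have 1: "continuous_on (ball 0 (R1 D)) (dual_symbol \<alpha> (fourier \<phi>) Q \<xi> k \<omega>)"
  proof (subst continuous_on_cong[OF refl eq], assumption)
    show "continuous_on (ball 0 (R1 D)) (\<lambda>z. cnj (fourier \<phi> z) * Q ((norm (\<xi> k) powr (1 - \<alpha>) / norm \<omega> powr (1 - \<alpha>)) *\<^sub>R z + (\<xi> k - \<omega>) /\<^sub>R norm \<omega> powr (1 - \<alpha>)) *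
       inverse (\<Sum>k' | touching \<alpha> (R1 D) (\<xi> k') (\<xi> k). fourier \<phi> ((norm (\<xi> k) powr (1 - \<alpha>) / norm (\<xi> k') powr (1 - \<alpha>)) *\<^sub>R z + (\<xi> k - \<xi> k') /\<^sub>R norm (\<xi> k') powr (1 - \<alpha>)) *
          cnj (fourier \<phi> ((norm (\<xi> k) powr (1 - \<alpha>) / norm (\<xi> k') powr (1 - \<alpha>)) *\<^sub>R z + (\<xi> k - \<xi> k') /\<^sub>R norm (\<xi> k') powr (1 - \<alpha>)))))"
    proof (intro continuous_on_mult continuous_on_inverse continuous_on_sum continuous_on_cnj Pc Qc ballI)
      show "continuous_on (ball 0 (R1 D)) (fourier \<phi>)" by (rule continuous_on_subset[OF window_cont[OF W]]) simp
      fix z :: "real ^ 'n" assume "z \<in> ball 0 (R1 D)"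
      from low[OF this, of k] pos
      show "(\<Sum>k' | touching \<alpha> (R1 D) (\<xi> k') (\<xi> k). fourier \<phi> ((norm (\<xi> k) powr (1 - \<alpha>) / norm (\<xi> k') powr (1 - \<alpha>)) *\<^sub>R z + (\<xi> k - \<xi> k') /\<^sub>R norm (\<xi> k') powr (1 - \<alpha>)) *
          cnj (fourier \<phi> ((norm (\<xi> k) powr (1 - \<alpha>) / norm (\<xi> k') powr (1 - \<alpha>)) *\<^sub>R z + (\<xi> k - \<xi> k') /\<^sub>R norm (\<xi> k') powr (1 - \<alpha>)))) \<noteq> 0"
        by (auto simp del: sum_eq_0_iff)
    qed
  qed
  have 2: "continuous_on (- C) (dual_symbol \<alpha> (fourier \<phi>) Q \<xi> k \<omega>)"
    by (subst continuous_on_cong[OF refl, of _ _ "\<lambda>_. 0"]) (auto simp: dual_symbol_def C(3))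
  have "continuous_on (ball 0 (R1 D) \<union> - C) (dual_symbol \<alpha> (fourier \<phi>) Q \<xi> k \<omega>)"
    using C(1) by (intro continuous_on_open_Un 1 2) auto
  moreover have "ball 0 (R1 D) \<union> - C = UNIV" using C(2) by blast
  ultimately show ?thesis by simp
qed

text \<open>Uniform over all lattices, centers and target frequencies. On the ball of radius \<open>R\<^sub>1\<close> the denominator is bounded
  below; outside the support of \<open>P\<close> the symbol vanishes, so the bounds extend to the whole space.\<close>
lemma dual_symbol_bounded_derivs:
  fixes \<phi> \<psi> :: "real ^ 'n::finite \<Rightarrow> complex"
  assumes \<alpha>: "0 < \<alpha>" and W: "subdyadic_window \<alpha> D \<phi>" and W': "subdyadic_window \<alpha> D' \<psi>"
    and pos: "0 < sep D" "0 < rho D" and Rb: "R1 D \<le> Rb" "R1 D' \<le> Rb"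
  shows "\<exists>L\<ge>0. \<forall>x \<xi> \<omega> k i. subdyadic_frame_pair \<alpha> D \<phi> x \<xi> \<and> 1 \<le> norm \<omega> \<and> touching \<alpha> Rb (\<xi> k) \<omega> \<longrightarrow>
     bounded_derivs M UNIV i L (dual_symbol \<alpha> (fourier \<phi>) (fourier \<psi>) \<xi> k \<omega>)"
proof -
  have Rpos: "0 < Rb" using window_radii(1)[OF W] Rb by linarith
  obtain \<kappa> where \<kappa>: "1 \<le> \<kappa>" "\<And>\<xi> \<xi>' :: real ^ 'n. 1 \<le> norm \<xi> \<Longrightarrow> 1 \<le> norm \<xi>' \<Longrightarrow> touching \<alpha> Rb \<xi> \<xi>' \<Longrightarrow> norm \<xi> powr (1 - \<alpha>) \<le> \<kappa> * norm \<xi>' powr (1 - \<alpha>)"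
    using touching_powr_le[OF \<alpha> Rpos, of "1 - \<alpha>", where 'n='n] by blast
  obtain N where N: "\<And>(\<xi> :: nat \<Rightarrow> real ^ 'n) \<omega>. subdyadic_centers \<alpha> (sep D) (rho D) \<xi> \<Longrightarrow> 1 \<le> norm \<omega> \<Longrightarrow>
     finite {k. touching \<alpha> Rb (\<xi> k) \<omega>} \<and> card {k. touching \<alpha> Rb (\<xi> k) \<omega>} \<le> N"
    using touching_card_bound[OF \<alpha> Rpos pos, where 'n='n] by blast
  obtain KP where KP: "0 \<le> KP" "\<And>i. bounded_derivs M UNIV i KP (fourier \<phi>)"
    using smooth_compact_support_bounded_derivs[OF window_smooth[OF W], of "R1 D" M] window_zero[OF W] by fastforce
  obtain KQ where KQ: "0 \<le> KQ" "\<And>i. bounded_derivs M UNIV i KQ (fourier \<psi>)"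
    using smooth_compact_support_bounded_derivs[OF window_smooth[OF W'], of "R1 D'" M] window_zero[OF W'] by fastforce
  have m: "0 < (m0 D)\<^sup>2" using window_lower(1)[OF W] by simp
  obtain L where L: "0 \<le> L" and q: "\<forall>S (i::'n) (I::nat set) c w c' w'. finite I \<and> card I \<le> N \<and> (\<forall>k\<in>I. \<bar>c k\<bar> \<le> \<kappa>) \<and> \<bar>c'\<bar> \<le> \<kappa> \<and>
     (\<forall>z\<in>S. (m0 D)\<^sup>2 \<le> cmod (\<Sum>k\<in>I. fourier \<phi> (c k *\<^sub>R z + w k) * cnj (fourier \<phi> (c k *\<^sub>R z + w k)))) \<longrightarrow>
     bounded_derivs M S i L (\<lambda>z. cnj (fourier \<phi> z) * fourier \<psi> (c' *\<^sub>R z + w') * inverse (\<Sum>k\<in>I. fourier \<phi> (c k *\<^sub>R z + w k) * cnj (fourier \<phi> (c k *\<^sub>R z + w k))))"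
    using quotient_bounded_derivs[OF KP(2,1) KQ(2,1) \<kappa>(1) m, of N] by (elim exE conjE)
  obtain C where C: "closed C" "C \<subseteq> ball 0 (R1 D)" "\<And>z. z \<notin> C \<Longrightarrow> fourier \<phi> z = 0"
    using window_support[OF W] by blast
  have "bounded_derivs M UNIV i L (dual_symbol \<alpha> (fourier \<phi>) (fourier \<psi>) \<xi> k \<omega>)"
    if pair: "subdyadic_frame_pair \<alpha> D \<phi> x \<xi>" and \<omega>: "1 \<le> norm \<omega>" and t: "touching \<alpha> Rb (\<xi> k) \<omega>" for x \<xi> \<omega> k i
  proof (rule bounded_derivs_extend[OF open_ball C(1,2) L])
    show "dual_symbol \<alpha> (fourier \<phi>) (fourier \<psi>) \<xi> k \<omega> z = 0" if "z \<notin> C" for z using C(3)[OF that] by (simp add: dual_symbol_def)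
    have nk: "1 \<le> norm (\<xi> k)" for k by (rule frame_pair_norm[OF pair])
    have ratio: "\<bar>norm \<zeta> powr (1 - \<alpha>) / norm \<zeta>' powr (1 - \<alpha>)\<bar> \<le> \<kappa>" if "1 \<le> norm \<zeta>" "1 \<le> norm \<zeta>'" "touching \<alpha> Rb \<zeta> \<zeta>'" for \<zeta> \<zeta>' :: "real ^ 'n"
    proof -
      have "0 < norm \<zeta>' powr (1 - \<alpha>)" using that(2) by (intro powr_gt_zero[THEN iffD2]) auto
      then show ?thesis using \<kappa>(2)[OF that] by (simp add: pos_divide_le_eq)
    qed
    show "bounded_derivs M (ball 0 (R1 D)) i L (dual_symbol \<alpha> (fourier \<phi>) (fourier \<psi>) \<xi> k \<omega>)"
    proof (rule bounded_derivs_cong[OF open_ball dual_symbol_ball_eq[OF \<alpha> pair Rb(1), symmetric]], assumption)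
      show "bounded_derivs M (ball 0 (R1 D)) i L
        (\<lambda>z. cnj (fourier \<phi> z) * fourier \<psi> ((norm (\<xi> k) powr (1 - \<alpha>) / norm \<omega> powr (1 - \<alpha>)) *\<^sub>R z + (\<xi> k - \<omega>) /\<^sub>R norm \<omega> powr (1 - \<alpha>)) *
       inverse (\<Sum>k' | touching \<alpha> Rb (\<xi> k') (\<xi> k). fourier \<phi> ((norm (\<xi> k) powr (1 - \<alpha>) / norm (\<xi> k') powr (1 - \<alpha>)) *\<^sub>R z + (\<xi> k - \<xi> k') /\<^sub>R norm (\<xi> k') powr (1 - \<alpha>)) *
          cnj (fourier \<phi> ((norm (\<xi> k) powr (1 - \<alpha>) / norm (\<xi> k') powr (1 - \<alpha>)) *\<^sub>R z + (\<xi> k - \<xi> k') /\<^sub>R norm (\<xi> k') powr (1 - \<alpha>)))))"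
        by (rule q[rule_format], intro conjI ballI ratio nk \<omega> t dual_symbol_ball_lower[OF \<alpha> pair Rb(1)] N[OF frame_pair_centers[OF pair] nk, THEN conjunct1] N[OF frame_pair_centers[OF pair] nk, THEN conjunct2])
          (auto simp: touching_sym)
    qed
  qed
  then show ?thesis using L by (intro exI[of _ L] conjI allI impI) (assumption, elim conjE)
qed

section \<open>Expansion of one packet in another family\<close>

text \<open>The coefficient of the \<open>\<phi>\<close>-packet with indices \<open>k\<close>, \<open>j\<close> in the expansion of the \<open>\<psi>\<close>-packet at \<open>(y, \<omega>)\<close>; \<open>s\<close> is the node step in
  the unit scale.\<close>
definition packet_coeff :: "real \<Rightarrow> real \<Rightarrow> (real ^ 'n::finite \<Rightarrow> complex) \<Rightarrow> (real ^ 'n \<Rightarrow> complex) \<Rightarrow> (nat \<Rightarrow> real ^ 'n) \<Rightarrow>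
    nat \<Rightarrow> real ^ 'n \<Rightarrow> real ^ 'n \<Rightarrow> int ^ 'n \<Rightarrow> complex" where
  "packet_coeff \<alpha> s P Q \<xi> k \<omega> y j =
     complex_of_real (norm \<omega> powr (real CARD('n) / 2 * (1 - \<alpha>)) / norm (\<xi> k) powr (real CARD('n) / 2 * (1 - \<alpha>)) *
       (s * (norm (\<xi> k) powr (1 - \<alpha>) / norm \<omega> powr (1 - \<alpha>)) / (2 * pi)) ^ CARD('n)) *
     exp (- (\<i> * complex_of_real (y \<bullet> (\<xi> k - \<omega>)))) *
     (LINT z|lborel. dual_symbol \<alpha> P Q \<xi> k \<omega> z * iexp ((s *\<^sub>R int_vec j - norm (\<xi> k) powr (1 - \<alpha>) *\<^sub>R y) \<bullet> z))"

text \<open>The part of the \<open>\<psi>\<close>-packet at \<open>(y, \<omega>)\<close> whose frequencies are cut out by \<open>|P\<^sub>k|\<^sup>2 / \<Phi>\<close>.\<close>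
definition packet_piece :: "real \<Rightarrow> (real ^ 'n::finite \<Rightarrow> complex) \<Rightarrow> (real ^ 'n \<Rightarrow> complex) \<Rightarrow> (nat \<Rightarrow> real ^ 'n) \<Rightarrow>
    nat \<Rightarrow> real ^ 'n \<Rightarrow> real ^ 'n \<Rightarrow> real ^ 'n \<Rightarrow> complex" where
  "packet_piece \<alpha> P Q \<xi> k \<omega> y t =
     complex_of_real (norm \<omega> powr (real CARD('n) / 2 * (1 - \<alpha>)) * (norm (\<xi> k) powr (1 - \<alpha>) / norm \<omega> powr (1 - \<alpha>) / (2 * pi)) ^ CARD('n)) *
     iexp (t \<bullet> \<omega>) * iexp ((t - y) \<bullet> (\<xi> k - \<omega>)) *
     (LINT z|lborel. P z * dual_symbol \<alpha> P Q \<xi> k \<omega> z * iexp ((norm (\<xi> k) powr (1 - \<alpha>) *\<^sub>R (t - y)) \<bullet> z))"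

text \<open>The sampling formula in the unit coordinate of \<open>\<xi>\<^sub>k\<close>, in which the node \<open>x k j\<close> becomes \<open>s *\<^sub>R int_vec j\<close>.\<close>
lemma packet_piece_has_sum:
  fixes \<xi> :: "nat \<Rightarrow> real ^ 'n::finite"
  assumes \<alpha>: "0 < \<alpha>" and pair: "subdyadic_frame_pair \<alpha> D \<phi> x \<xi>" and Q: "continuous_on UNIV Q"
  shows "((\<lambda>j. packet_coeff \<alpha> (stp D * rho D) (fourier \<phi>) Q \<xi> k \<omega> y j * packet \<alpha> \<phi> (x k j) (\<xi> k) t) has_sum
     packet_piece \<alpha> (fourier \<phi>) Q \<xi> k \<omega> y t) UNIV"
proof -
  note W = frame_pair_window[OF pair]
  define s where "s = stp D * rho D"
  define l where "l = norm (\<xi> k) powr (1 - \<alpha>)"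
  define m where "m = norm \<omega> powr (1 - \<alpha>)"
  define w where "w = norm \<omega> powr (real CARD('n) / 2 * (1 - \<alpha>))"
  define u where "u = norm (\<xi> k) powr (real CARD('n) / 2 * (1 - \<alpha>))"
  have nk: "0 < norm (\<xi> k)" using frame_pair_norm[OF pair, of k] by linarith
  have l: "0 < l" and u: "0 < u" using nk by (simp_all add: l_def u_def)
  have s: "0 < s" using frame_pair_pos[OF pair] by (simp add: s_def)
  let ?J = "\<lambda>j. LINT z|lborel. dual_symbol \<alpha> (fourier \<phi>) Q \<xi> k \<omega> z * iexp ((s *\<^sub>R int_vec j - l *\<^sub>R y) \<bullet> z)"
  let ?c = "complex_of_real (w * (l / m / (2 * pi)) ^ CARD('n)) * iexp (t \<bullet> \<omega>) * iexp ((t - y) \<bullet> (\<xi> k - \<omega>))"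
  have hs: "((\<lambda>j. complex_of_real (s ^ CARD('n)) * ?J j * \<phi> (l *\<^sub>R t - s *\<^sub>R int_vec j))
     has_sum (LINT z|lborel. fourier \<phi> z * dual_symbol \<alpha> (fourier \<phi>) Q \<xi> k \<omega> z * iexp ((l *\<^sub>R t - l *\<^sub>R y) \<bullet> z))) UNIV"
    by (rule windowed_fourier_series[OF s _ window_cont[OF W] window_zero[OF W] window_inversion[OF W] dual_symbol_cont[OF \<alpha> pair Q] dual_symbol_zero[OF W]])
      (use frame_pair_step[OF pair] in \<open>simp add: s_def\<close>)
  have "packet_coeff \<alpha> s (fourier \<phi>) Q \<xi> k \<omega> y j * packet \<alpha> \<phi> (x k j) (\<xi> k) t
     = ?c * (complex_of_real (s ^ CARD('n)) * ?J j * \<phi> (l *\<^sub>R t - s *\<^sub>R int_vec j))" for j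
  proof -
    have "l *\<^sub>R (t - x k j) = l *\<^sub>R t - s *\<^sub>R int_vec j"
    proof -
      have "l * (stp D * rho D * norm (\<xi> k) powr (\<alpha> - 1)) = s * (norm (\<xi> k) powr (1 - \<alpha>) * norm (\<xi> k) powr (\<alpha> - 1))"
        by (simp add: l_def s_def)
      also have "norm (\<xi> k) powr (1 - \<alpha>) * norm (\<xi> k) powr (\<alpha> - 1) = 1" using nk by (simp flip: powr_add)
      finally show ?thesis by (simp add: frame_pair_nodes[OF pair] scaleR_diff_right)
    qed
    then have pk: "packet \<alpha> \<phi> (x k j) (\<xi> k) t = complex_of_real u * \<phi> (l *\<^sub>R t - s *\<^sub>R int_vec j) * iexp (t \<bullet> \<xi> k)"
      unfolding packet_def u_def l_def by simp
    have co: "packet_coeff \<alpha> s (fourier \<phi>) Q \<xi> k \<omega> y j = complex_of_real (w / u * (s * (l / m) / (2 * pi)) ^ CARD('n)) * exp (- (\<i> * complex_of_real (y \<bullet> (\<xi> k - \<omega>)))) * ?J j"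
      unfolding packet_coeff_def w_def u_def l_def m_def ..
    have e: "exp (- (\<i> * complex_of_real (y \<bullet> (\<xi> k - \<omega>)))) * iexp (t \<bullet> \<xi> k)
       = iexp (t \<bullet> \<omega>) * iexp ((t - y) \<bullet> (\<xi> k - \<omega>))"
      by (simp add: exp_add[symmetric] inner_diff_left inner_diff_right algebra_simps)
    have r: "w / u * (s * (l / m) / (2 * pi)) ^ CARD('n) * u = w * (l / m / (2 * pi)) ^ CARD('n) * s ^ CARD('n)"
      using u by (simp add: power_mult_distrib power_divide)
    have "packet_coeff \<alpha> s (fourier \<phi>) Q \<xi> k \<omega> y j * packet \<alpha> \<phi> (x k j) (\<xi> k) t
      = complex_of_real (w / u * (s * (l / m) / (2 * pi)) ^ CARD('n) * u) * (exp (- (\<i> * complex_of_real (y \<bullet> (\<xi> k - \<omega>)))) * iexp (t \<bullet> \<xi> k)) * ?J j * \<phi> (l *\<^sub>R t - s *\<^sub>R int_vec j)"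
      unfolding pk co by (simp only: of_real_mult mult_ac)
    also have "\<dots> = ?c * (complex_of_real (s ^ CARD('n)) * ?J j * \<phi> (l *\<^sub>R t - s *\<^sub>R int_vec j))"
      unfolding r e by (simp only: of_real_mult mult_ac)
    finally show ?thesis .
  qed
  moreover have "packet_piece \<alpha> (fourier \<phi>) Q \<xi> k \<omega> y t = ?c * (LINT z|lborel. fourier \<phi> z * dual_symbol \<alpha> (fourier \<phi>) Q \<xi> k \<omega> z * iexp ((l *\<^sub>R t - l *\<^sub>R y) \<bullet> z))"
    unfolding packet_piece_def w_def l_def m_def by (simp only: scaleR_diff_right)
  ultimately show ?thesis using has_sum_cmult_right[OF hs, of ?c] by (simp only: s_def)
qed

text \<open>Insert \<open>1 = \<Sum>\<^sub>k |P\<^sub>k|\<^sup>2 / \<Phi>\<close> into the inversion formula for \<open>\<psi>\<close>; on the support of the dilated window of \<open>\<psi>\<close> only windows that touch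
  contribute. In each term pass to the unit coordinate of \<open>\<xi>\<^sub>k\<close>.\<close>
lemma packet_eq_sum_pieces:
  fixes \<xi> :: "nat \<Rightarrow> real ^ 'n::finite" and \<psi> :: "real ^ 'n \<Rightarrow> complex"
  assumes \<alpha>: "0 < \<alpha>" and pair: "subdyadic_frame_pair \<alpha> D \<phi> x \<xi>" and W': "subdyadic_window \<alpha> D' \<psi>"
    and Rb: "R1 D \<le> Rb" "R1 D' \<le> Rb" and \<omega>: "1 \<le> norm \<omega>"
  shows "packet \<alpha> \<psi> y \<omega> t = (\<Sum>k | touching \<alpha> Rb (\<xi> k) \<omega>. packet_piece \<alpha> (fourier \<phi>) (fourier \<psi>) \<xi> k \<omega> y t)"
proof -
  note W = frame_pair_window[OF pair]
  let ?J = "{k. touching \<alpha> Rb (\<xi> k) \<omega>}"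
  define d where "d = CARD('n)"
  define l where "l k = norm (\<xi> k) powr (1 - \<alpha>)" for k
  define m where "m = norm \<omega> powr (1 - \<alpha>)"
  have l: "0 < l k" for k using frame_pair_norm[OF pair, of k] unfolding l_def by (intro powr_gt_zero[THEN iffD2]) auto
  have m: "0 < m" using \<omega> unfolding m_def by (intro powr_gt_zero[THEN iffD2]) auto
  let ?B = "\<lambda>k. dual_symbol \<alpha> (fourier \<phi>) (fourier \<psi>) \<xi> k \<omega>"
  define F where "F k z = fourier \<phi> z * ?B k z * iexp ((l k *\<^sub>R (t - y)) \<bullet> z)" for k z
  define e where "e k = iexp ((t - y) \<bullet> (\<xi> k - \<omega>))" for k
  \<comment> \<open>The unit coordinate of \<open>\<xi>\<^sub>k\<close> as a function of the unit coordinate \<open>w\<close> of \<open>\<omega>\<close>.\<close>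
  define Z where "Z k w = (\<omega> - \<xi> k) /\<^sub>R l k + (m / l k) *\<^sub>R w" for k w
  have Fc: "continuous_on UNIV (F k)" for k
    unfolding F_def by (intro continuous_intros window_cont[OF W] dual_symbol_cont[OF \<alpha> pair window_cont[OF W']])
  have Fm: "F k \<in> borel_measurable borel" for k by (rule borel_measurable_continuous_onI[OF Fc])
  have F0: "F k z = 0" if "R1 D < norm z" for k z using window_zero[OF W, of z] that by (simp add: F_def)
  have Fi: "integrable lborel (F k)" for k by (rule continuous_compact_support_integrable[OF Fc F0])
  have ml: "m / l k \<noteq> 0" for k using m l[of k] by simp
  have Gi: "integrable lborel (\<lambda>w. e k * F k (Z k w))" for k
    unfolding Z_def by (intro integrable_mult_right) (subst lborel_integrable_affine[OF ml Fm], rule Fi)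
  have Gint: "(LINT w|lborel. e k * F k (Z k w)) = complex_of_real ((l k / m) ^ d) * (e k * (LINT z|lborel. F k z))" for k
  proof -
    have "(LINT w|lborel. F k (Z k w)) = (LINT z|lborel. F k z) /\<^sub>R \<bar>m / l k\<bar> ^ d"
      unfolding Z_def d_def by (subst lborel_integral_affine[OF ml Fm]) simp
    also have "\<dots> = complex_of_real ((l k / m) ^ d) * (LINT z|lborel. F k z)"
      using m l[of k] by (simp add: scaleR_conv_of_real power_divide)
    finally show ?thesis by (subst integral_mult_right_zero) (simp only: mult_ac)
  qed
  have pt: "fourier \<psi> w * iexp ((m *\<^sub>R (t - y)) \<bullet> w) = (\<Sum>k\<in>?J. e k * F k (Z k w))" for w
  proof -
    define \<eta> where "\<eta> = \<omega> + m *\<^sub>R w"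
    have Z: "Z k w = (\<eta> - \<xi> k) /\<^sub>R l k" for k unfolding Z_def \<eta>_def by (simp add: algebra_simps divide_inverse)
    have centre_eq: "\<xi> k + l k *\<^sub>R Z k w = \<eta>" for k using l[of k] by (simp add: Z)
    have Qw: "freq_window \<alpha> (fourier \<psi>) \<omega> \<eta> = fourier \<psi> w" unfolding freq_window_def m_def[symmetric] \<eta>_def using m by simp
    let ?f = "\<lambda>k. freq_window \<alpha> (fourier \<phi>) (\<xi> k) \<eta>"
    have ex: "e k * iexp ((l k *\<^sub>R (t - y)) \<bullet> Z k w) = iexp ((m *\<^sub>R (t - y)) \<bullet> w)" for k
    proof -
      have "(t - y) \<bullet> (\<xi> k - \<omega>) + (l k *\<^sub>R (t - y)) \<bullet> Z k w = (t - y) \<bullet> ((\<xi> k + l k *\<^sub>R Z k w) - \<omega>)"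
        by (simp add: inner_add_right inner_diff_right)
      also have "\<dots> = (m *\<^sub>R (t - y)) \<bullet> w" unfolding centre_eq by (simp add: \<eta>_def)
      finally have "complex_of_real ((t - y) \<bullet> (\<xi> k - \<omega>)) + complex_of_real ((l k *\<^sub>R (t - y)) \<bullet> Z k w) = complex_of_real ((m *\<^sub>R (t - y)) \<bullet> w)"
        by (simp only: of_real_add[symmetric])
      then show ?thesis unfolding e_def by (simp only: exp_add[symmetric] distrib_left[symmetric])
    qed
    have P: "fourier \<phi> (Z k w) = ?f k" for k by (simp add: freq_window_def Z l_def)
    have Bk: "?B k (Z k w) = cnj (?f k) * fourier \<psi> w * inverse (freq_density \<alpha> (fourier \<phi>) \<xi> \<eta>)" for k
      unfolding dual_symbol_def l_def[symmetric] centre_eq Qw P ..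
    have trm: "e k * F k (Z k w) = (fourier \<psi> w * iexp ((m *\<^sub>R (t - y)) \<bullet> w) * inverse (freq_density \<alpha> (fourier \<phi>) \<xi> \<eta>)) * (?f k * cnj (?f k))" for k
      unfolding F_def Bk P ex[of k, symmetric] by (simp only: mult_ac)
    show ?thesis
    proof (cases "fourier \<psi> w = 0")
      case True
      then show ?thesis unfolding trm by simp
    next
      case False
      have "norm w \<le> Rb" using window_zero[OF W', of w] False Rb(2) by linarith
      then have near: "norm (\<eta> - \<omega>) \<le> Rb * norm \<omega> powr (1 - \<alpha>)"
        unfolding \<eta>_def m_def[symmetric] using m by (simp add: mult.commute[of m] mult_right_mono)
      have nz: "freq_density \<alpha> (fourier \<phi>) \<xi> \<eta> \<noteq> 0"
        using freq_density_near_lower[OF \<alpha> pair Rb(1) \<omega> near] window_lower(1)[OF W] by auto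
      have "(\<Sum>k\<in>?J. e k * F k (Z k w)) = (fourier \<psi> w * iexp ((m *\<^sub>R (t - y)) \<bullet> w) * inverse (freq_density \<alpha> (fourier \<phi>) \<xi> \<eta>)) * freq_density \<alpha> (fourier \<phi>) \<xi> \<eta>"
        unfolding trm by (subst (2) freq_density_near_eq[OF \<alpha> pair Rb(1) \<omega> near]) (simp only: sum_distrib_left)
      then show ?thesis using nz by simp
    qed
  qed
  have "(2 * pi) ^ d * \<psi> (m *\<^sub>R (t - y)) = (LINT w|lborel. fourier \<psi> w * iexp ((m *\<^sub>R (t - y)) \<bullet> w))"
    unfolding d_def by (rule window_inversion[OF W', symmetric])
  also have "\<dots> = (\<Sum>k\<in>?J. complex_of_real ((l k / m) ^ d) * (e k * (LINT z|lborel. F k z)))"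
    unfolding pt by (subst Bochner_Integration.integral_sum[OF Gi]) (simp only: Gint)
  finally have main: "complex_of_real ((2 * pi) ^ d) * \<psi> (m *\<^sub>R (t - y)) = (\<Sum>k\<in>?J. complex_of_real ((l k / m) ^ d) * (e k * (LINT z|lborel. F k z)))" .
  have p0: "complex_of_real ((2 * pi) ^ d) \<noteq> 0" by simp
  have "\<psi> (m *\<^sub>R (t - y)) = (\<Sum>k\<in>?J. complex_of_real ((l k / m) ^ d) * (e k * (LINT z|lborel. F k z))) / complex_of_real ((2 * pi) ^ d)"
    unfolding main[symmetric] using p0 by simp
  then have "packet \<alpha> \<psi> y \<omega> t = complex_of_real (norm \<omega> powr (real CARD('n) / 2 * (1 - \<alpha>))) *
      ((\<Sum>k\<in>?J. complex_of_real ((l k / m) ^ d) * (e k * (LINT z|lborel. F k z))) / complex_of_real ((2 * pi) ^ d)) * iexp (t \<bullet> \<omega>)"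
    unfolding packet_def m_def[symmetric] by simp
  also have "\<dots> = (\<Sum>k\<in>?J. packet_piece \<alpha> (fourier \<phi>) (fourier \<psi>) \<xi> k \<omega> y t)"
    unfolding sum_divide_distrib sum_distrib_left sum_distrib_right
  proof (rule sum.cong[OF refl])
    fix k
    have "complex_of_real ((l k / m) ^ d) / complex_of_real ((2 * pi) ^ d) = complex_of_real ((l k / m / (2 * pi)) ^ d)"
      by (simp only: of_real_divide[symmetric] power_divide[symmetric])
    then show "complex_of_real (norm \<omega> powr (real CARD('n) / 2 * (1 - \<alpha>))) * (complex_of_real ((l k / m) ^ d) * (e k * (LINT z|lborel. F k z)) / complex_of_real ((2 * pi) ^ d)) * iexp (t \<bullet> \<omega>)
       = packet_piece \<alpha> (fourier \<phi>) (fourier \<psi>) \<xi> k \<omega> y t"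
      unfolding packet_piece_def F_def e_def l_def[symmetric] m_def[symmetric] d_def[symmetric] of_real_mult
      by (simp add: field_simps)
  qed
  finally show ?thesis .
qed

lemma dual_symbol_integral_decay:
  fixes \<xi> :: "nat \<Rightarrow> real ^ 'n::finite"
  assumes \<alpha>: "0 < \<alpha>" and pair: "subdyadic_frame_pair \<alpha> D \<phi> x \<xi>" and Q: "continuous_on UNIV Q"
    and bd: "\<And>i. bounded_derivs M UNIV i L (dual_symbol \<alpha> (fourier \<phi>) Q \<xi> k \<omega>)"
  defines "K \<equiv> L * measure lborel (cball 0 (R1 D) :: (real ^ 'n) set)"
  defines "J \<equiv> \<lambda>v. cmod (LINT z|lborel. dual_symbol \<alpha> (fourier \<phi>) Q \<xi> k \<omega> z * iexp (v \<bullet> z))"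
  shows "\<bar>v $ i\<bar> ^ M * J v \<le> K" and "J v \<le> K"
proof -
  note W = frame_pair_window[OF pair]
  have m: "dual_symbol \<alpha> (fourier \<phi>) Q \<xi> k \<omega> \<in> borel_measurable borel"
    by (rule borel_measurable_continuous_onI[OF dual_symbol_cont[OF \<alpha> pair Q]])
  have z: "R1 D < norm z \<Longrightarrow> dual_symbol \<alpha> (fourier \<phi>) Q \<xi> k \<omega> z = 0" for z
    by (rule dual_symbol_zero[OF W]) simp
  show "\<bar>v $ i\<bar> ^ M * J v \<le> K" unfolding J_def K_def by (rule fourier_decay[OF bd m z])
  have "bounded_derivs 0 UNIV i L (dual_symbol \<alpha> (fourier \<phi>) Q \<xi> k \<omega>)"
    using bounded_derivs_bound[OF bd] by simp
  from fourier_decay[OF this m z, where v=v] show "J v \<le> K" unfolding J_def K_def by simp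
qed

lemma packet_coeff_norm:
  assumes "0 < s"
  shows "cmod (packet_coeff \<alpha> s P Q \<xi> k \<omega> y j) =
    norm \<omega> powr (real CARD('n) / 2 * (1 - \<alpha>)) / norm (\<xi> k) powr (real CARD('n) / 2 * (1 - \<alpha>)) *
       (s * (norm (\<xi> k) powr (1 - \<alpha>) / norm \<omega> powr (1 - \<alpha>)) / (2 * pi)) ^ CARD('n) *
     cmod (LINT z|lborel. dual_symbol \<alpha> P Q \<xi> k \<omega> z * iexp ((s *\<^sub>R int_vec j - norm (\<xi> k) powr (1 - \<alpha>) *\<^sub>R (y :: real ^ 'n::finite)) \<bullet> z))"
proof -
  have "cmod (exp (- (\<i> * complex_of_real (y \<bullet> (\<xi> k - \<omega>))))) = 1" by simp
  moreover have "0 \<le> norm \<omega> powr (real CARD('n) / 2 * (1 - \<alpha>)) / norm (\<xi> k) powr (real CARD('n) / 2 * (1 - \<alpha>)) *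
       (s * (norm (\<xi> k) powr (1 - \<alpha>) / norm \<omega> powr (1 - \<alpha>)) / (2 * pi)) ^ CARD('n)"
    using assms by simp
  ultimately show ?thesis unfolding packet_coeff_def by (simp only: norm_mult norm_of_real abs_of_nonneg mult_1_right)
qed

text \<open>Decay of order \<open>2 * CARD('n)\<close>, uniformly over everything but the windows and the geometric constants. The argument of the
  weight is the distance of the nodes measured in the scale of \<open>\<xi>\<^sub>k\<close>.\<close>
lemma packet_coeff_bound:
  fixes \<phi> \<psi> :: "real ^ 'n::finite \<Rightarrow> complex"
  assumes \<alpha>: "0 < \<alpha>" and W: "subdyadic_window \<alpha> D \<phi>" and W': "subdyadic_window \<alpha> D' \<psi>"
    and pos: "0 < sep D" "0 < rho D" "0 < stp D" and Rb: "R1 D \<le> Rb" "R1 D' \<le> Rb"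
  shows "\<exists>L>0. \<forall>x \<xi> \<omega> k y j. subdyadic_frame_pair \<alpha> D \<phi> x \<xi> \<and> 1 \<le> norm \<omega> \<and> touching \<alpha> Rb (\<xi> k) \<omega> \<longrightarrow>
     cmod (packet_coeff \<alpha> (stp D * rho D) (fourier \<phi>) (fourier \<psi>) \<xi> k \<omega> y j)
       \<le> L * lattice_weight ((stp D * rho D) *\<^sub>R int_vec j - norm (\<xi> k) powr (1 - \<alpha>) *\<^sub>R y)"
proof -
  define s where "s = stp D * rho D"
  have s: "0 < s" using pos by (simp add: s_def)
  have Rpos: "0 < Rb" using window_radii(1)[OF W] Rb by linarith
  obtain \<kappa> where \<kappa>: "1 \<le> \<kappa>" "\<And>\<xi> \<xi>' :: real ^ 'n. 1 \<le> norm \<xi> \<Longrightarrow> 1 \<le> norm \<xi>' \<Longrightarrow> touching \<alpha> Rb \<xi> \<xi>' \<Longrightarrow> norm \<xi> powr (1 - \<alpha>) \<le> \<kappa> * norm \<xi>' powr (1 - \<alpha>)"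
    using touching_powr_le[OF \<alpha> Rpos, of "1 - \<alpha>", where 'n='n] by blast
  let ?e = "real CARD('n) / 2 * (1 - \<alpha>)"
  obtain \<kappa>' where \<kappa>': "1 \<le> \<kappa>'" "\<And>\<xi> \<xi>' :: real ^ 'n. 1 \<le> norm \<xi> \<Longrightarrow> 1 \<le> norm \<xi>' \<Longrightarrow> touching \<alpha> Rb \<xi> \<xi>' \<Longrightarrow> norm \<xi> powr ?e \<le> \<kappa>' * norm \<xi>' powr ?e"
    using touching_powr_le[OF \<alpha> Rpos, of ?e, where 'n='n] by blast
  obtain L0 where L0: "0 \<le> L0" "\<And>x \<xi> \<omega> k i. subdyadic_frame_pair \<alpha> D \<phi> x \<xi> \<Longrightarrow> 1 \<le> norm \<omega> \<Longrightarrow> touching \<alpha> Rb (\<xi> k) \<omega> \<Longrightarrow>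
     bounded_derivs (2 * CARD('n)) UNIV i L0 (dual_symbol \<alpha> (fourier \<phi>) (fourier \<psi>) \<xi> k \<omega>)"
    using dual_symbol_bounded_derivs[OF \<alpha> W W' pos(1,2) Rb, of "2 * CARD('n)"] by metis
  define K where "K = L0 * measure lborel (cball 0 (R1 D) :: (real ^ 'n) set)"
  have K: "0 \<le> K" using L0(1) by (simp add: K_def)
  define A where "A = \<kappa>' * (s * \<kappa> / (2 * pi)) ^ CARD('n)"
  have A: "0 \<le> A" using \<kappa>(1) \<kappa>'(1) s by (simp add: A_def)
  define L where "L = A * ((1 + real CARD('n)) ^ (2 * CARD('n)) * K) + 1"
  have "cmod (packet_coeff \<alpha> s (fourier \<phi>) (fourier \<psi>) \<xi> k \<omega> y j) \<le> L * lattice_weight (s *\<^sub>R int_vec j - norm (\<xi> k) powr (1 - \<alpha>) *\<^sub>R y)"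
    if pair: "subdyadic_frame_pair \<alpha> D \<phi> x \<xi>" and \<omega>: "1 \<le> norm \<omega>" and t: "touching \<alpha> Rb (\<xi> k) \<omega>" for x \<xi> \<omega> k y j
  proof -
    let ?v = "s *\<^sub>R int_vec j - norm (\<xi> k) powr (1 - \<alpha>) *\<^sub>R y"
    define J where "J = cmod (LINT z|lborel. dual_symbol \<alpha> (fourier \<phi>) (fourier \<psi>) \<xi> k \<omega> z * iexp (?v \<bullet> z))"
    have nk: "1 \<le> norm (\<xi> k)" by (rule frame_pair_norm[OF pair])
    have J: "J \<le> (1 + real CARD('n)) ^ (2 * CARD('n)) * K * lattice_weight ?v"
      unfolding J_def K_def
      by (rule decay_lattice_weight[OF norm_ge_zero dual_symbol_integral_decay[OF \<alpha> pair window_cont[OF W'] L0(2)[OF pair \<omega> t]]])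
    have 1: "norm \<omega> powr ?e / norm (\<xi> k) powr ?e \<le> \<kappa>'"
    proof -
      have "0 < norm (\<xi> k) powr ?e" using nk by (intro powr_gt_zero[THEN iffD2]) auto
      then show ?thesis using \<kappa>'(2)[OF \<omega> nk] t by (simp add: pos_divide_le_eq touching_sym)
    qed
    have 2: "(s * (norm (\<xi> k) powr (1 - \<alpha>) / norm \<omega> powr (1 - \<alpha>)) / (2 * pi)) ^ CARD('n) \<le> (s * \<kappa> / (2 * pi)) ^ CARD('n)"
    proof -
      have "0 < norm \<omega> powr (1 - \<alpha>)" using \<omega> by (intro powr_gt_zero[THEN iffD2]) auto
      then have "norm (\<xi> k) powr (1 - \<alpha>) / norm \<omega> powr (1 - \<alpha>) \<le> \<kappa>" using \<kappa>(2)[OF nk \<omega> t] by (simp add: pos_divide_le_eq)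
      then show ?thesis using s by (intro power_mono divide_right_mono mult_left_mono) auto
    qed
    have "cmod (packet_coeff \<alpha> s (fourier \<phi>) (fourier \<psi>) \<xi> k \<omega> y j) \<le> A * J"
      unfolding packet_coeff_norm[OF s] J_def A_def using 1 2 s \<kappa>'(1) by (intro mult_right_mono mult_mono) auto
    also have "\<dots> \<le> A * ((1 + real CARD('n)) ^ (2 * CARD('n)) * K * lattice_weight ?v)" using J A by (rule mult_left_mono)
    also have "\<dots> \<le> L * lattice_weight ?v" using lattice_weight_pos[of ?v] by (simp add: L_def distrib_right)
    finally show ?thesis .
  qed
  moreover have "0 < L" using A K by (simp add: L_def add_nonneg_pos)
  ultimately show ?thesis unfolding s_def by (intro exI[of _ L] conjI allI impI) (assumption, elim conjE)
qed

text \<open>Decay of every order \<open>N\<close>, with a constant that may depend on the lattice, the center and the node. It serves the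
  convergence of the expansion in the Schwartz space, where all orders occur.\<close>
lemma packet_coeff_rapid:
  fixes \<phi> \<psi> :: "real ^ 'n::finite \<Rightarrow> complex"
  assumes \<alpha>: "0 < \<alpha>" and pair: "subdyadic_frame_pair \<alpha> D \<phi> x \<xi>" and W': "subdyadic_window \<alpha> D' \<psi>"
    and Rb: "R1 D \<le> Rb" "R1 D' \<le> Rb" and \<omega>: "1 \<le> norm \<omega>" and t: "touching \<alpha> Rb (\<xi> k) \<omega>"
  shows "\<exists>C. \<forall>j. cmod (packet_coeff \<alpha> (stp D * rho D) (fourier \<phi>) (fourier \<psi>) \<xi> k \<omega> y j) * (1 + norm (int_vec j)) ^ N \<le> C"
proof -
  note W = frame_pair_window[OF pair]
  define s where "s = stp D * rho D"
  have s: "0 < s" using frame_pair_pos[OF pair] by (simp add: s_def)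
  define l where "l = norm (\<xi> k) powr (1 - \<alpha>)"
  have l: "0 \<le> l" by (simp add: l_def)
  obtain L0 where L0: "0 \<le> L0" "\<And>x \<xi> \<omega> k i. subdyadic_frame_pair \<alpha> D \<phi> x \<xi> \<Longrightarrow> 1 \<le> norm \<omega> \<Longrightarrow> touching \<alpha> Rb (\<xi> k) \<omega> \<Longrightarrow>
     bounded_derivs N UNIV i L0 (dual_symbol \<alpha> (fourier \<phi>) (fourier \<psi>) \<xi> k \<omega>)"
    using dual_symbol_bounded_derivs[OF \<alpha> W W' frame_pair_pos(1,2)[OF pair] Rb, of N] by metis
  define K where "K = (1 + real CARD('n)) ^ N * (L0 * measure lborel (cball 0 (R1 D) :: (real ^ 'n) set))"
  define J where "J v = cmod (LINT z|lborel. dual_symbol \<alpha> (fourier \<phi>) (fourier \<psi>) \<xi> k \<omega> z * iexp (v \<bullet> z))" for v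
  have J: "(1 + norm v) ^ N * J v \<le> K" for v
    unfolding J_def K_def
    by (rule decay_norm[OF norm_ge_zero dual_symbol_integral_decay[OF \<alpha> pair window_cont[OF W'] L0(2)[OF pair \<omega> t]]])
  define c where "c = norm \<omega> powr (real CARD('n) / 2 * (1 - \<alpha>)) / norm (\<xi> k) powr (real CARD('n) / 2 * (1 - \<alpha>)) *
       (s * (norm (\<xi> k) powr (1 - \<alpha>) / norm \<omega> powr (1 - \<alpha>)) / (2 * pi)) ^ CARD('n)"
  have c: "0 \<le> c" using s by (simp add: c_def)
  define A where "A = 1 + l * norm y / s + 1 / s"
  have "cmod (packet_coeff \<alpha> s (fourier \<phi>) (fourier \<psi>) \<xi> k \<omega> y j) * (1 + norm (int_vec j)) ^ N \<le> c * A ^ N * K" for j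
  proof -
    let ?v = "s *\<^sub>R int_vec j - l *\<^sub>R y"
    have "norm (s *\<^sub>R int_vec j) \<le> norm ?v + norm (l *\<^sub>R y)" using norm_triangle_ineq[of ?v "l *\<^sub>R y"] by simp
    then have "norm (int_vec j) \<le> (norm ?v + l * norm y) / s" using s l by (simp add: pos_le_divide_eq mult.commute)
    then have "1 + norm (int_vec j) \<le> 1 + l * norm y / s + norm ?v * (1 / s)" by (simp add: add_divide_distrib)
    also have "\<dots> \<le> A * (1 + norm ?v)"
    proof -
      have "0 \<le> l * norm y / s * norm ?v" using s l by simp
      then show ?thesis using s by (simp add: A_def algebra_simps)
    qed
    finally have "(1 + norm (int_vec j)) ^ N \<le> (A * (1 + norm ?v)) ^ N" by (intro power_mono) auto
    then have "c * J ?v * (1 + norm (int_vec j)) ^ N \<le> c * J ?v * (A * (1 + norm ?v)) ^ N"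
      using c by (intro mult_left_mono) (auto simp: J_def)
    also have "\<dots> = c * A ^ N * ((1 + norm ?v) ^ N * J ?v)" by (simp only: power_mult_distrib mult_ac)
    also have "\<dots> \<le> c * A ^ N * K" using c s l by (intro mult_left_mono J) (auto simp: A_def)
    finally show ?thesis unfolding packet_coeff_norm[OF s] J_def c_def l_def .
  qed
  then show ?thesis unfolding s_def by blast
qed

section \<open>Comparison of the norms\<close>

lemma infinite_int_vec: "infinite (UNIV :: (int ^ 'n::finite) set)"
proof
  assume "finite (UNIV :: (int ^ 'n) set)"
  then have "finite (range (\<lambda>a::int. (\<chi> i. a) :: int ^ 'n))" by (rule finite_subset[rotated]) simp
  moreover have "inj (\<lambda>a::int. (\<chi> i. a) :: int ^ 'n)" by (auto simp: inj_def vec_eq_iff)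
  ultimately show False using finite_imageD infinite_UNIV_int by blast
qed

text \<open>The seminorms of packets grow polynomially in the node index, the coefficients decay rapidly; hence the conjugated series
  converges in the Schwartz space.\<close>
lemma pairing_packet_series:
  fixes \<phi> :: "real ^ 'n::finite \<Rightarrow> complex" and a :: "int ^ 'n \<Rightarrow> complex"
  assumes f: "tempered_distribution f" and \<phi>: "\<phi> \<in> schwartz" and real: "\<And>t. cnj (\<phi> t) = \<phi> t" and \<xi>: "1 \<le> norm \<xi>"
    and rapid: "\<And>N. \<exists>C. \<forall>j. cmod (a j) * (1 + norm (int_vec j)) ^ N \<le> C"
    and hs: "\<And>t. ((\<lambda>j. a j * packet \<alpha> \<phi> (\<sigma> *\<^sub>R int_vec j) \<xi> t) has_sum g t) UNIV"
  shows "(\<lambda>t. cnj (g t)) \<in> schwartz"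
    and "ennreal (cmod (f (\<lambda>t. cnj (g t)))) \<le> infsum (\<lambda>j. ennreal (cmod (a j)) * ennreal (cmod (pairing f (packet \<alpha> \<phi> (\<sigma> *\<^sub>R int_vec j) \<xi>)))) UNIV"
proof -
  define e where "e = from_nat_into (UNIV :: (int ^ 'n) set)"
  have e: "bij_betw e UNIV UNIV" unfolding e_def by (rule bij_betw_from_nat_into) (auto simp: infinite_int_vec)
  then have inj_e: "inj e" by (simp add: bij_betw_def)
  define l where "l = norm \<xi> powr (1 - \<alpha>)"
  define w where "w = norm \<xi> powr (real CARD('n) / 2 * (1 - \<alpha>))"
  have l: "0 < l" and w: "0 \<le> w" using \<xi> unfolding l_def w_def by auto
  let ?W = "\<lambda>j. wave l (\<sigma> *\<^sub>R int_vec j) (- \<xi>) \<phi>"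
  have cp: "cnj (packet \<alpha> \<phi> (\<sigma> *\<^sub>R int_vec j) \<xi> t) = complex_of_real w * ?W j t" for j t
    unfolding packet_def wave_def w_def[symmetric] l_def[symmetric]
    by (simp add: real exp_cnj)
  have Ws: "?W j \<in> schwartz" for j by (rule wave_schwartz[OF \<phi> l])
  define u where "u n = (\<lambda>t. (cnj (a (e n)) * complex_of_real w) * ?W (e n) t)" for n
  have u: "u n \<in> schwartz" for n unfolding u_def by (rule schwartz_mult[OF Ws])
  have su: "summable (\<lambda>n. schwartz_seminorm N is (u n))" for N "is"
  proof -
    obtain C where C: "0 \<le> C" "\<And>x t. (1 + norm t) ^ N * cmod (partial_derivs is (wave l x (- \<xi>) \<phi>) t) \<le> C * (1 + norm x) ^ N"
      using wave_schwartz_bound[OF \<phi> l, of N "is" "- \<xi>"] by blast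
    obtain A where A: "\<And>j. cmod (a j) * (1 + norm (int_vec j)) ^ (N + 2 * CARD('n)) \<le> A" using rapid by blast
    define B where "B = w * C * (1 + \<bar>\<sigma>\<bar>) ^ N * A"
    have le: "schwartz_seminorm N is (u n) \<le> B * lattice_weight (int_vec (e n))" for n
    proof (rule schwartz_seminorm_le)
      fix t
      let ?j = "e n"
      have p: "0 < (1 + norm (int_vec ?j)) ^ (2 * CARD('n))" by (simp add: add_pos_nonneg)
      have "partial_derivs is (u n) t = (cnj (a ?j) * complex_of_real w) * partial_derivs is (?W ?j) t"
        using partial_derivs_lincomb[OF schwartz_smooth[OF Ws] schwartz_smooth[OF Ws], of "is" "cnj (a ?j) * complex_of_real w" ?j 0 ?j] by (simp add: u_def)
      then have "(1 + norm t) ^ N * cmod (partial_derivs is (u n) t) = cmod (a ?j) * w * ((1 + norm t) ^ N * cmod (partial_derivs is (?W ?j) t))"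
        using w by (simp add: norm_mult)
      also have "\<dots> \<le> cmod (a ?j) * w * (C * (1 + norm (\<sigma> *\<^sub>R int_vec ?j)) ^ N)"
        using w by (intro mult_left_mono C(2)) auto
      also have "\<dots> \<le> cmod (a ?j) * w * (C * ((1 + \<bar>\<sigma>\<bar>) * (1 + norm (int_vec ?j))) ^ N)"
      proof -
        have "1 + norm (\<sigma> *\<^sub>R int_vec ?j) \<le> (1 + \<bar>\<sigma>\<bar>) * (1 + norm (int_vec ?j))" by (simp add: algebra_simps)
        then show ?thesis using w C(1) by (intro mult_left_mono power_mono) auto
      qed
      also have "\<dots> = w * C * (1 + \<bar>\<sigma>\<bar>) ^ N * (cmod (a ?j) * (1 + norm (int_vec ?j)) ^ N)"
        by (simp only: power_mult_distrib mult_ac)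
      also have "\<dots> \<le> w * C * (1 + \<bar>\<sigma>\<bar>) ^ N * (A * (1 / (1 + norm (int_vec ?j)) ^ (2 * CARD('n))))"
      proof (rule mult_left_mono)
        have "cmod (a ?j) * (1 + norm (int_vec ?j)) ^ N * (1 + norm (int_vec ?j)) ^ (2 * CARD('n)) \<le> A"
          using A[of ?j] by (simp add: power_add mult.assoc)
        then show "cmod (a ?j) * (1 + norm (int_vec ?j)) ^ N \<le> A * (1 / (1 + norm (int_vec ?j)) ^ (2 * CARD('n)))"
          using p by (simp add: pos_le_divide_eq)
      qed (use w C in auto)
      also have "\<dots> = B * (1 / (1 + norm (int_vec ?j)) ^ (2 * CARD('n)))" by (simp add: B_def)
      also have "\<dots> \<le> B * lattice_weight (int_vec ?j)"
      proof (intro mult_left_mono lattice_weight_le_norm)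
        have "0 \<le> A" by (rule order_trans[OF _ A[of 0]]) simp
        then show "0 \<le> B" using w C(1) by (simp add: B_def)
      qed
      finally show "(1 + norm t) ^ N * cmod (partial_derivs is (u n) t) \<le> B * lattice_weight (int_vec (e n))" .
    qed
    have "summable (\<lambda>n. B * lattice_weight (int_vec (e n)))"
    proof (rule summable_mult)
      obtain S where S: "\<And>\<sigma> (v :: real ^ 'n) F. 1 \<le> \<sigma> \<Longrightarrow> finite F \<Longrightarrow> (\<Sum>j\<in>F. lattice_weight (\<sigma> *\<^sub>R int_vec j - v)) \<le> S"
        using lattice_weight_sum[of 1, where 'n='n, folded int_vec_def] by (metis zero_less_one)
      have "(\<Sum>n<m. lattice_weight (int_vec (e n))) \<le> S" for m
      proof -
        have "(\<Sum>n<m. lattice_weight (int_vec (e n))) = (\<Sum>j\<in>e ` {..<m}. lattice_weight (int_vec j))"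
          by (rule sum.reindex[symmetric, unfolded o_def]) (rule inj_on_subset[OF inj_e], simp)
        also have "\<dots> \<le> S" using S[of 1 "e ` {..<m}" 0] by simp
        finally show ?thesis .
      qed
      then show "summable (\<lambda>n. lattice_weight (int_vec (e n)))"
        by (intro summableI_nonneg_bounded[of _ S] less_imp_le[OF lattice_weight_pos])
    qed
    then show ?thesis
    proof (rule summable_comparison_test[rotated], intro exI[of _ 0] allI impI)
      show "norm (schwartz_seminorm N is (u n)) \<le> B * lattice_weight (int_vec (e n))" for n
        using le[of n] schwartz_seminorm_nonneg[OF u, of N "is" n] by (simp only: real_norm_def abs_of_nonneg)
    qed
  qed
  have g: "(\<lambda>t. cnj (g t)) = (\<lambda>t. \<Sum>n. u n t)"
  proof
    fix t
    have "((\<lambda>n. a (e n) * packet \<alpha> \<phi> (\<sigma> *\<^sub>R int_vec (e n)) \<xi> t) has_sum g t) UNIV"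
      using hs[of t] has_sum_reindex_bij_betw[OF e, of "\<lambda>j. a j * packet \<alpha> \<phi> (\<sigma> *\<^sub>R int_vec j) \<xi> t" "g t"] by simp
    then have "(\<lambda>n. a (e n) * packet \<alpha> \<phi> (\<sigma> *\<^sub>R int_vec (e n)) \<xi> t) sums g t" by (rule has_sum_imp_sums)
    then have "(\<lambda>n. cnj (a (e n) * packet \<alpha> \<phi> (\<sigma> *\<^sub>R int_vec (e n)) \<xi> t)) sums cnj (g t)" by (simp only: sums_cnj)
    then have "(\<lambda>n. u n t) sums cnj (g t)" by (simp only: complex_cnj_mult cp u_def mult.assoc)
    then show "cnj (g t) = (\<Sum>n. u n t)" by (rule sums_unique)
  qed
  show "(\<lambda>t. cnj (g t)) \<in> schwartz" unfolding g by (rule schwartz_series[OF u su])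
  have fu: "f (u n) = cnj (a (e n)) * pairing f (packet \<alpha> \<phi> (\<sigma> *\<^sub>R int_vec (e n)) \<xi>)" for n
    unfolding pairing_def cp u_def mult.assoc by (rule tempered_mult[OF f schwartz_mult[OF Ws]])
  have lim: "(\<lambda>m. ennreal (cmod (\<Sum>n<m. f (u n)))) \<longlonglongrightarrow> ennreal (cmod (f (\<lambda>t. cnj (g t))))"
    using tempered_sums[OF f u su] unfolding g sums_def by (intro tendsto_ennrealI tendsto_norm)
  let ?T = "\<lambda>j. ennreal (cmod (a j)) * ennreal (cmod (pairing f (packet \<alpha> \<phi> (\<sigma> *\<^sub>R int_vec j) \<xi>)))"
  have "ennreal (cmod (\<Sum>n<m. f (u n))) \<le> infsum ?T UNIV" for m
  proof -
    have "ennreal (cmod (\<Sum>n<m. f (u n))) \<le> ennreal (\<Sum>n<m. cmod (f (u n)))" by (intro ennreal_leI norm_sum)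
    also have "\<dots> = (\<Sum>n<m. ?T (e n))" by (simp add: fu norm_mult ennreal_mult flip: sum_ennreal)
    also have "\<dots> = (\<Sum>j\<in>e ` {..<m}. ?T j)"
      by (rule sum.reindex[symmetric, unfolded o_def]) (rule inj_on_subset[OF inj_e], simp)
    also have "\<dots> \<le> infsum ?T UNIV" by (rule ennreal_sum_le_infsum) simp
    finally show ?thesis .
  qed
  then show "ennreal (cmod (f (\<lambda>t. cnj (g t)))) \<le> infsum ?T UNIV"
    by (intro LIMSEQ_le_const2[OF lim]) auto
qed

text \<open>Apply the distribution term by term to the expansion of the \<open>\<psi>\<close>-packet.\<close>
lemma pairing_packet_le:
  fixes \<xi> :: "nat \<Rightarrow> real ^ 'n::finite" and \<psi> :: "real ^ 'n \<Rightarrow> complex"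
  assumes \<alpha>: "0 < \<alpha>" and pair: "subdyadic_frame_pair \<alpha> D \<phi> x \<xi>" and W': "subdyadic_window \<alpha> D' \<psi>"
    and Rb: "R1 D \<le> Rb" "R1 D' \<le> Rb" and \<omega>: "1 \<le> norm \<omega>" and f: "tempered_distribution f"
  shows "ennreal (cmod (pairing f (packet \<alpha> \<psi> y \<omega>))) \<le> (\<Sum>k | touching \<alpha> Rb (\<xi> k) \<omega>.
     infsum (\<lambda>j. ennreal (cmod (packet_coeff \<alpha> (stp D * rho D) (fourier \<phi>) (fourier \<psi>) \<xi> k \<omega> y j)) * ennreal (cmod (pairing f (packet \<alpha> \<phi> (x k j) (\<xi> k))))) UNIV)"
proof -
  note W = frame_pair_window[OF pair]
  let ?J = "{k. touching \<alpha> Rb (\<xi> k) \<omega>}"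
  have Rpos: "0 < Rb" using window_radii(1)[OF W] Rb by linarith
  have fin: "finite ?J"
    using touching_card_bound[OF \<alpha> Rpos frame_pair_pos(1,2)[OF pair]] frame_pair_centers[OF pair] \<omega> by blast
  let ?g = "\<lambda>k. packet_piece \<alpha> (fourier \<phi>) (fourier \<psi>) \<xi> k \<omega> y"
  let ?a = "packet_coeff \<alpha> (stp D * rho D) (fourier \<phi>) (fourier \<psi>) \<xi>"
  note hs = packet_piece_has_sum[OF \<alpha> pair window_cont[OF W'], unfolded frame_pair_nodes[OF pair]]
  have rap: "\<exists>C. \<forall>j. cmod (?a k \<omega> y j) * (1 + norm (int_vec j)) ^ N \<le> C" if "k \<in> ?J" for k N
    using packet_coeff_rapid[OF \<alpha> pair W' Rb \<omega>] that by blast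
  have S: "(\<lambda>t. cnj (?g k t)) \<in> schwartz" if "k \<in> ?J" for k
    by (rule pairing_packet_series(1)[OF f window_schwartz[OF W] window_real[OF W] frame_pair_norm[OF pair] rap[OF that] hs])
  have bound: "ennreal (cmod (f (\<lambda>t. cnj (?g k t)))) \<le> infsum (\<lambda>j. ennreal (cmod (?a k \<omega> y j)) * ennreal (cmod (pairing f (packet \<alpha> \<phi> (x k j) (\<xi> k))))) UNIV" if "k \<in> ?J" for k
    unfolding frame_pair_nodes[OF pair]
    by (rule pairing_packet_series(2)[OF f window_schwartz[OF W] window_real[OF W] frame_pair_norm[OF pair] rap[OF that] hs])
  have "pairing f (packet \<alpha> \<psi> y \<omega>) = f (\<lambda>t. \<Sum>k\<in>?J. cnj (?g k t))"
    unfolding pairing_def packet_eq_sum_pieces[OF \<alpha> pair W' Rb \<omega>] cnj_sum ..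
  also have "\<dots> = (\<Sum>k\<in>?J. f (\<lambda>t. cnj (?g k t)))" by (rule tempered_sum[OF f fin S])
  finally have "ennreal (cmod (pairing f (packet \<alpha> \<psi> y \<omega>))) \<le> ennreal (\<Sum>k\<in>?J. cmod (f (\<lambda>t. cnj (?g k t))))"
    by (simp only:) (intro ennreal_leI norm_sum)
  also have "\<dots> = (\<Sum>k\<in>?J. ennreal (cmod (f (\<lambda>t. cnj (?g k t)))))" by simp
  also have "\<dots> \<le> (\<Sum>k\<in>?J. infsum (\<lambda>j. ennreal (cmod (?a k \<omega> y j)) * ennreal (cmod (pairing f (packet \<alpha> \<phi> (x k j) (\<xi> k))))) UNIV)"
    by (rule sum_mono[OF bound])
  finally show ?thesis .
qed

lemma ennreal_infsum_finite_support:
  fixes h :: "'k \<Rightarrow> ennreal"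
  assumes "finite J"
  shows "infsum (\<lambda>k. if k \<in> J then h k else 0) UNIV = sum h J"
proof -
  have "infsum (\<lambda>k. if k \<in> J then h k else 0) UNIV = infsum h J"
    by (rule infsum_cong_neutral) auto
  then show ?thesis using assms by simp
qed

lemma lattice_weight_minus: "lattice_weight (u - v) = lattice_weight (v - u)"
  by (simp add: lattice_weight_def abs_minus_commute)

text \<open>Schur's test twice: for fixed centers \<open>m\<close>, \<open>k\<close> on the nodes, where the matrix entries are bounded by lattice weights, and
  then on the centers, where the matrix is a constant times the touching relation, which has boundedly many entries in
  each row and column.\<close>
lemma M_norm_le:
  fixes \<phi> \<psi> :: "real ^ 'n::finite \<Rightarrow> complex"
  assumes \<alpha>: "0 < \<alpha>" and W: "subdyadic_window \<alpha> D \<phi>" and W': "subdyadic_window \<alpha> D' \<psi>"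
    and pos: "0 < sep D" "0 < rho D" "0 < stp D" and pos': "0 < sep D'" "0 < rho D'" "0 < stp D'"
  shows "\<exists>C>0. \<forall>x \<xi> x' \<xi>' p q f. subdyadic_frame_pair \<alpha> D \<phi> x \<xi> \<and> subdyadic_frame_pair \<alpha> D' \<psi> x' \<xi>' \<and> 1 \<le> p \<and> 1 \<le> q \<and> tempered_distribution f \<longrightarrow>
     M_norm \<alpha> \<beta> p q \<psi> x' \<xi>' f \<le> ennreal C * M_norm \<alpha> \<beta> p q \<phi> x \<xi> f"
proof -
  define Rb where "Rb = max (R1 D) (R1 D')"
  have Rb: "R1 D \<le> Rb" "R1 D' \<le> Rb" by (simp_all add: Rb_def)
  have Rpos: "0 < Rb" using window_radii(1)[OF W] Rb by linarith
  define s where "s = stp D * rho D"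
  define s' where "s' = stp D' * rho D'"
  have s: "0 < s" "0 < s'" using pos pos' by (simp_all add: s_def s'_def)
  obtain \<kappa> where \<kappa>: "1 \<le> \<kappa>" "\<And>\<xi> \<xi>' :: real ^ 'n. 1 \<le> norm \<xi> \<Longrightarrow> 1 \<le> norm \<xi>' \<Longrightarrow> touching \<alpha> Rb \<xi> \<xi>' \<Longrightarrow> norm \<xi> powr (1 - \<alpha>) \<le> \<kappa> * norm \<xi>' powr (1 - \<alpha>)"
    using touching_powr_le[OF \<alpha> Rpos, of "1 - \<alpha>", where 'n='n] by blast
  obtain b where b: "1 \<le> b" "\<And>\<xi> \<xi>' :: real ^ 'n. 1 \<le> norm \<xi> \<Longrightarrow> 1 \<le> norm \<xi>' \<Longrightarrow> touching \<alpha> Rb \<xi> \<xi>' \<Longrightarrow> (1 + norm \<xi>) powr \<beta> \<le> b * (1 + norm \<xi>') powr \<beta>"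
    using touching_powr_le[OF \<alpha> Rpos, of \<beta>, where 'n='n] by blast
  obtain N where N: "\<And>(\<xi> :: nat \<Rightarrow> real ^ 'n) \<omega>. subdyadic_centers \<alpha> (sep D) (rho D) \<xi> \<Longrightarrow> 1 \<le> norm \<omega> \<Longrightarrow>
     finite {k. touching \<alpha> Rb (\<xi> k) \<omega>} \<and> card {k. touching \<alpha> Rb (\<xi> k) \<omega>} \<le> N"
    using touching_card_bound[OF \<alpha> Rpos pos(1,2), where 'n='n] by blast
  obtain N' where N': "\<And>(\<xi> :: nat \<Rightarrow> real ^ 'n) \<omega>. subdyadic_centers \<alpha> (sep D') (rho D') \<xi> \<Longrightarrow> 1 \<le> norm \<omega> \<Longrightarrow>
     finite {k. touching \<alpha> Rb (\<xi> k) \<omega>} \<and> card {k. touching \<alpha> Rb (\<xi> k) \<omega>} \<le> N'"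
    using touching_card_bound[OF \<alpha> Rpos pos'(1,2), where 'n='n] by blast
  obtain L where L: "0 < L" "\<And>x \<xi> \<omega> k y j. subdyadic_frame_pair \<alpha> D \<phi> x \<xi> \<Longrightarrow> 1 \<le> norm \<omega> \<Longrightarrow> touching \<alpha> Rb (\<xi> k) \<omega> \<Longrightarrow>
     cmod (packet_coeff \<alpha> s (fourier \<phi>) (fourier \<psi>) \<xi> k \<omega> y j) \<le> L * lattice_weight (s *\<^sub>R int_vec j - norm (\<xi> k) powr (1 - \<alpha>) *\<^sub>R y)"
    using packet_coeff_bound[OF \<alpha> W W' pos Rb] unfolding s_def by metis
  \<comment> \<open>In the scale of \<open>\<xi>\<^sub>k\<close> the steps of the two node lattices are \<open>s\<close> and at least \<open>s' / \<kappa>\<close>.\<close>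
  define s0 where "s0 = min s (s' / \<kappa>)"
  have s0: "0 < s0" "s0 \<le> s" "s0 \<le> s' / \<kappa>" using s \<kappa>(1) by (auto simp: s0_def)
  obtain S where S: "0 < S" "\<And>\<sigma> (v :: real ^ 'n) F. s0 \<le> \<sigma> \<Longrightarrow> finite F \<Longrightarrow> (\<Sum>j\<in>F. lattice_weight (\<sigma> *\<^sub>R int_vec j - v)) \<le> S"
    using lattice_weight_sum[OF s0(1), where 'n='n, folded int_vec_def] by metis
  define C1 where "C1 = L * S"
  have C1: "0 < C1" using L S by (simp add: C1_def)
  define C2 where "C2 = (real N)\<^sup>2 * C1 * b"
  have C2: "0 \<le> C2" using C1 b(1) by (simp add: C2_def)
  \<comment> \<open>A common bound for row sums \<open>N * C2\<close> and column sums \<open>N' * C2\<close>; the added ones keep it positive.\<close>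
  define C where "C = (real N + real N' + 1) * (C2 + 1)"
  have C: "0 < C" using C2 by (simp add: C_def)
  have "M_norm \<alpha> \<beta> p q \<psi> x' \<xi>' f \<le> ennreal C * M_norm \<alpha> \<beta> p q \<phi> x \<xi> f"
    if pair: "subdyadic_frame_pair \<alpha> D \<phi> x \<xi>" and pair': "subdyadic_frame_pair \<alpha> D' \<psi> x' \<xi>'"
      and p: "1 \<le> p" and q: "1 \<le> q" and f: "tempered_distribution f" for x \<xi> x' \<xi>' p q f
  proof -
    have nk: "1 \<le> norm (\<xi> k)" for k by (rule frame_pair_norm[OF pair])
    have nm: "1 \<le> norm (\<xi>' m)" for m by (rule frame_pair_norm[OF pair'])
    let ?J = "\<lambda>m. {k. touching \<alpha> Rb (\<xi> k) (\<xi>' m)}"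
    have J: "finite (?J m)" "card (?J m) \<le> N" for m using N[OF frame_pair_centers[OF pair] nm] by auto
    let ?J' = "\<lambda>k. {m. touching \<alpha> Rb (\<xi> k) (\<xi>' m)}"
    have J': "finite (?J' k)" "card (?J' k) \<le> N'" for k
      using N'[OF frame_pair_centers[OF pair'] nk, of k] by (auto simp: touching_sym[of \<alpha> Rb "\<xi> k"])
    define c where "c k j = ennreal (cmod (pairing f (packet \<alpha> \<phi> (x k j) (\<xi> k))))" for k j
    define c' where "c' m l = ennreal (cmod (pairing f (packet \<alpha> \<psi> (x' m l) (\<xi>' m))))" for m l
    define K where "K m k l j = ennreal (L * lattice_weight (s *\<^sub>R int_vec j - norm (\<xi> k) powr (1 - \<alpha>) *\<^sub>R x' m l))" for m k l j
    have sums: "infsum (\<lambda>j. ennreal (L * h j)) UNIV \<le> ennreal C1" if "\<And>F. finite F \<Longrightarrow> sum h F \<le> S" "\<And>j. 0 \<le> h j" for h :: "int ^ 'n \<Rightarrow> real"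
    proof (rule ennreal_infsum_le)
      fix F :: "(int ^ 'n) set" assume F: "finite F"
      have "(\<Sum>j\<in>F. ennreal (L * h j)) = ennreal (L * sum h F)"
        using L(1) that(2) by (simp add: sum_distrib_left)
      also have "\<dots> \<le> ennreal C1" unfolding C1_def using that(1)[OF F] L(1) by (intro ennreal_leI mult_left_mono) auto
      finally show "(\<Sum>j\<in>F. ennreal (L * h j)) \<le> ennreal C1" .
    qed
    have rows: "infsum (K m k l) UNIV \<le> ennreal C1" for m k l
      unfolding K_def by (intro sums S(2)[OF s0(2)] less_imp_le[OF lattice_weight_pos])
    have cols: "infsum (\<lambda>l. K m k l j) UNIV \<le> ennreal C1" if k: "k \<in> ?J m" for m k j
    proof -
      define \<sigma> where "\<sigma> = s' * (norm (\<xi> k) powr (1 - \<alpha>) / norm (\<xi>' m) powr (1 - \<alpha>))"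
      have mp: "0 < norm (\<xi>' m) powr (1 - \<alpha>)" using nm[of m] by (intro powr_gt_zero[THEN iffD2]) auto
      have inv: "norm (\<xi>' m) powr (\<alpha> - 1) = 1 / norm (\<xi>' m) powr (1 - \<alpha>)"
        using powr_minus[of "norm (\<xi>' m)" "1 - \<alpha>"] by (simp add: inverse_eq_divide)
      have x': "norm (\<xi> k) powr (1 - \<alpha>) *\<^sub>R x' m l = \<sigma> *\<^sub>R int_vec l" for l
        by (simp add: frame_pair_nodes[OF pair'] \<sigma>_def s'_def inv)
      have "norm (\<xi>' m) powr (1 - \<alpha>) \<le> \<kappa> * norm (\<xi> k) powr (1 - \<alpha>)"
        using \<kappa>(2)[OF nm nk] k by (simp add: touching_sym)
      then have "1 / \<kappa> \<le> norm (\<xi> k) powr (1 - \<alpha>) / norm (\<xi>' m) powr (1 - \<alpha>)"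
        using \<kappa>(1) mp by (simp add: field_simps)
      then have "s' * (1 / \<kappa>) \<le> \<sigma>" unfolding \<sigma>_def using s by (intro mult_left_mono) auto
      then have \<sigma>: "s0 \<le> \<sigma>" using s0(3) by simp
      show ?thesis unfolding K_def x' lattice_weight_minus[of "s *\<^sub>R int_vec j"]
        by (intro sums S(2)[OF \<sigma>] less_imp_le[OF lattice_weight_pos])
    qed
    have inner: "lp_norm p (c' m) \<le> ennreal ((real N)\<^sup>2 * C1) * (\<Sum>k\<in>?J m. lp_norm p (c k))" for m
    proof -
      have "c' m l \<le> (\<Sum>k\<in>?J m. infsum (\<lambda>j. (if k \<in> ?J m then K m k l j else 0) * c k j) UNIV)" for l
      proof -
        have "c' m l \<le> (\<Sum>k\<in>?J m. infsum (\<lambda>j. ennreal (cmod (packet_coeff \<alpha> s (fourier \<phi>) (fourier \<psi>) \<xi> k (\<xi>' m) (x' m l) j)) * c k j) UNIV)"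
          unfolding c'_def c_def s_def by (rule pairing_packet_le[OF \<alpha> pair W' Rb nm f])
        also have "\<dots> \<le> (\<Sum>k\<in>?J m. infsum (\<lambda>j. (if k \<in> ?J m then K m k l j else 0) * c k j) UNIV)"
          using L(2)[OF pair nm] unfolding K_def
          by (intro sum_mono ennreal_infsum_mono mult_right_mono) (auto intro!: ennreal_leI)
        finally show ?thesis .
      qed
      then have "lp_norm p (c' m) \<le> lp_norm p (\<lambda>l. \<Sum>k\<in>?J m. infsum (\<lambda>j. (if k \<in> ?J m then K m k l j else 0) * c k j) UNIV)"
        by (rule lp_norm_mono[OF _ p])
      also have "\<dots> \<le> ennreal ((real (card (?J m)))\<^sup>2) * (\<Sum>k\<in>?J m. lp_norm p (\<lambda>l. infsum (\<lambda>j. (if k \<in> ?J m then K m k l j else 0) * c k j) UNIV))"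
        by (rule lp_norm_sum_le[OF J(1) p])
      also have "\<dots> \<le> ennreal ((real N)\<^sup>2) * (\<Sum>k\<in>?J m. ennreal C1 * lp_norm p (c k))"
      proof (intro mult_mono sum_mono)
        show "ennreal ((real (card (?J m)))\<^sup>2) \<le> ennreal ((real N)\<^sup>2)" using J(2)[of m] by (intro ennreal_leI power_mono) auto
        fix k assume k: "k \<in> ?J m"
        have "lp_norm p (\<lambda>l. infsum (\<lambda>j. K m k l j * c k j) UNIV) \<le> ennreal C1 * lp_norm p (c k)"
          by (rule lp_norm_schur[OF rows cols[OF k] C1 p])
        then show "lp_norm p (\<lambda>l. infsum (\<lambda>j. (if k \<in> ?J m then K m k l j else 0) * c k j) UNIV) \<le> ennreal C1 * lp_norm p (c k)"
          using k by simp
      qed auto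
      also have "\<dots> = ennreal ((real N)\<^sup>2 * C1) * (\<Sum>k\<in>?J m. lp_norm p (c k))"
        using C1 by (simp add: sum_distrib_left[symmetric] ennreal_mult mult.assoc)
      finally show ?thesis .
    qed
    define U where "U k = lp_norm p (c k) * ennreal ((1 + norm (\<xi> k)) powr \<beta>)" for k
    define Ko where "Ko m k = (if k \<in> ?J m then ennreal C2 else 0)" for m k
    have outer: "lp_norm p (c' m) * ennreal ((1 + norm (\<xi>' m)) powr \<beta>) \<le> infsum (\<lambda>k. Ko m k * U k) UNIV" for m
    proof -
      have "lp_norm p (c' m) * ennreal ((1 + norm (\<xi>' m)) powr \<beta>)
         \<le> ennreal ((real N)\<^sup>2 * C1) * (\<Sum>k\<in>?J m. lp_norm p (c k)) * ennreal ((1 + norm (\<xi>' m)) powr \<beta>)"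
        by (rule mult_right_mono[OF inner]) simp
      also have "\<dots> = ennreal ((real N)\<^sup>2 * C1) * (\<Sum>k\<in>?J m. lp_norm p (c k) * ennreal ((1 + norm (\<xi>' m)) powr \<beta>))"
        by (simp only: mult.assoc sum_distrib_right)
      also have "\<dots> \<le> ennreal ((real N)\<^sup>2 * C1) * (\<Sum>k\<in>?J m. ennreal b * U k)"
      proof (intro mult_left_mono sum_mono)
        fix k assume k: "k \<in> ?J m"
        have "(1 + norm (\<xi>' m)) powr \<beta> \<le> b * (1 + norm (\<xi> k)) powr \<beta>"
          using b(2)[OF nm nk] k by (simp add: touching_sym)
        then have "ennreal ((1 + norm (\<xi>' m)) powr \<beta>) \<le> ennreal b * ennreal ((1 + norm (\<xi> k)) powr \<beta>)"
          using b(1) by (subst ennreal_mult[symmetric]) (auto intro: ennreal_leI)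
        then have "lp_norm p (c k) * ennreal ((1 + norm (\<xi>' m)) powr \<beta>) \<le> lp_norm p (c k) * (ennreal b * ennreal ((1 + norm (\<xi> k)) powr \<beta>))"
          by (rule mult_left_mono) simp
        then show "lp_norm p (c k) * ennreal ((1 + norm (\<xi>' m)) powr \<beta>) \<le> ennreal b * U k"
          by (simp only: U_def mult_ac)
      qed simp
      also have "\<dots> = (\<Sum>k\<in>?J m. ennreal C2 * U k)"
        using C1 b(1) by (simp add: C2_def sum_distrib_left[symmetric] ennreal_mult mult.assoc)
      also have "\<dots> = infsum (\<lambda>k. if k \<in> ?J m then ennreal C2 * U k else 0) UNIV"
        by (rule ennreal_infsum_finite_support[OF J(1), symmetric])
      also have "\<dots> = infsum (\<lambda>k. Ko m k * U k) UNIV"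
        by (rule infsum_cong) (simp add: Ko_def)
      finally show ?thesis .
    qed
    have "lp_norm q (\<lambda>m. lp_norm p (c' m) * ennreal ((1 + norm (\<xi>' m)) powr \<beta>)) \<le> lp_norm q (\<lambda>m. infsum (\<lambda>k. Ko m k * U k) UNIV)"
      by (rule lp_norm_mono[OF outer q])
    also have "\<dots> \<le> ennreal C * lp_norm q U"
    proof (rule lp_norm_schur[OF _ _ C q])
      have card_le: "(\<Sum>k\<in>I. ennreal C2) \<le> ennreal C" if "card I \<le> N + N'" for I :: "nat set"
      proof -
        have "(\<Sum>k\<in>I. ennreal C2) = ennreal (real (card I) * C2)"
          using C2 by (simp add: ennreal_mult ennreal_of_nat_eq_real_of_nat)
        also have "real (card I) * C2 \<le> C"
          unfolding C_def using that C2 by (intro mult_mono) auto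
        finally show ?thesis by (simp add: ennreal_leI)
      qed
      show "infsum (Ko m) UNIV \<le> ennreal C" for m
      proof -
        have "infsum (Ko m) UNIV = (\<Sum>k\<in>?J m. ennreal C2)"
          unfolding Ko_def by (rule ennreal_infsum_finite_support[OF J(1)])
        then show ?thesis using card_le[of "?J m"] J(2)[of m] by simp
      qed
      show "infsum (\<lambda>m. Ko m k) UNIV \<le> ennreal C" for k
      proof -
        have "infsum (\<lambda>m. Ko m k) UNIV = infsum (\<lambda>m. if m \<in> ?J' k then ennreal C2 else 0) UNIV"
          unfolding Ko_def by (rule infsum_cong) simp
        also have "\<dots> = (\<Sum>m\<in>?J' k. ennreal C2)" by (rule ennreal_infsum_finite_support[OF J'(1)])
        finally show ?thesis using card_le[of "?J' k"] J'(2)[of k] by simp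
      qed
    qed
    finally show ?thesis unfolding M_norm_def c_def c'_def U_def .
  qed
  then show ?thesis using C by (intro exI[of _ C] conjI allI impI) (assumption, elim conjE)
qed

theorem theorem4p8:
  fixes \<alpha> :: real and D D' :: frame_params and \<phi> \<psi> :: "real ^ 'n::finite \<Rightarrow> complex"
  assumes "0 < \<alpha>"
  shows "\<forall>\<beta>::real. \<exists>c C :: real. 0 < c \<and> c \<le> C \<and>
    (\<forall>x \<xi> x' \<xi>'. subdyadic_frame_pair \<alpha> D \<phi> x \<xi> \<and> subdyadic_frame_pair \<alpha> D' \<psi> x' \<xi>' \<longrightarrow>
      (\<forall>p q :: ennreal. 1 \<le> p \<and> 1 \<le> q \<longrightarrow>
        (\<forall>f. tempered_distribution f \<longrightarrow>
          ennreal c * M_norm \<alpha> \<beta> p q \<phi> x \<xi> f \<le> M_norm \<alpha> \<beta> p q \<psi> x' \<xi>' f \<and>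
          M_norm \<alpha> \<beta> p q \<psi> x' \<xi>' f \<le> ennreal C * M_norm \<alpha> \<beta> p q \<phi> x \<xi> f)))"
proof
  fix \<beta> :: real
  show "\<exists>c C :: real. 0 < c \<and> c \<le> C \<and>
    (\<forall>x \<xi> x' \<xi>'. subdyadic_frame_pair \<alpha> D \<phi> x \<xi> \<and> subdyadic_frame_pair \<alpha> D' \<psi> x' \<xi>' \<longrightarrow>
      (\<forall>p q :: ennreal. 1 \<le> p \<and> 1 \<le> q \<longrightarrow>
        (\<forall>f. tempered_distribution f \<longrightarrow>
          ennreal c * M_norm \<alpha> \<beta> p q \<phi> x \<xi> f \<le> M_norm \<alpha> \<beta> p q \<psi> x' \<xi>' f \<and>
          M_norm \<alpha> \<beta> p q \<psi> x' \<xi>' f \<le> ennreal C * M_norm \<alpha> \<beta> p q \<phi> x \<xi> f)))"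
  proof (cases "\<exists>x \<xi> x' \<xi>'. subdyadic_frame_pair \<alpha> D \<phi> x \<xi> \<and> subdyadic_frame_pair \<alpha> D' \<psi> x' \<xi>'")
    case False
    then show ?thesis by (intro exI[of _ 1]) auto
  next
    case True
    then obtain x0 \<xi>0 x0' \<xi>0' where ex: "subdyadic_frame_pair \<alpha> D \<phi> x0 \<xi>0" "subdyadic_frame_pair \<alpha> D' \<psi> x0' \<xi>0'" by blast
    obtain C1 where C1: "0 < C1" "\<And>x \<xi> x' \<xi>' p q f. subdyadic_frame_pair \<alpha> D \<phi> x \<xi> \<Longrightarrow> subdyadic_frame_pair \<alpha> D' \<psi> x' \<xi>' \<Longrightarrow> 1 \<le> p \<Longrightarrow> 1 \<le> q \<Longrightarrow> tempered_distribution f \<Longrightarrow>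
       M_norm \<alpha> \<beta> p q \<psi> x' \<xi>' f \<le> ennreal C1 * M_norm \<alpha> \<beta> p q \<phi> x \<xi> f"
      using M_norm_le[OF assms frame_pair_window[OF ex(1)] frame_pair_window[OF ex(2)] frame_pair_pos[OF ex(1)] frame_pair_pos[OF ex(2)], of \<beta>] by metis
    obtain C2 where C2: "0 < C2" "\<And>x \<xi> x' \<xi>' p q f. subdyadic_frame_pair \<alpha> D' \<psi> x' \<xi>' \<Longrightarrow> subdyadic_frame_pair \<alpha> D \<phi> x \<xi> \<Longrightarrow> 1 \<le> p \<Longrightarrow> 1 \<le> q \<Longrightarrow> tempered_distribution f \<Longrightarrow>
       M_norm \<alpha> \<beta> p q \<phi> x \<xi> f \<le> ennreal C2 * M_norm \<alpha> \<beta> p q \<psi> x' \<xi>' f"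
      using M_norm_le[OF assms frame_pair_window[OF ex(2)] frame_pair_window[OF ex(1)] frame_pair_pos[OF ex(2)] frame_pair_pos[OF ex(1)], of \<beta>] by metis
    \<comment> \<open>The lower estimate is the upper one with the pairs exchanged; enlarging \<open>C1\<close> to \<open>C\<close> ensures \<open>c \<le> C\<close>.\<close>
    define c where "c = 1 / C2"
    define C where "C = max C1 c"
    have both: "ennreal c * M_norm \<alpha> \<beta> p q \<phi> x \<xi> f \<le> M_norm \<alpha> \<beta> p q \<psi> x' \<xi>' f \<and>
          M_norm \<alpha> \<beta> p q \<psi> x' \<xi>' f \<le> ennreal C * M_norm \<alpha> \<beta> p q \<phi> x \<xi> f"
      if pr: "subdyadic_frame_pair \<alpha> D \<phi> x \<xi>" "subdyadic_frame_pair \<alpha> D' \<psi> x' \<xi>'" and pq: "1 \<le> p" "1 \<le> q" and f: "tempered_distribution f" for x \<xi> x' \<xi>' p q f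
    proof
      have "ennreal c * M_norm \<alpha> \<beta> p q \<phi> x \<xi> f \<le> ennreal c * (ennreal C2 * M_norm \<alpha> \<beta> p q \<psi> x' \<xi>' f)"
        by (intro mult_left_mono C2(2)[OF pr(2,1) pq f]) simp
      also have "\<dots> = (ennreal c * ennreal C2) * M_norm \<alpha> \<beta> p q \<psi> x' \<xi>' f" by (simp only: mult.assoc)
      also have "ennreal c * ennreal C2 = 1" using C2(1) by (simp add: c_def ennreal_mult[symmetric])
      also have "1 * M_norm \<alpha> \<beta> p q \<psi> x' \<xi>' f = M_norm \<alpha> \<beta> p q \<psi> x' \<xi>' f" by simp
      finally show "ennreal c * M_norm \<alpha> \<beta> p q \<phi> x \<xi> f \<le> M_norm \<alpha> \<beta> p q \<psi> x' \<xi>' f" .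
      have "ennreal C1 \<le> ennreal C" by (simp add: C_def ennreal_leI)
      then show "M_norm \<alpha> \<beta> p q \<psi> x' \<xi>' f \<le> ennreal C * M_norm \<alpha> \<beta> p q \<phi> x \<xi> f"
        using order_trans[OF C1(2)[OF pr pq f] mult_right_mono] by simp
    qed
    have cC: "0 < c" "c \<le> C" using C2(1) by (simp_all add: c_def C_def)
    show ?thesis
    proof (rule exI[of _ c], rule exI[of _ C], intro conjI[OF cC(1)] conjI[OF cC(2)] allI impI)
      fix x \<xi> x' \<xi>' and p q :: ennreal and f :: "(real ^ 'n \<Rightarrow> complex) \<Rightarrow> complex"
      assume "subdyadic_frame_pair \<alpha> D \<phi> x \<xi> \<and> subdyadic_frame_pair \<alpha> D' \<psi> x' \<xi>'" "1 \<le> p \<and> 1 \<le> q" "tempered_distribution f"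
      then show "ennreal c * M_norm \<alpha> \<beta> p q \<phi> x \<xi> f \<le> M_norm \<alpha> \<beta> p q \<psi> x' \<xi>' f \<and>
          M_norm \<alpha> \<beta> p q \<psi> x' \<xi>' f \<le> ennreal C * M_norm \<alpha> \<beta> p q \<phi> x \<xi> f"
        by (elim conjE) (rule both)
    qed
  qed
qed

end
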